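(* Let $N\ge1$ and $\phi\in(-\pi/2,\pi/2)$ with $\phi\ne -\frac{N+2}{2N+8}\pi+\frac{2k}{N+4}\pi$ for all $k\in\mathbb{Z}$ (limit-point case). Then, with respect to the standard inner product of $L^2(\mathbb{R}_\pm)$: (a) $A_{max\pm}(\tau_\pm)^*=A_{0\pm}(\tau_\pm^+)$ and $A_{0\pm}(\tau_\pm)^*=A_{max\pm}(\tau_\pm^+)$; (b) $\mathcal{T}A_{0\pm}(\tau_\pm)\mathcal{T}\subset A_{0\pm}(\tau_\pm)^*$; (c) $Q_\pm$ is a closed sector with vertex $0$ and opening angle strictly less than $\pi$, and $\mathbb{C}\setminus Q_\pm\subset\Pi(A_{0\pm}(\tau_\pm))$; in particular $\Pi(A_{0\pm}(\tau_\pm))\ne\emptyset$ and $\Pi(A_{0-}(\tau_-))\cap\Pi(A_{0+}(\tau_+))\ne\emptyset$; (d) for every $\lambda\in\Pi(A_{0\pm}(\tau_\pm))$, $\mathrm{def}(A_{0\pm}(\tau_\pm)-\lambda)=\mathrm{def}(A_{0\pm}(\tau^+_\pm)-\overline{\lambda})=1$; (e) $\dim\big(\mathrm{dom}\,A_{max\pm}(\tau_\pm)/\mathrm{dom}\,A_{0\pm}(\tau_\pm)\big)=2$.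
   Context: $\mathbb{R}_+=[0,\infty)$, $\mathbb{R}_-=(-\infty,0]$. $\tau_\pm w(x)=-e^{\mp2i\phi}w''(x)-(ix)^{N+2}e^{\pm(N+2)i\phi}w(x)$ on $\mathbb{R}_\pm$, $\tau^+_\pm w(x)=-e^{\pm2i\phi}w''(x)-(-ix)^{N+2}e^{\mp(N+2)i\phi}w(x)$. $\mathcal{T}u=\overline{u}$. For $\tau\in\{\tau_\pm,\tau_\pm^+\}$ on $\mathbb{R}_\pm$: the maximal operator $A_{max\pm}(\tau)$ acts by $w\mapsto\tau w$ on $\{w\in L^2(\mathbb{R}_\pm): w,w'\in AC_{loc}(\mathbb{R}_\pm),\ \tau w\in L^2(\mathbb{R}_\pm)\}$; the preminimal operator $A'_{0\pm}(\tau)$ is its restriction to those $w$ with $w(0)=w'(0)=0$ that vanish outside a bounded subset of $\mathbb{R}_\pm$; the minimal operator $A_{0\pm}(\tau)$ is the closure of $A'_{0\pm}(\tau)$ (which is closable). For a closed operator $T$ in $L^2$, $\mathrm{def}\,T=\dim L^2/\mathrm{ran}\,T$, and $\Pi(T)=\{\lambda\in\mathbb{C}:\exists k>0,\ \|(T-\lambda)u\|\ge k\|u\|\ \forall u\in\mathrm{dom}\,T\}$. $Q_\pm=\mathrm{clconv}\{e^{\mp2i\phi}r-(ix)^{N+2}e^{\pm(N+2)i\phi}:0<r<\infty,\ x\in\mathbb{R}_\pm\}$ (closed convex hull). *)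

theory Defs
  imports "HOL-Analysis.Analysis"
begin

definition halfline :: "real \<Rightarrow> real set" where
  "halfline s = {x. 0 \<le> s * x}"

text \<open>Elements of L2(S) are represented by (Lebesgue measurable, square integrable)
  functions; elements are identified up to equality almost everywhere.\<close>
definition L2 :: "real set \<Rightarrow> (real \<Rightarrow> complex) set" where
  "L2 S = {f. f \<in> borel_measurable (lebesgue_on S) \<and>
              integrable (lebesgue_on S) (\<lambda>x. (cmod (f x))\<^sup>2)}"

definition aeq :: "real set \<Rightarrow> (real \<Rightarrow> complex) \<Rightarrow> (real \<Rightarrow> complex) \<Rightarrow> bool" where
  "aeq S f g \<longleftrightarrow> (AE x in lebesgue_on S. f x = g x)"

definition l2inner :: "real set \<Rightarrow> (real \<Rightarrow> complex) \<Rightarrow> (real \<Rightarrow> complex) \<Rightarrow> complex" where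
  "l2inner S f g = integral\<^sup>L (lebesgue_on S) (\<lambda>x. f x * cnj (g x))"

definition l2norm :: "real set \<Rightarrow> (real \<Rightarrow> complex) \<Rightarrow> real" where
  "l2norm S f = sqrt (integral\<^sup>L (lebesgue_on S) (\<lambda>x. (cmod (f x))\<^sup>2))"

text \<open>Linear operators in L2(S) are represented by their graphs, as relations between
  representatives, saturated under a.e.-equality.\<close>
type_synonym op = "((real \<Rightarrow> complex) \<times> (real \<Rightarrow> complex)) set"

definition opdom :: "op \<Rightarrow> (real \<Rightarrow> complex) set" where
  "opdom T = fst ` T"

definition opran :: "op \<Rightarrow> (real \<Rightarrow> complex) set" where
  "opran T = snd ` T"

definition opshift :: "op \<Rightarrow> complex \<Rightarrow> op" where
  "opshift T c = {(u, \<lambda>x. f x - c * u x) | u f. (u, f) \<in> T}"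

definition adjoint :: "real set \<Rightarrow> op \<Rightarrow> op" where
  "adjoint S T = {(v, g). v \<in> L2 S \<and> g \<in> L2 S \<and>
       (\<forall>(u, f) \<in> T. l2inner S f v = l2inner S u g)}"

definition opclosure :: "real set \<Rightarrow> op \<Rightarrow> op" where
  "opclosure S T = {(u, f). u \<in> L2 S \<and> f \<in> L2 S \<and>
      (\<exists>U F. (\<forall>n. (U n, F n) \<in> T) \<and>
             (\<lambda>n. l2norm S (\<lambda>x. U n x - u x)) \<longlonglongrightarrow> 0 \<and>
             (\<lambda>n. l2norm S (\<lambda>x. F n x - f x)) \<longlonglongrightarrow> 0)}"

definition conjop :: "op \<Rightarrow> op" where
  "conjop A = {(\<lambda>x. cnj (u x), \<lambda>x. cnj (f x)) | u f. (u, f) \<in> A}"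

definition regtype :: "real set \<Rightarrow> op \<Rightarrow> complex set" where
  "regtype S T = {z. \<exists>k>0. \<forall>(u, f) \<in> T. l2norm S (\<lambda>x. f x - z * u x) \<ge> k * l2norm S u}"

text \<open>dim (L / V) = n for a subspace V of L (both sets of representatives, V saturated):
  there are n elements of L, linearly independent modulo V, spanning L modulo V.\<close>
definition quotdim :: "(real \<Rightarrow> complex) set \<Rightarrow> (real \<Rightarrow> complex) set \<Rightarrow> nat \<Rightarrow> bool" where
  "quotdim L V n \<longleftrightarrow> (\<exists>g :: nat \<Rightarrow> real \<Rightarrow> complex.
      (\<forall>i<n. g i \<in> L) \<and>
      (\<forall>c :: nat \<Rightarrow> complex. (\<lambda>x. \<Sum>i<n. c i * g i x) \<in> V \<longrightarrow> (\<forall>i<n. c i = 0)) \<and>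
      (\<forall>h\<in>L. \<exists>c :: nat \<Rightarrow> complex. (\<lambda>x. h x - (\<Sum>i<n. c i * g i x)) \<in> V))"

definition ac_loc_with_deriv :: "real set \<Rightarrow> (real \<Rightarrow> complex) \<Rightarrow> (real \<Rightarrow> complex) \<Rightarrow> bool" where
  "ac_loc_with_deriv S w w1 \<longleftrightarrow>
     (\<forall>a\<in>S. \<forall>b\<in>S. a \<le> b \<longrightarrow>
        set_integrable lborel {a..b} w1 \<and>
        w b - w a = set_lebesgue_integral lborel {a..b} w1)"

definition Amax :: "real set \<Rightarrow> complex \<Rightarrow> (real \<Rightarrow> complex) \<Rightarrow> op" where
  "Amax S a q = {(u, f). u \<in> L2 S \<and> f \<in> L2 S \<and>
      (\<exists>w w1 w2. ac_loc_with_deriv S w w1 \<and> ac_loc_with_deriv S w1 w2 \<and>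
          aeq S u w \<and> aeq S f (\<lambda>x. - a * w2 x - q x * w x))}"

definition A0pre :: "real set \<Rightarrow> complex \<Rightarrow> (real \<Rightarrow> complex) \<Rightarrow> op" where
  "A0pre S a q = {(u, f). u \<in> L2 S \<and> f \<in> L2 S \<and>
      (\<exists>w w1 w2. ac_loc_with_deriv S w w1 \<and> ac_loc_with_deriv S w1 w2 \<and>
          w 0 = 0 \<and> w1 0 = 0 \<and> (\<exists>B. bounded B \<and> (\<forall>x\<in>S - B. w x = 0)) \<and>
          aeq S u w \<and> aeq S f (\<lambda>x. - a * w2 x - q x * w x))}"

definition A0 :: "real set \<Rightarrow> complex \<Rightarrow> (real \<Rightarrow> complex) \<Rightarrow> op" where
  "A0 S a q = opclosure S (A0pre S a q)"

text \<open>Coefficients of tau_s (s = 1 for +, s = -1 for -):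
  tau_s w = - e^{-2 i s phi} w'' - (i x)^{N+2} e^{s (N+2) i phi} w,
  tau_s^+ w = - e^{2 i s phi} w'' - (-i x)^{N+2} e^{- s (N+2) i phi} w.\<close>
definition tau_a :: "real \<Rightarrow> real \<Rightarrow> complex" where
  "tau_a s \<phi> = exp (- 2 * \<i> * of_real (s * \<phi>))"

definition tau_q :: "nat \<Rightarrow> real \<Rightarrow> real \<Rightarrow> real \<Rightarrow> complex" where
  "tau_q N s \<phi> x = (\<i> * of_real x) ^ (N + 2) * exp (of_nat (N + 2) * \<i> * of_real (s * \<phi>))"

definition tauplus_a :: "real \<Rightarrow> real \<Rightarrow> complex" where
  "tauplus_a s \<phi> = exp (2 * \<i> * of_real (s * \<phi>))"

definition tauplus_q :: "nat \<Rightarrow> real \<Rightarrow> real \<Rightarrow> real \<Rightarrow> complex" where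
  "tauplus_q N s \<phi> x = (- \<i> * of_real x) ^ (N + 2) * exp (- of_nat (N + 2) * \<i> * of_real (s * \<phi>))"

definition Qset :: "nat \<Rightarrow> real \<Rightarrow> real \<Rightarrow> complex set" where
  "Qset N s \<phi> = closure (convex hull
     {tau_a s \<phi> * of_real r - tau_q N s \<phi> x | r x. 0 < r \<and> x \<in> halfline s})"

definition closed_sector_lt_pi :: "complex set \<Rightarrow> bool" where
  "closed_sector_lt_pi Q \<longleftrightarrow> (\<exists>\<theta>1 \<theta>2. \<theta>1 \<le> \<theta>2 \<and> \<theta>2 - \<theta>1 < pi \<and>
      Q = {of_real t * exp (\<i> * of_real \<theta>) | t \<theta>. 0 \<le> t \<and> \<theta>1 \<le> \<theta> \<and> \<theta> \<le> \<theta>2})"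

end

theory Submission
  imports Defs
begin

text \<open>
  Write the potential as \<open>-q x = b |x| ^ (N + 2)\<close> with \<open>|b| = 1\<close>. The condition on \<open>\<phi>\<close> says exactly that
  \<open>b \<noteq> -a\<close>, so some \<open>c\<close> satisfies \<open>Re (c a) > 0\<close> and \<open>Re (c b) > 0\<close>, and the form of \<open>c \<tau>\<close> is accretive.
  An energy estimate with a linear cutoff then shows that \<open>w'\<close> is square integrable for every \<open>w\<close> in the
  maximal domain. Two consequences follow. First, multiplication by cutoffs approximates in the graph
  norm, so the minimal domain consists of the \<open>w\<close> in the maximal domain with \<open>w 0 = w' 0 = 0\<close>; combined
  with the du Bois-Reymond lemma and Green's formula this gives the adjoints and the codimension 2.
  Second, the Wronskian of two square integrable solutions is constant and integrable, hence zero, so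
  \<open>ker (A_max - z)\<close> has dimension at most 1; it is not 0 because otherwise \<open>A_0 - z\<close> would be onto and the
  maximal domain would coincide with the minimal one. The negative half-line is reduced to the positive
  one by reflection.
\<close>

subsection \<open>Square integrable functions\<close>

text \<open>The coefficients are complex, so no operator here is symmetric and the theory of
  self-adjoint extensions does not apply. Complex conjugation takes its place: it carries the
  minimal and maximal operators of \<tau> to those of the formal adjoint, so the class of operators
  treated is closed under it, and the orthogonal complement of a range becomes the conjugate of a
  kernel for \<tau> itself. The unbounded potential is never estimated. Its sign after
  multiplication by \<open>c\<close> lets its term be discarded from the energy estimate, and it
  commutes with cutoffs, so only derivatives of the cutoff produce errors. A suitable
  \<open>c\<close> is the conjugate of \<open>a + b\<close>, which turns the bisector of the two
  unit vectors onto the positive real axis. Elements of L2 are functions up to almost everywhere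
  equality, whereas boundary values exist only for the locally absolutely continuous representative.
  Limits in the graph norm come without such a representative; for the minimal domain it is obtained
  through the adjoint of the conjugate maximal operator.\<close>

lemma L2_measurable: "f \<in> L2 S \<Longrightarrow> f \<in> borel_measurable (lebesgue_on S)"
  by (simp add: L2_def)

lemma L2_integrable_sq: "f \<in> L2 S \<Longrightarrow> integrable (lebesgue_on S) (\<lambda>x. (cmod (f x))\<^sup>2)"
  by (simp add: L2_def)

lemma L2_mult_integrable:
  assumes "f \<in> L2 S" "g \<in> L2 S"
  shows "integrable (lebesgue_on S) (\<lambda>x. f x * g x)"
proof (rule Bochner_Integration.integrable_bound)
  show "integrable (lebesgue_on S) (\<lambda>x. (cmod (f x))\<^sup>2 + (cmod (g x))\<^sup>2)"
    using assms by (simp add: L2_def)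
  show "(\<lambda>x. f x * g x) \<in> borel_measurable (lebesgue_on S)"
    using assms by (intro borel_measurable_times) (auto simp: L2_def)
  have "cmod (f x) * cmod (g x) \<le> (cmod (f x))\<^sup>2 + (cmod (g x))\<^sup>2" for x
    using sum_squares_bound[of "cmod (f x)" "cmod (g x)"]
      mult_nonneg_nonneg[OF norm_ge_zero[of "f x"] norm_ge_zero[of "g x"]] by linarith
  then show "AE x in lebesgue_on S. norm (f x * g x) \<le> norm ((cmod (f x))\<^sup>2 + (cmod (g x))\<^sup>2)"
    by (simp add: norm_mult)
qed

lemma borel_measurable_cnj [measurable (raw)]:
  "f \<in> borel_measurable M \<Longrightarrow> (\<lambda>x. cnj (f x)) \<in> borel_measurable M"
  by (rule measurable_compose[OF _ borel_measurable_continuous_onI]) (auto intro: continuous_intros)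

lemma L2_cnj: "f \<in> L2 S \<Longrightarrow> (\<lambda>x. cnj (f x)) \<in> L2 S"
  by (auto simp: L2_def)

lemma L2_zero [simp]: "(\<lambda>x. 0) \<in> L2 S"
  by (auto simp: L2_def)

lemma L2_scale: "f \<in> L2 S \<Longrightarrow> (\<lambda>x. c * f x) \<in> L2 S"
  by (auto simp: L2_def norm_mult power_mult_distrib)

lemma L2_add:
  assumes "f \<in> L2 S" "g \<in> L2 S"
  shows "(\<lambda>x. f x + g x) \<in> L2 S"
proof -
  have "integrable (lebesgue_on S) (\<lambda>x. (cmod (f x + g x))\<^sup>2)"
  proof (rule Bochner_Integration.integrable_bound)
    show "integrable (lebesgue_on S) (\<lambda>x. 2 * (cmod (f x))\<^sup>2 + 2 * (cmod (g x))\<^sup>2)"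
      using assms by (simp add: L2_def)
    show "(\<lambda>x. (cmod (f x + g x))\<^sup>2) \<in> borel_measurable (lebesgue_on S)"
      using assms by (auto simp: L2_def)
    have "(cmod (f x + g x))\<^sup>2 \<le> 2 * (cmod (f x))\<^sup>2 + 2 * (cmod (g x))\<^sup>2" for x
      using power_mono[OF norm_triangle_ineq[of "f x" "g x"], of 2]
        sum_squares_bound[of "cmod (f x)" "cmod (g x)"] by (simp add: power2_sum)
    then show "AE x in lebesgue_on S. norm ((cmod (f x + g x))\<^sup>2) \<le> norm (2 * (cmod (f x))\<^sup>2 + 2 * (cmod (g x))\<^sup>2)"
      by simp
  qed
  with assms show ?thesis by (auto simp: L2_def)
qed

lemma L2_diff:
  assumes "f \<in> L2 S" "g \<in> L2 S"
  shows "(\<lambda>x. f x - g x) \<in> L2 S"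
  using L2_add[OF assms(1) L2_scale[OF assms(2), of "-1"]] by simp

lemma L2_cong:
  assumes "f \<in> L2 S" "g \<in> borel_measurable (lebesgue_on S)" "aeq S f g"
  shows "g \<in> L2 S"
proof -
  have "integrable (lebesgue_on S) (\<lambda>x. (cmod (g x))\<^sup>2)"
    by (rule integrable_cong_AE_imp[OF L2_integrable_sq[OF assms(1)]])
       (use assms in \<open>auto simp: aeq_def\<close>)
  with assms show ?thesis by (simp add: L2_def)
qed

lemma l2inner_integrable:
  "f \<in> L2 S \<Longrightarrow> g \<in> L2 S \<Longrightarrow> integrable (lebesgue_on S) (\<lambda>x. f x * cnj (g x))"
  using L2_mult_integrable[OF _ L2_cnj] .

lemma l2inner_add_left:
  assumes "f \<in> L2 S" "g \<in> L2 S" "h \<in> L2 S"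
  shows "l2inner S (\<lambda>x. f x + g x) h = l2inner S f h + l2inner S g h"
  unfolding l2inner_def distrib_right
  by (rule Bochner_Integration.integral_add) (use assms l2inner_integrable in auto)

lemma l2inner_diff_left:
  assumes "f \<in> L2 S" "g \<in> L2 S" "h \<in> L2 S"
  shows "l2inner S (\<lambda>x. f x - g x) h = l2inner S f h - l2inner S g h"
  unfolding l2inner_def left_diff_distrib
  by (rule Bochner_Integration.integral_diff) (use assms l2inner_integrable in auto)

lemma l2inner_scale_left: "l2inner S (\<lambda>x. c * f x) h = c * l2inner S f h"
  unfolding l2inner_def by (simp add: mult.assoc)

lemma l2inner_commute: "l2inner S g f = cnj (l2inner S f g)"
  unfolding l2inner_def by (simp flip: Bochner_Integration.integral_cnj add: mult.commute)

lemma l2inner_diff_right: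
  assumes "f \<in> L2 S" "g \<in> L2 S" "h \<in> L2 S"
  shows "l2inner S h (\<lambda>x. f x - g x) = l2inner S h f - l2inner S h g"
  using l2inner_diff_left[OF assms] l2inner_commute[of S h] by simp

lemma l2inner_add_right:
  assumes "f \<in> L2 S" "g \<in> L2 S" "h \<in> L2 S"
  shows "l2inner S h (\<lambda>x. f x + g x) = l2inner S h f + l2inner S h g"
  using l2inner_add_left[OF assms] l2inner_commute[of S h] by simp

lemma l2inner_scale_right: "l2inner S h (\<lambda>x. c * f x) = cnj c * l2inner S h f"
  using l2inner_scale_left[of S c f h] l2inner_commute[of S h] by simp

lemma l2norm_sq: "(l2norm S f)\<^sup>2 = integral\<^sup>L (lebesgue_on S) (\<lambda>x. (cmod (f x))\<^sup>2)"
  by (simp add: l2norm_def)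

lemma l2norm_nonneg [simp]: "0 \<le> l2norm S f"
  by (simp add: l2norm_def)

lemma l2inner_self: "l2inner S f f = of_real ((l2norm S f)\<^sup>2)"
  unfolding l2norm_sq l2inner_def complex_norm_square[symmetric] by (simp del: of_real_power)

lemma l2norm_scale: "l2norm S (\<lambda>x. c * f x) = cmod c * l2norm S f"
  by (simp add: l2norm_def norm_mult power_mult_distrib real_sqrt_mult)

lemma l2norm_minus_commute: "l2norm S (\<lambda>x. f x - g x) = l2norm S (\<lambda>x. g x - f x)"
  by (simp add: l2norm_def norm_minus_commute)

lemma l2norm_cnj: "l2norm S (\<lambda>x. cnj (f x)) = l2norm S f"
  by (simp add: l2norm_def)

lemma l2norm_eq_0_iff:
  assumes "f \<in> L2 S"
  shows "l2norm S f = 0 \<longleftrightarrow> aeq S f (\<lambda>x. 0)"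
  using integral_nonneg_eq_0_iff_AE[OF L2_integrable_sq[OF assms]] by (simp add: l2norm_def aeq_def)

text \<open>Expansion of a square. Special choices of \<open>c\<close> give Cauchy-Schwarz, the
  triangle inequality, the parallelogram law and the first variation at a minimiser.\<close>

lemma l2norm_diff_scale_sq:
  assumes "f \<in> L2 S" "g \<in> L2 S"
  shows "(l2norm S (\<lambda>x. f x - c * g x))\<^sup>2
    = (l2norm S f)\<^sup>2 - 2 * Re (cnj c * l2inner S f g) + (cmod c)\<^sup>2 * (l2norm S g)\<^sup>2"
proof -
  have cg: "(\<lambda>x. c * g x) \<in> L2 S" using assms by (rule_tac L2_scale)
  have "complex_of_real ((l2norm S (\<lambda>x. f x - c * g x))\<^sup>2)
      = l2inner S f f - cnj c * l2inner S f g - (c * cnj (l2inner S f g) - c * cnj c * l2inner S g g)"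
    unfolding l2inner_self[symmetric]
    by (simp add: l2inner_diff_left l2inner_diff_right l2inner_scale_left l2inner_scale_right
        L2_diff assms cg l2inner_commute[of S g f] algebra_simps)
  also have "\<dots> = of_real ((l2norm S f)\<^sup>2) - (cnj c * l2inner S f g + cnj (cnj c * l2inner S f g))
       + of_real ((cmod c)\<^sup>2) * of_real ((l2norm S g)\<^sup>2)"
    unfolding l2inner_self complex_norm_square by simp
  also have "\<dots> = of_real ((l2norm S f)\<^sup>2 - 2 * Re (cnj c * l2inner S f g) + (cmod c)\<^sup>2 * (l2norm S g)\<^sup>2)"
    unfolding complex_add_cnj by simp
  finally show ?thesis unfolding of_real_eq_iff .
qed

lemma l2inner_bound:
  assumes "f \<in> L2 S" "g \<in> L2 S"
  shows "cmod (l2inner S f g) \<le> l2norm S f * l2norm S g"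
proof -
  define I G F where "I = l2inner S f g" and "G = (l2norm S g)\<^sup>2" and "F = (l2norm S f)\<^sup>2"
  \<comment> \<open>The coefficient of \<open>g\<close> is taken as \<open>t * I\<close> with
    \<open>t\<close> real: the factor \<open>I\<close> makes the cross term real and leaves a
    quadratic in \<open>t\<close>.\<close>
  have key: "0 \<le> F - 2 * (t * (cmod I)\<^sup>2) + (t\<^sup>2 * (cmod I)\<^sup>2) * G" for t
  proof -
    have "0 \<le> F - 2 * Re (cnj (of_real t * I) * I) + (cmod (of_real t * I))\<^sup>2 * G"
      using l2norm_diff_scale_sq[OF assms, of "of_real t * I"] unfolding I_def F_def G_def
      by (metis zero_le_power2)
    moreover have "Re (cnj (of_real t * I) * I) = t * (cmod I)\<^sup>2"
      unfolding cmod_power2 by (simp add: power2_eq_square algebra_simps)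
    ultimately show ?thesis by (simp only: norm_mult power_mult_distrib norm_of_real power2_abs)
  qed
  have "(cmod I)\<^sup>2 \<le> F * G"
  proof (cases "G = 0")
    case True
    have "(cmod I)\<^sup>2 = 0"
    proof (rule ccontr)
      assume "(cmod I)\<^sup>2 \<noteq> 0"
      \<comment> \<open>For \<open>G = 0\<close> the quadratic is affine in \<open>t\<close>, and
        this \<open>t\<close> gives it the value \<open>F - 2 * (F + 1)\<close>, which is negative
        because \<open>F\<close> is a square.\<close>
      then show False using key[of "(F + 1) / (cmod I)\<^sup>2"] True
        by (simp add: F_def) (smt (verit) zero_le_power2)
    qed
    then show ?thesis using True by simp
  next
    case False
    then have "G > 0" by (simp add: G_def)
    then show ?thesis using key[of "1/G"] by (simp add: field_simps power2_eq_square)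
  qed
  then have "(cmod I)\<^sup>2 \<le> (l2norm S f * l2norm S g)\<^sup>2" by (simp add: F_def G_def power_mult_distrib)
  then show ?thesis unfolding I_def by (rule power2_le_imp_le) simp
qed

lemma l2norm_triangle_diff:
  assumes "f \<in> L2 S" "g \<in> L2 S"
  shows "l2norm S (\<lambda>x. f x - g x) \<le> l2norm S f + l2norm S g"
proof (rule power2_le_imp_le)
  have "- Re (l2inner S f g) \<le> l2norm S f * l2norm S g"
    using l2inner_bound[OF assms] abs_Re_le_cmod[of "l2inner S f g"] by linarith
  then show "(l2norm S (\<lambda>x. f x - g x))\<^sup>2 \<le> (l2norm S f + l2norm S g)\<^sup>2"
    using l2norm_diff_scale_sq[OF assms, of 1] by (simp add: power2_sum)
qed simp

lemma l2norm_triangle: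
  assumes "f \<in> L2 S" "g \<in> L2 S"
  shows "l2norm S (\<lambda>x. f x + g x) \<le> l2norm S f + l2norm S g"
  using l2norm_triangle_diff[OF assms(1) L2_scale[OF assms(2), of "-1"]]
    l2norm_scale[of S "-1" g] by simp

lemma l2norm_triangle_diff3:
  assumes "f \<in> L2 S" "g \<in> L2 S" "h \<in> L2 S"
  shows "l2norm S (\<lambda>x. f x - h x) \<le> l2norm S (\<lambda>x. f x - g x) + l2norm S (\<lambda>x. g x - h x)"
  using l2norm_triangle[OF L2_diff[OF assms(1,2)] L2_diff[OF assms(2,3)]] by simp

lemma l2inner_tendsto:
  assumes "\<And>n. F n \<in> L2 S" "\<And>n. G n \<in> L2 S" "f \<in> L2 S" "g \<in> L2 S"
    and F: "(\<lambda>n. l2norm S (\<lambda>x. F n x - f x)) \<longlonglongrightarrow> 0"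
    and G: "(\<lambda>n. l2norm S (\<lambda>x. G n x - g x)) \<longlonglongrightarrow> 0"
  shows "(\<lambda>n. l2inner S (F n) (G n)) \<longlonglongrightarrow> l2inner S f g"
proof (rule LIM_zero_cancel, rule Lim_null_comparison)
  let ?d = "\<lambda>n. l2norm S (\<lambda>x. F n x - f x)" and ?e = "\<lambda>n. l2norm S (\<lambda>x. G n x - g x)"
  show "(\<lambda>n. ?d n * (?e n + l2norm S g) + l2norm S f * ?e n) \<longlonglongrightarrow> 0"
    using F G by (auto intro!: tendsto_eq_intros)
  have "norm (l2inner S (F n) (G n) - l2inner S f g) \<le> ?d n * (?e n + l2norm S g) + l2norm S f * ?e n" for n
  proof -
    have "l2inner S (F n) (G n) - l2inner S f g
        = l2inner S (\<lambda>x. F n x - f x) (G n) + l2inner S f (\<lambda>x. G n x - g x)"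
      using assms by (simp add: l2inner_diff_left l2inner_diff_right)
    also have "norm \<dots> \<le> ?d n * l2norm S (G n) + l2norm S f * ?e n"
      using assms by (intro order_trans[OF norm_triangle_ineq] add_mono l2inner_bound L2_diff)
    also have "l2norm S (G n) \<le> ?e n + l2norm S g"
      using l2norm_triangle[OF L2_diff[OF assms(2,4)] assms(4), of n] by simp
    finally show ?thesis by (simp add: mult_left_mono)
  qed
  then show "\<forall>\<^sub>F n in sequentially. norm (l2inner S (F n) (G n) - l2inner S f g)
      \<le> ?d n * (?e n + l2norm S g) + l2norm S f * ?e n" by simp
qed

lemma l2norm_tendsto:
  assumes "\<And>n. F n \<in> L2 S" "f \<in> L2 S"
    and F: "(\<lambda>n. l2norm S (\<lambda>x. F n x - f x)) \<longlonglongrightarrow> 0"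
  shows "(\<lambda>n. l2norm S (F n)) \<longlonglongrightarrow> l2norm S f"
proof (rule LIM_zero_cancel, rule Lim_null_comparison[OF _ F])
  have "norm (l2norm S (F n) - l2norm S f) \<le> l2norm S (\<lambda>x. F n x - f x)" for n
    using l2norm_triangle[OF L2_diff[OF assms(1,2)] assms(2), of n]
      l2norm_triangle_diff[OF assms(1) L2_diff[OF assms(1,2)], of n n] by (simp add: abs_if)
  then show "\<forall>\<^sub>F n in sequentially. norm (l2norm S (F n) - l2norm S f) \<le> l2norm S (\<lambda>x. F n x - f x)"
    by simp
qed

subsection \<open>Completeness and orthogonal projection\<close>

lemma L2_nn_integral_sq:
  "f \<in> L2 S \<Longrightarrow> (\<integral>\<^sup>+x. ennreal ((cmod (f x))\<^sup>2) \<partial>lebesgue_on S) = ennreal ((l2norm S f)\<^sup>2)"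
  unfolding l2norm_sq by (rule nn_integral_eq_integral[OF L2_integrable_sq]) auto

lemma L2_if_nn_integral_le:
  assumes f: "f \<in> borel_measurable (lebesgue_on S)" and e: "0 \<le> e"
    and le: "(\<integral>\<^sup>+x. ennreal ((cmod (f x))\<^sup>2) \<partial>lebesgue_on S) \<le> ennreal (e\<^sup>2)"
  shows "f \<in> L2 S" "l2norm S f \<le> e"
proof -
  have "integrable (lebesgue_on S) (\<lambda>x. (cmod (f x))\<^sup>2)"
    using f le_less_trans[OF le ennreal_less_top] by (intro integrableI_bounded) auto
  then show *: "f \<in> L2 S" using f by (simp add: L2_def)
  show "l2norm S f \<le> e"
    using le e unfolding L2_nn_integral_sq[OF *] by (intro power2_le_imp_le[OF _ e]) (simp add: ennreal_le_iff)
qed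

text \<open>The weights \<open>2 ^ k\<close> against squared norms of size \<open>(1/4) ^ k\<close>
  still leave a convergent sum of integrals. Hence the weighted series of squared increments is
  finite almost everywhere, which forces geometric decay of the increments at such a point and
  convergence of the telescoping sum.\<close>

lemma L2_geometric_AE_convergent:
  assumes g: "\<And>k. g k \<in> L2 S"
    and le: "\<And>k. l2norm S (\<lambda>x. g (Suc k) x - g k x) \<le> (1/2) ^ k"
  shows "AE x in lebesgue_on S. convergent (\<lambda>k. g k x)"
proof -
  have [measurable]: "g k \<in> borel_measurable (lebesgue_on S)" for k using g by (rule L2_measurable)
  let ?d = "\<lambda>k x. 2 ^ k * (cmod (g (Suc k) x - g k x))\<^sup>2"
  define D where "D x = (\<Sum>k. ennreal (?d k x))" for x
  have "(\<integral>\<^sup>+x. D x \<partial>lebesgue_on S) = (\<Sum>k. (\<integral>\<^sup>+x. ennreal (?d k x) \<partial>lebesgue_on S))"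
    unfolding D_def by (rule nn_integral_suminf) measurable
  also have "\<dots> \<le> (\<Sum>k. ennreal ((1/2) ^ k))"
  proof (rule suminf_le)
    fix k
    have "(\<integral>\<^sup>+x. ennreal (?d k x) \<partial>lebesgue_on S)
        = ennreal (2 ^ k) * (\<integral>\<^sup>+x. ennreal ((cmod (g (Suc k) x - g k x))\<^sup>2) \<partial>lebesgue_on S)"
      unfolding ennreal_mult[OF zero_le_power[OF zero_le_numeral] zero_le_power2]
      by (rule nn_integral_cmult) measurable
    also have "\<dots> = ennreal (2 ^ k * (l2norm S (\<lambda>x. g (Suc k) x - g k x))\<^sup>2)"
      unfolding ennreal_mult[OF zero_le_power[OF zero_le_numeral] zero_le_power2]
        L2_nn_integral_sq[OF L2_diff[OF g g]] ..
    also have "\<dots> \<le> ennreal (2 ^ k * ((1/2) ^ k)\<^sup>2)"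
      using le[of k] by (intro ennreal_leI mult_left_mono power_mono) auto
    also have "\<dots> = ennreal ((1/2) ^ k)"
      unfolding power2_eq_square power_mult_distrib[symmetric] by simp
    finally show "(\<integral>\<^sup>+x. ennreal (?d k x) \<partial>lebesgue_on S) \<le> ennreal ((1/2) ^ k)" .
  qed (rule summableI)+
  also have "\<dots> = ennreal (1 / (1 - 1/2))"
  proof (rule suminf_ennreal_eq)
    show "(\<lambda>k. (1/2 :: real) ^ k) sums (1 / (1 - 1/2))" by (rule geometric_sums) simp
  qed simp
  also have "\<dots> < top" by (rule ennreal_less_top)
  finally have "(\<integral>\<^sup>+x. D x \<partial>lebesgue_on S) \<noteq> \<infinity>"
    unfolding infinity_ennreal_def less_top .
  moreover have "D \<in> borel_measurable (lebesgue_on S)"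
    unfolding D_def by measurable
  ultimately have "AE x in lebesgue_on S. D x \<noteq> \<infinity>"
    by (intro nn_integral_PInf_AE)
  then show ?thesis
  proof eventually_elim
    case (elim x)
    then obtain C where C: "D x = ennreal C" "0 \<le> C"
      by (cases "D x" rule: ennreal_cases) auto
    have "norm (g (Suc k) x - g k x) \<le> sqrt C * (1 / sqrt 2) ^ k" for k
    proof -
      have "(\<Sum>j\<in>{k}. ennreal (?d j x)) \<le> D x"
        unfolding D_def by (rule sum_le_suminf[OF summableI]) simp_all
      then have "ennreal (?d k x) \<le> ennreal C" unfolding C(1) by simp
      then have "?d k x \<le> C" using C(2) by (simp add: ennreal_le_iff)
      then have "(norm (g (Suc k) x - g k x))\<^sup>2 \<le> C * (1/2) ^ k"
        by (simp add: field_simps)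
      then have "norm (g (Suc k) x - g k x) \<le> sqrt (C * (1/2) ^ k)"
        by (simp add: real_le_rsqrt)
      also have "\<dots> = sqrt C * (1 / sqrt 2) ^ k"
        unfolding real_sqrt_mult real_sqrt_power real_sqrt_divide by simp
      finally show ?thesis .
    qed
    moreover have "summable (\<lambda>k. sqrt C * (1 / sqrt 2) ^ k)"
      by (intro summable_mult summable_geometric) auto
    ultimately have "summable (\<lambda>k. g (Suc k) x - g k x)"
      by (rule summable_comparison_test'[rotated])
    then have "convergent (\<lambda>n. g n x - g 0 x)"
      unfolding summable_iff_convergent sum_lessThan_telescope[of "\<lambda>k. g k x"] .
    then show "convergent (\<lambda>n. g n x)"
      using convergent_add[OF _ convergent_const[of "g 0 x"], of "\<lambda>n. g n x - g 0 x"] by simp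
  qed
qed

lemma L2_complete:
  assumes F: "\<And>n. F n \<in> L2 S"
    and cauchy: "\<And>e. 0 < e \<Longrightarrow> \<exists>N. \<forall>m\<ge>N. \<forall>n\<ge>N. l2norm S (\<lambda>x. F m x - F n x) < e"
  shows "\<exists>f\<in>L2 S. (\<lambda>n. l2norm S (\<lambda>x. F n x - f x)) \<longlonglongrightarrow> 0"
proof -
  have "\<exists>N. \<forall>k. \<forall>m\<ge>N k. \<forall>n\<ge>N k. l2norm S (\<lambda>x. F m x - F n x) < (1/2) ^ k"
    using cauchy by (intro choice) auto
  then obtain N where N: "\<And>k m n. N k \<le> m \<Longrightarrow> N k \<le> n \<Longrightarrow> l2norm S (\<lambda>x. F m x - F n x) < (1/2) ^ k"
    by blast
  \<comment> \<open>The sum makes \<open>r\<close> monotone and at least \<open>N k\<close>; the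
    extra \<open>k\<close> guarantees \<open>k \<le> r k\<close>, so the subsequence passes every
    index.\<close>
  define r where "r k = (\<Sum>i\<le>k. N i) + k" for k
  have rN: "N k \<le> r k" for k
    unfolding r_def using member_le_sum[of k "{..k}" N] by auto
  have r_mono: "r k \<le> r (Suc k)" for k by (simp add: r_def)
  define g where "g k = F (r k)" for k
  define f where "f x = lim (\<lambda>k. g k x)" for x
  have g: "g k \<in> L2 S" for k by (simp add: g_def F)
  have [measurable]: "g k \<in> borel_measurable (lebesgue_on S)" "F k \<in> borel_measurable (lebesgue_on S)" for k
    using g F by (auto intro: L2_measurable)
  have fm [measurable]: "f \<in> borel_measurable (lebesgue_on S)" unfolding f_def by measurable
  have "AE x in lebesgue_on S. convergent (\<lambda>k. g k x)"
  proof (rule L2_geometric_AE_convergent[OF g])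
    show "l2norm S (\<lambda>x. g (Suc k) x - g k x) \<le> (1/2) ^ k" for k
      unfolding g_def using N[of k "r (Suc k)" "r k"] rN[of k] r_mono[of k] by simp
  qed
  then have lim: "AE x in lebesgue_on S. (\<lambda>k. g k x) \<longlonglongrightarrow> f x"
    by (simp add: convergent_LIMSEQ_iff f_def)
  \<comment> \<open>Fatou's lemma along the subsequence. It yields membership in \<open>L2\<close>
    together with the bound, as nothing is known yet about the integrability of the pointwise
    limit.\<close>
  have *: "(\<lambda>x. F n x - f x) \<in> L2 S \<and> l2norm S (\<lambda>x. F n x - f x) \<le> e"
    if n: "\<forall>m\<ge>M. l2norm S (\<lambda>x. F n x - F m x) \<le> e" for n e M
  proof -
    have "0 \<le> e" using n l2norm_nonneg by (meson order_refl order_trans)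
    have "(\<integral>\<^sup>+x. ennreal ((cmod (F n x - f x))\<^sup>2) \<partial>lebesgue_on S)
        = (\<integral>\<^sup>+x. liminf (\<lambda>k. ennreal ((cmod (F n x - g k x))\<^sup>2)) \<partial>lebesgue_on S)"
    proof (rule nn_integral_cong_AE, use lim in eventually_elim)
      case (elim x)
      then have "(\<lambda>k. ennreal ((cmod (F n x - g k x))\<^sup>2)) \<longlonglongrightarrow> ennreal ((cmod (F n x - f x))\<^sup>2)"
        by (intro tendsto_intros)
      from lim_imp_Liminf[OF _ this] show ?case by (rule sym) simp
    qed
    also have "\<dots> \<le> liminf (\<lambda>k. (\<integral>\<^sup>+x. ennreal ((cmod (F n x - g k x))\<^sup>2) \<partial>lebesgue_on S))"
      by (rule nn_integral_liminf) measurable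
    also have "\<dots> \<le> ennreal (e\<^sup>2)"
    proof (rule Liminf_le)
      show "\<forall>\<^sub>F k in sequentially. (\<integral>\<^sup>+x. ennreal ((cmod (F n x - g k x))\<^sup>2) \<partial>lebesgue_on S) \<le> ennreal (e\<^sup>2)"
      proof (rule eventually_sequentiallyI[of M])
        fix k assume "M \<le> k"
        then have "M \<le> r k" by (simp add: r_def)
        then have "l2norm S (\<lambda>x. F n x - g k x) \<le> e" unfolding g_def using n by blast
        then show "(\<integral>\<^sup>+x. ennreal ((cmod (F n x - g k x))\<^sup>2) \<partial>lebesgue_on S) \<le> ennreal (e\<^sup>2)"
          unfolding L2_nn_integral_sq[OF L2_diff[OF F g]] by (intro ennreal_leI power_mono) auto
      qed
    qed simp
    finally show ?thesis using L2_if_nn_integral_le[of "\<lambda>x. F n x - f x" S e] \<open>0 \<le> e\<close> by auto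
  qed
  obtain N1 where "\<forall>m\<ge>N1. \<forall>n\<ge>N1. l2norm S (\<lambda>x. F m x - F n x) < 1" using cauchy[of 1] by auto
  then have "(\<lambda>x. F N1 x - f x) \<in> L2 S" using *[of N1 N1 1] by (meson less_imp_le order_refl)
  from L2_diff[OF F[of N1] this] have "f \<in> L2 S" by simp
  moreover have "(\<lambda>n. l2norm S (\<lambda>x. F n x - f x)) \<longlonglongrightarrow> 0"
  proof (rule LIMSEQ_I)
    fix e :: real assume "0 < e"
    then obtain M where M: "\<forall>m\<ge>M. \<forall>n\<ge>M. l2norm S (\<lambda>x. F m x - F n x) < e/2" using cauchy[of "e/2"] by auto
    have le: "l2norm S (\<lambda>x. F n x - f x) \<le> e/2" if "n \<ge> M" for n
      using *[of M n "e/2"] M that by (meson less_imp_le)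
    have "norm (l2norm S (\<lambda>x. F n x - f x) - 0) < e" if "n \<ge> M" for n
      using \<open>0 < e\<close> le[OF that] by simp
    then show "\<exists>no. \<forall>n\<ge>no. norm (l2norm S (\<lambda>x. F n x - f x) - 0) < e" by blast
  qed
  ultimately show ?thesis by blast
qed

text \<open>A minimising sequence for the distance from \<open>h\<close> to \<open>R\<close> is
  Cauchy by the parallelogram law, and the first variation at the limit gives orthogonality.
  Closedness is required for every representative of a limit, so no quotient by null functions has
  to be formed.\<close>

lemma L2_projection:
  assumes R: "R \<subseteq> L2 S" and zero: "(\<lambda>x. 0) \<in> R"
    and lin: "\<And>f g c. f \<in> R \<Longrightarrow> g \<in> R \<Longrightarrow> (\<lambda>x. f x + c * g x) \<in> R"
    and closed: "\<And>F f. (\<And>n. F n \<in> R) \<Longrightarrow> f \<in> L2 S \<Longrightarrow> (\<lambda>n. l2norm S (\<lambda>x. F n x - f x)) \<longlonglongrightarrow> 0 \<Longrightarrow> f \<in> R"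
    and h: "h \<in> L2 S"
  shows "\<exists>r\<in>R. \<forall>g\<in>R. l2inner S (\<lambda>x. h x - r x) g = 0"
proof -
  define D where "D = (\<lambda>r. l2norm S (\<lambda>x. h x - r x)) ` R"
  define d where "d = Inf D"
  have bdd: "bdd_below D" unfolding D_def by (intro bdd_belowI[of _ 0]) auto
  have ne: "D \<noteq> {}" using zero by (auto simp: D_def)
  have d_le: "d \<le> l2norm S (\<lambda>x. h x - r x)" if "r \<in> R" for r
    unfolding d_def using that bdd by (intro cInf_lower) (auto simp: D_def)
  have d0: "0 \<le> d" unfolding d_def using ne by (intro cInf_greatest) (auto simp: D_def)
  have "\<exists>r\<in>R. l2norm S (\<lambda>x. h x - r x) < d + 1 / (real n + 1)" for n
    using cInf_lessD[OF ne, of "d + 1 / (real n + 1)"] by (auto simp: D_def d_def)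
  then obtain r where r: "\<And>n. r n \<in> R" and rd: "\<And>n. l2norm S (\<lambda>x. h x - r n x) < d + 1 / (real n + 1)"
    by metis
  have rL: "r n \<in> L2 S" for n using r R by auto
  \<comment> \<open>Parallelogram law for \<open>h - r m\<close> and \<open>h - r n\<close>: the
    midpoint of \<open>r m\<close> and \<open>r n\<close> lies in \<open>R\<close>, so its distance
    to \<open>h\<close> is at least \<open>d\<close>.\<close>
  have par: "(l2norm S (\<lambda>x. r m x - r n x))\<^sup>2
      \<le> 2 * (l2norm S (\<lambda>x. h x - r m x))\<^sup>2 + 2 * (l2norm S (\<lambda>x. h x - r n x))\<^sup>2 - 4 * d\<^sup>2" for m n
  proof -
    note hm = L2_diff[OF h rL[of m]] note hn = L2_diff[OF h rL[of n]]
    have "(\<lambda>x. (\<lambda>x. 0 + (1/2) * r m x) x + (1/2) * r n x) \<in> R"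
      by (intro lin zero r)
    then have "d \<le> l2norm S (\<lambda>x. h x - ((1/2) * r m x + (1/2) * r n x))" using d_le by fastforce
    then have "2 * d \<le> l2norm S (\<lambda>x. 2 * (h x - ((1/2) * r m x + (1/2) * r n x)))"
      by (simp only: l2norm_scale) simp
    also have "(\<lambda>x. 2 * (h x - ((1/2) * r m x + (1/2) * r n x))) = (\<lambda>x. h x - r m x - (-1) * (h x - r n x))"
      by (auto simp: algebra_simps)
    finally have "(2 * d)\<^sup>2 \<le> (l2norm S (\<lambda>x. h x - r m x - (-1) * (h x - r n x)))\<^sup>2"
      using d0 by (intro power_mono) auto
    moreover have "(\<lambda>x. r m x - r n x) = (\<lambda>x. h x - r n x - 1 * (h x - r m x))" by auto
    ultimately show ?thesis
      using l2norm_diff_scale_sq[OF hm hn, of "-1"] l2norm_diff_scale_sq[OF hn hm, of 1]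
        l2inner_commute[of S "\<lambda>x. h x - r n x" "\<lambda>x. h x - r m x"]
      by (simp add: power_mult_distrib)
  qed
  have sq: "(l2norm S (\<lambda>x. h x - r n x))\<^sup>2 \<le> d\<^sup>2 + (2 * d + 1) / (real n + 1)" for n
  proof -
    have "(l2norm S (\<lambda>x. h x - r n x))\<^sup>2 \<le> (d + 1 / (real n + 1))\<^sup>2"
      using rd[of n] by (intro power_mono) auto
    also have "\<dots> = d\<^sup>2 + 2 * d / (real n + 1) + (1 / (real n + 1)) * (1 / (real n + 1))"
      unfolding power2_sum by (simp add: power2_eq_square)
    also have "(1 / (real n + 1)) * (1 / (real n + 1)) \<le> 1 / (real n + 1) * 1"
      by (intro mult_left_mono) auto
    finally show ?thesis by (simp add: add_divide_distrib)
  qed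
  have "\<exists>f\<in>L2 S. (\<lambda>n. l2norm S (\<lambda>x. r n x - f x)) \<longlonglongrightarrow> 0"
  proof (rule L2_complete[OF rL])
    fix e :: real assume "0 < e"
    \<comment> \<open>Inserting \<open>sq\<close> twice into \<open>par\<close> cancels
      \<open>4 * d\<^sup>2\<close> and leaves at most \<open>4 * (2 * d + 1) / (N + 1)\<close>; this
      \<open>N\<close> pushes that below \<open>e\<^sup>2\<close>.\<close>
    define N where "N = nat \<lceil>4 * (2 * d + 1) / e\<^sup>2\<rceil>"
    have N: "4 * (2 * d + 1) / e\<^sup>2 < real N + 1" unfolding N_def by linarith
    have "l2norm S (\<lambda>x. r m x - r n x) < e" if "m \<ge> N" "n \<ge> N" for m n
    proof (rule power2_less_imp_less)
      have le: "(2 * d + 1) / (real k + 1) \<le> (2 * d + 1) / (real N + 1)" if "k \<ge> N" for k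
        using that d0 by (intro divide_left_mono) auto
      have "(l2norm S (\<lambda>x. r m x - r n x))\<^sup>2 \<le> 4 * ((2 * d + 1) / (real N + 1))"
        using par[of m n] sq[of m] sq[of n] le[OF that(1)] le[OF that(2)] by linarith
      also have "\<dots> < e\<^sup>2" using N \<open>0 < e\<close> by (simp add: field_simps)
      finally show "(l2norm S (\<lambda>x. r m x - r n x))\<^sup>2 < e\<^sup>2" .
    qed (use \<open>0 < e\<close> in simp)
    then show "\<exists>N. \<forall>m\<ge>N. \<forall>n\<ge>N. l2norm S (\<lambda>x. r m x - r n x) < e" by blast
  qed
  then obtain f where f: "f \<in> L2 S" and lim: "(\<lambda>n. l2norm S (\<lambda>x. r n x - f x)) \<longlonglongrightarrow> 0" by blast
  have fR: "f \<in> R" using closed[OF r f lim] .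
  have "(\<lambda>n. l2norm S (\<lambda>x. h x - r n x)) \<longlonglongrightarrow> l2norm S (\<lambda>x. h x - f x)"
    using lim l2norm_minus_commute[of S f] by (intro l2norm_tendsto L2_diff h rL f) simp
  moreover have "(\<lambda>n. d + 1 / (real n + 1)) \<longlonglongrightarrow> d + 0"
    using LIMSEQ_inverse_real_of_nat by (intro tendsto_add tendsto_const) (simp add: inverse_eq_divide add.commute)
  ultimately have "l2norm S (\<lambda>x. h x - f x) \<le> d"
    using rd by (intro LIMSEQ_le[of _ _ "\<lambda>n. d + 1 / (real n + 1)"]) (auto intro: less_imp_le)
  then have hf: "l2norm S (\<lambda>x. h x - f x) = d" using d_le[OF fR] by simp
  have "l2inner S (\<lambda>x. h x - f x) g = 0" if g: "g \<in> R" for g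
  proof (rule ccontr)
    define I G where "I = l2inner S (\<lambda>x. h x - f x) g" and "G = (l2norm S g)\<^sup>2"
    assume "l2inner S (\<lambda>x. h x - f x) g \<noteq> 0"
    then have I: "(cmod I)\<^sup>2 > 0" by (simp add: I_def)
    have G: "G \<ge> 0" by (simp add: G_def)
    \<comment> \<open>The optimal \<open>1 / G\<close> fails for \<open>G = 0\<close>; with
      \<open>G + 1\<close> one has \<open>t > 0\<close> and \<open>t * G \<le> 1\<close> in all
      cases, which contradicts \<open>2 * t \<le> t\<^sup>2 * G\<close>.\<close>
    define t where "t = 1 / (G + 1)"
    have "d \<le> l2norm S (\<lambda>x. h x - f x - (of_real t * I) * g x)"
      using d_le[OF lin[OF fR g, of "of_real t * I"]] by (simp add: algebra_simps)
    then have "d\<^sup>2 \<le> (l2norm S (\<lambda>x. h x - f x - (of_real t * I) * g x))\<^sup>2"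
      using d0 by (intro power_mono)
    also have "\<dots> = d\<^sup>2 - 2 * Re (cnj (of_real t * I) * I) + (cmod (of_real t * I))\<^sup>2 * G"
      using l2norm_diff_scale_sq[OF L2_diff[OF h f], of g "of_real t * I"] g R hf
      by (auto simp: I_def G_def)
    also have "Re (cnj (of_real t * I) * I) = t * (cmod I)\<^sup>2"
      unfolding cmod_power2 by (simp add: power2_eq_square algebra_simps)
    finally have "2 * t * (cmod I)\<^sup>2 \<le> t\<^sup>2 * G * (cmod I)\<^sup>2"
      by (simp add: norm_mult power_mult_distrib mult.commute mult.left_commute)
    then have "2 * t \<le> t\<^sup>2 * G" using I by (simp only: mult_le_cancel_right_pos)
    moreover have "t * G \<le> 1" "t > 0" unfolding t_def using G by (auto simp: field_simps)
    ultimately show False by (simp add: power2_eq_square)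
  qed
  with fR show ?thesis by blast
qed

subsection \<open>Absolutely continuous functions on the half-line\<close>

lemma set_integrable_mult_continuous:
  fixes f g :: "real \<Rightarrow> complex"
  assumes f: "set_integrable lborel {a..b} f" and g: "continuous_on {a..b} g"
  shows "set_integrable lborel {a..b} (\<lambda>x. f x * g x)"
proof -
  have "bounded (g ` {a..b})"
    using compact_imp_bounded[OF compact_continuous_image[OF g compact_Icc]] .
  then obtain B where "\<forall>y\<in>g ` {a..b}. norm y \<le> B"
    unfolding bounded_iff by blast
  then have B: "norm (g x) \<le> B" if "x \<in> {a..b}" for x using that by blast
  have fm: "(\<lambda>x. indicator {a..b} x *\<^sub>R f x) \<in> borel_measurable lborel"
    using f unfolding set_integrable_def by (rule borel_measurable_integrable)
  have gm: "(\<lambda>x. indicator {a..b} x *\<^sub>R g x) \<in> borel_measurable lborel"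
    using borel_measurable_continuous_on_indicator[OF _ g] by simp
  show ?thesis unfolding set_integrable_def
  proof (rule Bochner_Integration.integrable_bound)
    show "integrable lborel (\<lambda>x. B *\<^sub>R (indicator {a..b} x *\<^sub>R f x))"
      using f unfolding set_integrable_def by (rule integrable_scaleR_right)
    have "(\<lambda>x. (indicator {a..b} x *\<^sub>R f x) * (indicator {a..b} x *\<^sub>R g x)) \<in> borel_measurable lborel"
      using fm gm by (rule borel_measurable_times)
    also have "(\<lambda>x. (indicator {a..b} x *\<^sub>R f x) * (indicator {a..b} x *\<^sub>R g x))
        = (\<lambda>x. indicator {a..b} x *\<^sub>R (f x * g x))"
      by (auto simp: indicator_def)
    finally show "(\<lambda>x. indicator {a..b} x *\<^sub>R (f x * g x)) \<in> borel_measurable lborel" .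
    have "norm (indicator {a..b} x *\<^sub>R (f x * g x)) \<le> norm (B *\<^sub>R (indicator {a..b} x *\<^sub>R f x))" for x
    proof (cases "x \<in> {a..b}")
      case True
      then have "cmod (f x) * cmod (g x) \<le> cmod (f x) * \<bar>B\<bar>"
        using B[of x] by (intro mult_left_mono) auto
      then show ?thesis using True by (simp add: norm_mult mult.commute)
    qed simp
    then show "AE x in lborel. norm (indicator {a..b} x *\<^sub>R (f x * g x))
        \<le> norm (B *\<^sub>R (indicator {a..b} x *\<^sub>R f x))" by simp
  qed
qed

abbreviation AC :: "(real \<Rightarrow> complex) \<Rightarrow> (real \<Rightarrow> complex) \<Rightarrow> bool" where
  "AC \<equiv> ac_loc_with_deriv {0..}"

lemma AC_set_integrable: "AC w w1 \<Longrightarrow> 0 \<le> a \<Longrightarrow> a \<le> b \<Longrightarrow> set_integrable lborel {a..b} w1"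
  by (simp add: ac_loc_with_deriv_def)

lemma AC_integral: "AC w w1 \<Longrightarrow> 0 \<le> b \<Longrightarrow> w b - w 0 = (LBINT x:{0..b}. w1 x)"
  by (simp add: ac_loc_with_deriv_def)

lemma ACI:
  assumes int: "\<And>b. 0 \<le> b \<Longrightarrow> set_integrable lborel {0..b} w1"
    and eq: "\<And>b. 0 \<le> b \<Longrightarrow> w b = w 0 + (LBINT x:{0..b}. w1 x)"
  shows "AC w w1"
  unfolding ac_loc_with_deriv_def
proof (intro ballI impI conjI)
  fix a b :: real assume ab: "a \<in> {0..}" "b \<in> {0..}" "a \<le> b"
  show s: "set_integrable lborel {a..b} w1"
    by (rule set_integrable_subset[OF int[of b]]) (use ab in auto)
  have "integral {0..a} w1 + integral {a..b} w1 = integral {0..b} w1"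
    using ab set_borel_integral_eq_integral(1)[OF int[of b]] by (intro Henstock_Kurzweil_Integration.integral_combine) auto
  then show "w b - w a = (LBINT x:{a..b}. w1 x)"
    using eq[of a] eq[of b] ab set_borel_integral_eq_integral(2)[OF s]
      set_borel_integral_eq_integral(2)[OF int[of a]] set_borel_integral_eq_integral(2)[OF int[of b]]
    by (simp add: algebra_simps)
qed

lemma AC_eq_integral:
  assumes "AC w w1" "0 \<le> x" shows "w x = w 0 + integral {0..x} w1"
  using AC_integral[OF assms] set_borel_integral_eq_integral(2)[OF AC_set_integrable[OF assms(1), of 0 x]] assms(2)
  by (simp add: algebra_simps)

lemma continuous_on_atLeastI:
  fixes f :: "real \<Rightarrow> 'a::topological_space"
  assumes "\<And>b. 0 \<le> b \<Longrightarrow> continuous_on {0..b} f"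
  shows "continuous_on {0..} f"
  unfolding continuous_on_def
proof
  fix x :: real assume x: "x \<in> {0..}"
  have "(f \<longlongrightarrow> f x) (at x within {0..x+1})"
    using assms[of "x+1"] x by (auto simp: continuous_on_def)
  moreover have "at x within {0..x+1} = at x within {0..}"
    by (rule at_within_nhd[of _ "{..<x+1}"]) auto
  ultimately show "(f \<longlongrightarrow> f x) (at x within {0..})" by simp
qed

lemma AC_continuous:
  assumes "AC w w1" shows "continuous_on {0..} w"
proof (rule continuous_on_atLeastI)
  fix b :: real assume b: "0 \<le> b"
  have "continuous_on {0..b} (\<lambda>x. w 0 + integral {0..x} w1)"
    using set_borel_integral_eq_integral(1)[OF AC_set_integrable[OF assms _ b]]
    by (intro continuous_intros indefinite_integral_continuous_1) auto
  then show "continuous_on {0..b} w"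
    by (rule continuous_on_eq) (rule AC_eq_integral[OF assms, symmetric], simp)
qed

text \<open>The interval \<open>{0..x+1}\<close> gives an ordinary derivative at interior points and
  the one-sided derivative at the endpoint 0, where the initial data sit.\<close>

lemma AC_has_vector_derivative:
  assumes "AC w w1" "continuous_on {0..} w1" "0 \<le> x"
  shows "(w has_vector_derivative w1 x) (at x within {0..x+1})"
proof -
  have "((\<lambda>u. integral {0..u} w1) has_vector_derivative w1 x) (at x within {0..x+1})"
    using assms by (intro integral_has_vector_derivative continuous_on_subset[OF assms(2)]) auto
  then have "((\<lambda>u. w 0 + integral {0..u} w1) has_vector_derivative 0 + w1 x) (at x within {0..x+1})"
    by (intro has_vector_derivative_add has_vector_derivative_const)
  then have "((\<lambda>u. w 0 + integral {0..u} w1) has_vector_derivative w1 x) (at x within {0..x+1})"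
    by simp
  then show ?thesis
  proof (rule has_vector_derivative_transform[rotated 2])
    show "w u = w 0 + integral {0..u} w1" if "u \<in> {0..x+1}" for u
      by (rule AC_eq_integral[OF assms(1)]) (use that in simp)
  qed (use assms(3) in simp)
qed

text \<open>Makes the initial slope depend on the function alone and not on the chosen
  density.\<close>

lemma AC_deriv_unique:
  assumes "AC w w1" "AC v v1" "continuous_on {0..} w1" "continuous_on {0..} v1"
    and eq: "\<And>x. 0 \<le> x \<Longrightarrow> w x = v x" and x: "0 \<le> x"
  shows "w1 x = v1 x"
proof -
  have "(w has_vector_derivative v1 x) (at x within {0..x+1})"
    by (rule has_vector_derivative_transform[OF _ _ AC_has_vector_derivative[OF assms(2,4) x]])
       (use x eq in auto)
  with AC_has_vector_derivative[OF assms(1,3) x] show ?thesis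
    using x by (intro vector_derivative_unique_within_closed_interval[of 0 "x+1" x w]) auto
qed

lemma AC_C1:
  assumes der: "\<And>x. 0 \<le> x \<Longrightarrow> (w has_vector_derivative w1 x) (at x)" and cont: "continuous_on {0..} w1"
  shows "AC w w1"
proof (rule ACI)
  fix b :: real assume b: "0 \<le> b"
  show s: "set_integrable lborel {0..b} w1"
    by (rule borel_integrable_atLeastAtMost') (use cont in \<open>auto intro: continuous_on_subset\<close>)
  have "(w1 has_integral (w b - w 0)) {0..b}"
  proof (rule fundamental_theorem_of_calculus[OF b])
    show "(w has_vector_derivative w1 x) (at x within {0..b})" if "x \<in> {0..b}" for x
      by (rule has_vector_derivative_at_within[OF der]) (use that in simp)
  qed
  then show "w b = w 0 + (LBINT x:{0..b}. w1 x)"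
    unfolding set_borel_integral_eq_integral(2)[OF s] by (simp add: integral_unique)
qed

lemma AC_primitive:
  assumes "\<And>b. 0 \<le> b \<Longrightarrow> set_integrable lborel {0..b} f"
  shows "AC (\<lambda>x. c + (LBINT y:{0..x}. f y)) f"
proof (rule ACI[OF assms])
  have "(LBINT y:{0..0}. f y) = 0"
    using set_borel_integral_eq_integral(2)[OF assms[of 0]] by simp
  then show "c + (LBINT y:{0..b}. f y) = c + (LBINT y:{0..0}. f y) + (LBINT y:{0..b}. f y)" for b
    by simp
qed

section \<open>Algebra of locally absolutely continuous functions\<close>

lemma AC_add:
  assumes "AC w w1" "AC v v1"
  shows "AC (\<lambda>x. w x + v x) (\<lambda>x. w1 x + v1 x)"
proof (rule ACI)
  fix b :: real assume b: "0 \<le> b"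
  note i = AC_set_integrable[OF assms(1) order_refl b] AC_set_integrable[OF assms(2) order_refl b]
  show "set_integrable lborel {0..b} (\<lambda>x. w1 x + v1 x)" by (rule set_integral_add(1)[OF i])
  show "w b + v b = w 0 + v 0 + (LBINT x:{0..b}. w1 x + v1 x)"
    unfolding set_integral_add(2)[OF i] AC_integral[OF assms(1) b, symmetric] AC_integral[OF assms(2) b, symmetric]
    by simp
qed

lemma AC_scale:
  assumes "AC w w1"
  shows "AC (\<lambda>x. c * w x) (\<lambda>x. c * w1 x)"
  using assms unfolding ac_loc_with_deriv_def by (auto simp flip: right_diff_distrib)

lemma AC_diff:
  assumes "AC w w1" "AC v v1"
  shows "AC (\<lambda>x. w x - v x) (\<lambda>x. w1 x - v1 x)"
  using AC_add[OF assms(1) AC_scale[OF assms(2), of "-1"]] by simp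

lemma AC_cnj:
  assumes "AC w w1"
  shows "AC (\<lambda>x. cnj (w x)) (\<lambda>x. cnj (w1 x))"
proof (rule ACI)
  have *: "(\<lambda>x. indicator A x *\<^sub>R cnj (w1 x)) = (\<lambda>x. cnj (indicator A x *\<^sub>R w1 x))" for A
    by (auto simp: indicator_def)
  show "set_integrable lborel {0..b} (\<lambda>x. cnj (w1 x))" if "0 \<le> b" for b
    using AC_set_integrable[OF assms order_refl that] unfolding set_integrable_def * complex_integrable_cnj .
  show "cnj (w b) = cnj (w 0) + (LBINT x:{0..b}. cnj (w1 x))" if "0 \<le> b" for b
    unfolding set_lebesgue_integral_def * Bochner_Integration.integral_cnj
    unfolding AC_integral[OF assms that, unfolded set_lebesgue_integral_def, symmetric] by simp
qed

text \<open>The product of two integrals is the integral of \<open>w1 x * v1 y\<close> over the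
  square. Cutting the square along the diagonal and applying Fubini to each triangle, in opposite
  orders, produces the two terms on the left.\<close>

lemma integral_by_parts_primitives:
  assumes w: "AC w w1" and v: "AC v v1" and b: "0 \<le> b"
  shows "(LBINT x:{0..b}. w1 x * (v x - v 0)) + (LBINT y:{0..b}. v1 y * (w y - w 0)) = (w b - w 0) * (v b - v 0)"
proof -
  define F where "F x = indicator {0..b} x *\<^sub>R w1 x" for x
  define G where "G x = indicator {0..b} x *\<^sub>R v1 x" for x
  have F: "integrable lborel F" and G: "integrable lborel G"
    using AC_set_integrable[OF w _ b] AC_set_integrable[OF v _ b] by (auto simp: set_integrable_def F_def[abs_def] G_def[abs_def])
  have [measurable]: "F \<in> borel_measurable borel" "G \<in> borel_measurable borel"
    using borel_measurable_integrable[OF F] borel_measurable_integrable[OF G] by auto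
  have H: "integrable (lborel \<Otimes>\<^sub>M lborel) (\<lambda>(x, y). F x * G y)"
  proof (rule lborel_pair.Fubini_integrable)
    show "integrable lborel (\<lambda>x. LBINT y. norm (case (x, y) of (x, y) \<Rightarrow> F x * G y))"
      using F by (simp add: norm_mult)
    show "AE x in lborel. integrable lborel (\<lambda>y. case (x, y) of (x, y) \<Rightarrow> F x * G y)"
      using G by simp
  qed measurable
  have mT: "{p :: real \<times> real. snd p \<le> fst p} \<in> sets (lborel \<Otimes>\<^sub>M lborel)"
  proof -
    have "{p \<in> space (lborel \<Otimes>\<^sub>M lborel). snd p \<le> (fst p :: real)} \<in> sets (lborel \<Otimes>\<^sub>M lborel)" by measurable
    then show ?thesis by (simp add: space_pair_measure)
  qed
  define K where "K x y = (if y \<le> x then F x * G y else 0)" for x y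
  define L where "L x y = (if y \<le> x then 0 else F x * G y)" for x y
  have K: "integrable (lborel \<Otimes>\<^sub>M lborel) (\<lambda>(x, y). K x y)"
    using integrable_mult_indicator[OF mT H]
    by (rule back_subst[where P="integrable (lborel \<Otimes>\<^sub>M lborel)"]) (auto simp: K_def fun_eq_iff indicator_def)
  have L: "integrable (lborel \<Otimes>\<^sub>M lborel) (\<lambda>(x, y). L x y)"
    using Bochner_Integration.integrable_diff[OF H K]
    by (rule back_subst[where P="integrable (lborel \<Otimes>\<^sub>M lborel)"]) (auto simp: K_def L_def fun_eq_iff)
  have KI: "(LBINT y. K x y) = indicator {0..b} x *\<^sub>R (w1 x * (v x - v 0))" for x
  proof (cases "x \<in> {0..b}")
    case True
    have *: "(\<lambda>y. K x y) = (\<lambda>y. w1 x * (indicator {0..x} y *\<^sub>R v1 y))"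
      using True by (auto simp: K_def F_def G_def indicator_def fun_eq_iff)
    have "(LBINT y. K x y) = w1 x * (LBINT y:{0..x}. v1 y)"
      unfolding * set_lebesgue_integral_def by (rule integral_mult_right_zero)
    then show ?thesis using True AC_integral[OF v, of x] by simp
  next
    case False
    then have "K x y = 0" for y by (auto simp: K_def F_def)
    then show ?thesis using False by simp
  qed
  have LI: "(LBINT x. L x y) = indicator {0..b} y *\<^sub>R (v1 y * (w y - w 0))" for y
  proof (cases "y \<in> {0..b}")
    case True
    \<comment> \<open>The diagonal was given to \<open>K\<close>, so \<open>L\<close> agrees with
      the product on the closed interval \<open>{0..y}\<close> only off the point
      \<open>x = y\<close>.\<close>
    have "AE x in lborel. x \<noteq> y" by (rule AE_lborel_singleton)
    then have "AE x in lborel. L x y = v1 y * (indicator {0..y} x *\<^sub>R w1 x)"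
      by eventually_elim (use True in \<open>auto simp: L_def F_def G_def indicator_def\<close>)
    moreover have "(\<lambda>x. indicator {0..y} x *\<^sub>R w1 x) \<in> borel_measurable lborel"
      using AC_set_integrable[OF w, of 0 y] True unfolding set_integrable_def by (intro borel_measurable_integrable) auto
    ultimately have "(LBINT x. L x y) = (LBINT x. v1 y * (indicator {0..y} x *\<^sub>R w1 x))"
      by (intro integral_cong_AE borel_measurable_times[OF borel_measurable_const]) (auto simp: L_def)
    then have "(LBINT x. L x y) = v1 y * (LBINT x:{0..y}. w1 x)"
      unfolding set_lebesgue_integral_def integral_mult_right_zero .
    then show ?thesis using True AC_integral[OF w, of y] by simp
  next
    case False
    then have "L x y = 0" for x by (auto simp: L_def G_def)
    then show ?thesis using False by simp
  qed
  have "(LBINT x:{0..b}. w1 x * (v x - v 0)) + (LBINT y:{0..b}. v1 y * (w y - w 0))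
      = (LBINT x. LBINT y. K x y) + (LBINT y. LBINT x. L x y)"
    by (simp add: KI LI set_lebesgue_integral_def)
  also have "\<dots> = integral\<^sup>L (lborel \<Otimes>\<^sub>M lborel) (\<lambda>(x, y). K x y) + integral\<^sup>L (lborel \<Otimes>\<^sub>M lborel) (\<lambda>(x, y). L x y)"
    using lborel_pair.integral_fst[OF K] lborel_pair.integral_snd[OF L] by simp
  also have "\<dots> = integral\<^sup>L (lborel \<Otimes>\<^sub>M lborel) (\<lambda>p. (case p of (x, y) \<Rightarrow> K x y) + (case p of (x, y) \<Rightarrow> L x y))"
    by (rule Bochner_Integration.integral_add[symmetric, OF K L])
  also have "\<dots> = integral\<^sup>L (lborel \<Otimes>\<^sub>M lborel) (\<lambda>(x, y). F x * G y)"
    by (rule arg_cong[where f="integral\<^sup>L (lborel \<Otimes>\<^sub>M lborel)"]) (auto simp: K_def L_def fun_eq_iff)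
  also have "\<dots> = (LBINT x. LBINT y. F x * G y)"
    using lborel_pair.integral_fst[OF H] by simp
  also have "\<dots> = (LBINT x. F x) * (LBINT y. G y)" by simp
  also have "\<dots> = (w b - w 0) * (v b - v 0)"
    using AC_integral[OF w b] AC_integral[OF v b] by (simp add: set_lebesgue_integral_def F_def G_def)
  finally show ?thesis .
qed

lemma AC_mult:
  assumes w: "AC w w1" and v: "AC v v1"
  shows "AC (\<lambda>x. w x * v x) (\<lambda>x. w1 x * v x + w x * v1 x)"
proof (rule ACI)
  fix b :: real assume b: "0 \<le> b"
  have cw: "continuous_on {0..b} w" and cv: "continuous_on {0..b} v"
    using AC_continuous[OF w] AC_continuous[OF v] by (auto intro: continuous_on_subset)
  note w1 = AC_set_integrable[OF w order_refl b] and v1 = AC_set_integrable[OF v order_refl b]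
  note i1 = set_integrable_mult_continuous[OF w1 cv] and i2 = set_integrable_mult_continuous[OF v1 cw]
  show "set_integrable lborel {0..b} (\<lambda>x. w1 x * v x + w x * v1 x)"
    using set_integral_add(1)[OF i1 i2] by (simp add: mult.commute)
  have e1: "(LBINT x:{0..b}. w1 x * v x + w x * v1 x) = (LBINT x:{0..b}. w1 x * v x) + (LBINT x:{0..b}. v1 x * w x)"
    using set_integral_add(2)[OF i1 i2] by (simp add: mult.commute)
  have e2: "(LBINT x:{0..b}. w1 x * (v x - v 0)) = (LBINT x:{0..b}. w1 x * v x) - (w b - w 0) * v 0"
    unfolding right_diff_distrib using set_integral_diff(2)[OF i1 set_integrable_mult_left[OF w1]] AC_integral[OF w b] by simp
  have e3: "(LBINT x:{0..b}. v1 x * (w x - w 0)) = (LBINT x:{0..b}. v1 x * w x) - (v b - v 0) * w 0"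
    unfolding right_diff_distrib using set_integral_diff(2)[OF i2 set_integrable_mult_left[OF v1]] AC_integral[OF v b] by simp
  show "w b * v b = w 0 * v 0 + (LBINT x:{0..b}. w1 x * v x + w x * v1 x)"
    unfolding e1 using integral_by_parts_primitives[OF w v b, unfolded e2 e3] by algebra
qed

text \<open>A difference that is nonzero at \<open>x\<close> stays nonzero on an interval to the
  right of \<open>x\<close>. The right side is chosen so that the endpoint 0 is covered as
  well.\<close>

lemma aeq_imp_eq_continuous:
  assumes f: "continuous_on {0..} f" and g: "continuous_on {0..} g" and eq: "aeq {0..} f g" and x: "0 \<le> x"
  shows "f x = g x"
proof (rule ccontr)
  assume ne: "f x \<noteq> g x"
  have "continuous_on {0..} (\<lambda>y. f y - g y)" using f g by (rule continuous_on_diff)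
  then have "((\<lambda>y. f y - g y) \<longlongrightarrow> f x - g x) (at x within {0..})"
    using x by (auto simp: continuous_on_def)
  then have "\<forall>\<^sub>F y in at x within {0..}. f y - g y \<noteq> 0"
    by (rule tendsto_imp_eventually_ne) (use ne in simp)
  then obtain d where d: "d > 0" and dn: "\<And>y. y \<in> {0..} \<Longrightarrow> y \<noteq> x \<Longrightarrow> dist y x < d \<Longrightarrow> f y \<noteq> g y"
    by (auto simp: eventually_at)
  have "AE y in lebesgue. y \<in> {0..} \<longrightarrow> f y = g y"
    using eq unfolding aeq_def by (subst (asm) AE_restrict_space_iff) auto
  then have "AE y in lebesgue. y \<notin> {x<..<x+d}"
    by eventually_elim (use dn x in \<open>auto simp: dist_real_def\<close>)
  then have "{x<..<x+d} \<in> null_sets lebesgue"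
    by (subst (asm) AE_iff_null_sets[symmetric]) auto
  then show False using d by (auto simp: null_sets_def)
qed

subsection \<open>Restrictions of Lebesgue measure\<close>

lemma halfline_1: "halfline 1 = {0..}"
  by (auto simp: halfline_def)

text \<open>Bridge between the two integrals in use: \<open>L2\<close> is built on restricted
  Lebesgue measure, local absolute continuity on \<open>lborel\<close>.\<close>

lemma lebesgue_on_set_integrable:
  fixes g :: "real \<Rightarrow> complex"
  assumes "set_integrable lborel A g" and A: "A \<in> sets borel"
  shows "integrable (lebesgue_on A) g" "integral\<^sup>L (lebesgue_on A) g = (LBINT x:A. g x)"
proof -
  have i: "integrable lborel (\<lambda>x. indicator A x *\<^sub>R g x)" using assms(1) by (simp add: set_integrable_def)
  have A': "A \<inter> space lebesgue \<in> sets lebesgue" using A by simp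
  show "integrable (lebesgue_on A) g"
    unfolding integrable_restrict_space[OF A'] integrable_completion[OF borel_measurable_integrable[OF i]] by (rule i)
  show "integral\<^sup>L (lebesgue_on A) g = (LBINT x:A. g x)"
    unfolding integral_restrict_space[OF A'] integral_completion[OF borel_measurable_integrable[OF i]]
      set_lebesgue_integral_def ..
qed

text \<open>The way back asks for Borel measurability, which a Lebesgue integrable function need not
  have; hence the Borel representatives further on.\<close>

lemma set_integrable_lborelI:
  fixes g :: "real \<Rightarrow> complex"
  assumes "integrable (lebesgue_on A) g" and A: "A \<in> sets borel"
    and g: "(\<lambda>x. indicator A x *\<^sub>R g x) \<in> borel_measurable borel"
  shows "set_integrable lborel A g"
proof -
  have A': "A \<inter> space lebesgue \<in> sets lebesgue" using A by simp
  have g': "(\<lambda>x. indicator A x *\<^sub>R g x) \<in> borel_measurable lborel" using g by simp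
  show ?thesis using assms(1) 
    unfolding integrable_restrict_space[OF A'] integrable_completion[OF g'] set_integrable_def .
qed

lemma integrable_lebesgue_on_subset:
  fixes h :: "real \<Rightarrow> 'a::{banach, second_countable_topology}"
  assumes h: "integrable (lebesgue_on S) h" and "T \<subseteq> S" and S: "S \<in> sets lebesgue" and T: "T \<in> sets lebesgue"
  shows "integrable (lebesgue_on T) h"
proof -
  have S': "S \<inter> space lebesgue \<in> sets lebesgue" and T': "T \<inter> space lebesgue \<in> sets lebesgue" using S T by auto
  have "set_integrable lebesgue S h" using h unfolding integrable_restrict_space[OF S'] set_integrable_def .
  from set_integrable_subset[OF this T \<open>T \<subseteq> S\<close>] show ?thesis
    unfolding integrable_restrict_space[OF T'] set_integrable_def .
qed

lemma measurable_lebesgue_on_subset: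
  fixes h :: "real \<Rightarrow> 'a::{banach, second_countable_topology}"
  assumes h: "h \<in> borel_measurable (lebesgue_on S)" and "T \<subseteq> S" and T: "T \<in> sets lebesgue"
  shows "h \<in> borel_measurable (lebesgue_on T)"
  using measurable_restrict_mono[OF h \<open>T \<subseteq> S\<close>] .

lemma L2_subset:
  assumes "f \<in> L2 S" "T \<subseteq> S" "S \<in> sets lebesgue" "T \<in> sets lebesgue"
  shows "f \<in> L2 T"
  using assms integrable_lebesgue_on_subset[OF L2_integrable_sq[OF assms(1)] assms(2-4)]
    measurable_lebesgue_on_subset[OF L2_measurable[OF assms(1)] assms(2,4)] by (simp add: L2_def)

lemma continuous_measurable_lebesgue_on:
  assumes "continuous_on S f" "S \<in> sets lebesgue"
  shows "f \<in> borel_measurable (lebesgue_on S)"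
  using continuous_imp_measurable_on_sets_lebesgue[OF assms] .

lemma locally_integrable_measurable:
  fixes g :: "real \<Rightarrow> complex"
  assumes "\<And>b. 0 \<le> b \<Longrightarrow> set_integrable lborel {0..b} g"
  shows "(\<lambda>x. indicator {0..} x *\<^sub>R g x) \<in> borel_measurable borel"
proof (rule borel_measurable_LIMSEQ_metric)
  fix n :: nat
  show "(\<lambda>x. indicator {0..real n} x *\<^sub>R g x) \<in> borel_measurable borel"
    using borel_measurable_integrable[OF assms[of "real n", unfolded set_integrable_def]] by simp
next
  fix x :: real
  show "(\<lambda>n. indicator {0..real n} x *\<^sub>R g x) \<longlonglongrightarrow> indicator {0..} x *\<^sub>R g x"
  proof (rule tendsto_eventually, rule eventually_sequentiallyI[of "nat \<lceil>x\<rceil>"])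
    fix n assume "nat \<lceil>x\<rceil> \<le> n"
    then have "x \<le> real n" by linarith
    then show "indicator {0..real n} x *\<^sub>R g x = indicator {0..} x *\<^sub>R g x"
      by (auto simp: indicator_def)
  qed
qed

lemma locally_integrable_measurable_lebesgue_on:
  fixes g :: "real \<Rightarrow> complex"
  assumes "\<And>b. 0 \<le> b \<Longrightarrow> set_integrable lborel {0..b} g"
  shows "g \<in> borel_measurable (lebesgue_on {0..})"
proof -
  have "(\<lambda>x. indicator {0..} x *\<^sub>R g x) \<in> borel_measurable lborel"
    using locally_integrable_measurable[OF assms] by simp
  then have "(\<lambda>x. indicator {0..} x *\<^sub>R g x) \<in> borel_measurable lebesgue"
    by (rule measurable_completion)
  then show ?thesis by (subst borel_measurable_restrict_space_iff) auto
qed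

lemma integral_lebesgue_on_LIMSEQ:
  fixes h :: "real \<Rightarrow> 'a::{banach, second_countable_topology}"
  assumes "integrable (lebesgue_on {0..}) h"
  shows "(\<lambda>n. integral\<^sup>L (lebesgue_on {0..real n}) h) \<longlonglongrightarrow> integral\<^sup>L (lebesgue_on {0..}) h"
proof -
  have i: "integrable lebesgue (\<lambda>x. indicator {0..} x *\<^sub>R h x)"
    using assms by (subst (asm) integrable_restrict_space) auto
  have m: "(\<lambda>x. indicator {0..real n} x *\<^sub>R h x) \<in> borel_measurable lebesgue" for n
  proof -
    have "integrable (lebesgue_on {0..real n}) h"
      by (rule integrable_lebesgue_on_subset[OF assms]) auto
    then show ?thesis by (subst (asm) integrable_restrict_space) (auto dest: borel_measurable_integrable)
  qed
  have "(\<lambda>n. LINT x|lebesgue. indicator {0..real n} x *\<^sub>R h x) \<longlonglongrightarrow> (LINT x|lebesgue. indicator {0..} x *\<^sub>R h x)"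
  proof (rule integral_dominated_convergence[OF borel_measurable_integrable[OF i] m integrable_norm[OF i]])
    have "(\<lambda>n. indicator {0..real n} x *\<^sub>R h x) \<longlonglongrightarrow> indicator {0..} x *\<^sub>R h x" for x
    proof (rule tendsto_eventually, rule eventually_sequentiallyI[of "nat \<lceil>x\<rceil>"])
      fix n assume "nat \<lceil>x\<rceil> \<le> n"
      then have "x \<le> real n" by linarith
      then show "indicator {0..real n} x *\<^sub>R h x = indicator {0..} x *\<^sub>R h x"
        by (auto simp: indicator_def)
    qed
    then show "AE x in lebesgue. (\<lambda>n. indicator {0..real n} x *\<^sub>R h x) \<longlonglongrightarrow> indicator {0..} x *\<^sub>R h x" by simp
    show "AE x in lebesgue. norm (indicator {0..real n} x *\<^sub>R h x) \<le> norm (indicator {0..} x *\<^sub>R h x)" for n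
      by (auto simp: indicator_def)
  qed
  then show ?thesis by (subst (1 2) integral_restrict_space) auto
qed

lemma integral_lebesgue_on_mono:
  fixes h :: "real \<Rightarrow> real"
  assumes "integrable (lebesgue_on {0..}) h" "\<And>x. 0 \<le> h x"
  shows "integral\<^sup>L (lebesgue_on {0..b}) h \<le> integral\<^sup>L (lebesgue_on {0..}) h"
proof -
  have i: "integrable lebesgue (\<lambda>x. indicator {0..} x *\<^sub>R h x)"
    using assms by (subst (asm) integrable_restrict_space) auto
  have "integrable (lebesgue_on {0..b}) h"
    by (rule integrable_lebesgue_on_subset[OF assms(1)]) auto
  then have j: "integrable lebesgue (\<lambda>x. indicator {0..b} x *\<^sub>R h x)"
    by (subst (asm) integrable_restrict_space) auto
  have "(LINT x|lebesgue. indicator {0..b} x *\<^sub>R h x) \<le> (LINT x|lebesgue. indicator {0..} x *\<^sub>R h x)"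
    by (rule integral_mono[OF j i]) (use assms(2) in \<open>auto simp: indicator_def\<close>)
  then show ?thesis by (subst (1 2) integral_restrict_space) auto
qed

lemma integrable_const_imp_0:
  fixes h :: "real \<Rightarrow> complex"
  assumes "integrable (lebesgue_on {0..}) h" "\<And>x. 0 \<le> x \<Longrightarrow> h x = c"
  shows "c = 0"
proof (rule ccontr)
  assume "c \<noteq> 0"
  have "integral\<^sup>L (lebesgue_on {0..real n}) h = of_nat n * c" for n
  proof -
    have "integral\<^sup>L (lebesgue_on {0..real n}) h = integral\<^sup>L (lebesgue_on {0..real n}) (\<lambda>x. c)"
      by (rule Bochner_Integration.integral_cong) (use assms(2) in auto)
    then show ?thesis by (simp add: measure_restrict_space scaleR_conv_of_real)
  qed
  with integral_lebesgue_on_LIMSEQ[OF assms(1)] have "convergent (\<lambda>n. of_nat n * c)"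
    by (auto simp: convergent_def)
  then have "Bseq (\<lambda>n. of_nat n * c)" by (rule convergent_imp_Bseq)
  then obtain K where K: "\<And>n. norm (of_nat n * c) \<le> K" by (auto simp: Bseq_def)
  obtain n where "K / norm c < real n" using reals_Archimedean2 by blast
  then have "K < norm (of_nat n * c)" using \<open>c \<noteq> 0\<close> by (simp add: norm_mult field_simps)
  then show False using K[of n] by simp
qed

section \<open>Invariance under almost everywhere equality and bounded multipliers\<close>

lemma aeq_refl [simp]: "aeq S f f"
  by (simp add: aeq_def)

lemma aeq_trans:
  assumes "aeq S f g" "aeq S g h"
  shows "aeq S f h"
  using assms unfolding aeq_def by eventually_elim simp

lemma l2norm_cong_aeq:
  assumes "f \<in> L2 S" "f' \<in> L2 S" "aeq S f f'"
  shows "l2norm S f = l2norm S f'"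
proof -
  have "aeq S (\<lambda>x. f x - f' x) (\<lambda>x. 0)" using assms(3) unfolding aeq_def by eventually_elim simp
  then have "l2norm S (\<lambda>x. f x - f' x) = 0" using l2norm_eq_0_iff[OF L2_diff[OF assms(1,2)]] by simp
  then show ?thesis
    using l2norm_triangle[OF L2_diff[OF assms(1,2)] assms(2)]
      l2norm_triangle_diff[OF assms(1) L2_diff[OF assms(1,2)]] by simp
qed

lemma l2inner_cong_aeq:
  assumes "f \<in> L2 S" "f' \<in> L2 S" "g \<in> L2 S" "g' \<in> L2 S" "aeq S f f'" "aeq S g g'"
  shows "l2inner S f g = l2inner S f' g'"
  unfolding l2inner_def
proof (rule integral_cong_AE)
  show "AE x in lebesgue_on S. f x * cnj (g x) = f' x * cnj (g' x)"
    using assms(5,6) unfolding aeq_def by eventually_elim simp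
qed (use assms l2inner_integrable in \<open>auto intro: borel_measurable_integrable\<close>)

lemma L2_mult_bounded:
  assumes f: "f \<in> L2 S" and m: "m \<in> borel_measurable (lebesgue_on S)" and B: "\<And>x. x \<in> S \<Longrightarrow> cmod (m x) \<le> B" and B0: "0 \<le> B"
  shows "(\<lambda>x. m x * f x) \<in> L2 S" "l2norm S (\<lambda>x. m x * f x) \<le> B * l2norm S f"
proof -
  have le: "(cmod (m x * f x))\<^sup>2 \<le> B\<^sup>2 * (cmod (f x))\<^sup>2" if "x \<in> S" for x
    using power_mono[OF B[OF that], of 2] by (simp add: norm_mult power_mult_distrib mult_right_mono)
  have i: "integrable (lebesgue_on S) (\<lambda>x. B\<^sup>2 * (cmod (f x))\<^sup>2)" using L2_integrable_sq[OF f] by simp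
  have mm: "(\<lambda>x. m x * f x) \<in> borel_measurable (lebesgue_on S)"
    using m L2_measurable[OF f] by (rule borel_measurable_times)
  have j: "integrable (lebesgue_on S) (\<lambda>x. (cmod (m x * f x))\<^sup>2)"
  proof (rule Bochner_Integration.integrable_bound[OF i])
    show "AE x in lebesgue_on S. norm ((cmod (m x * f x))\<^sup>2) \<le> norm (B\<^sup>2 * (cmod (f x))\<^sup>2)"
      using le by (intro AE_I2) simp
  qed (use mm in measurable)
  with mm show "(\<lambda>x. m x * f x) \<in> L2 S" by (simp add: L2_def)
  have "(l2norm S (\<lambda>x. m x * f x))\<^sup>2 \<le> (B * l2norm S f)\<^sup>2"
    unfolding power_mult_distrib l2norm_sq
    using integral_mono[OF j i] le by simp
  then show "l2norm S (\<lambda>x. m x * f x) \<le> B * l2norm S f"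
    by (rule power2_le_imp_le) (simp add: B0)
qed

subsection \<open>Green formula and energy estimate\<close>

text \<open>The regular representative of an element of the maximal operator, with both densities.
  Values at 0 are meaningful for it, not for an arbitrary member of the almost everywhere
  class.\<close>

definition max_rep ::
  "complex \<Rightarrow> (real \<Rightarrow> complex) \<Rightarrow> (real \<Rightarrow> complex) \<Rightarrow> (real \<Rightarrow> complex) \<Rightarrow> (real \<Rightarrow> complex) \<Rightarrow> bool" where
  "max_rep a q w w1 w2 \<longleftrightarrow> AC w w1 \<and> AC w1 w2 \<and> w \<in> L2 {0..} \<and> (\<lambda>x. - a * w2 x - q x * w x) \<in> L2 {0..}"

lemma tau_measurable:
  assumes q: "continuous_on {0..} q" and "AC w w1" "AC w1 w2"
  shows "(\<lambda>x. - a * w2 x - q x * w x) \<in> borel_measurable (lebesgue_on {0..})"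
proof -
  have [measurable]: "w2 \<in> borel_measurable (lebesgue_on {0..})"
    using AC_set_integrable[OF assms(3)] by (intro locally_integrable_measurable_lebesgue_on) auto
  have [measurable]: "w \<in> borel_measurable (lebesgue_on {0..})" "q \<in> borel_measurable (lebesgue_on {0..})"
    using AC_continuous[OF assms(2)] q by (auto intro: continuous_measurable_lebesgue_on)
  show ?thesis by measurable
qed

lemma Amax_iff:
  assumes q: "continuous_on {0..} q"
  shows "(u, f) \<in> Amax {0..} a q \<longleftrightarrow> u \<in> L2 {0..} \<and> f \<in> L2 {0..} \<and>
    (\<exists>w w1 w2. max_rep a q w w1 w2 \<and> aeq {0..} u w \<and> aeq {0..} f (\<lambda>x. - a * w2 x - q x * w x))"
proof -
  have "max_rep a q w w1 w2"
    if "u \<in> L2 {0..}" "f \<in> L2 {0..}" "AC w w1" "AC w1 w2" "aeq {0..} u w"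
      "aeq {0..} f (\<lambda>x. - a * w2 x - q x * w x)" for w w1 w2
    unfolding max_rep_def
    using that L2_cong[OF that(1) _ that(5)] L2_cong[OF that(2) tau_measurable[OF q that(3,4)] that(6)]
      continuous_measurable_lebesgue_on[OF AC_continuous[OF that(3)]] by simp
  then show ?thesis unfolding Amax_def max_rep_def by blast
qed

text \<open>The product rule applied to the Wronskian \<open>u1 * v - u * v1\<close>; the products
  of first derivatives cancel.\<close>

lemma AC_green:
  assumes "AC u u1" "AC u1 u2" "AC v v1" "AC v1 v2" "0 \<le> b"
  shows "set_integrable lborel {0..b} (\<lambda>x. u2 x * v x - u x * v2 x)"
    "(LBINT x:{0..b}. u2 x * v x - u x * v2 x) = (u1 b * v b - u b * v1 b) - (u1 0 * v 0 - u 0 * v1 0)"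
proof -
  have "AC (\<lambda>x. u1 x * v x - u x * v1 x) (\<lambda>x. (u2 x * v x + u1 x * v1 x) - (u1 x * v1 x + u x * v2 x))"
    by (intro AC_diff AC_mult assms)
  then have *: "AC (\<lambda>x. u1 x * v x - u x * v1 x) (\<lambda>x. u2 x * v x - u x * v2 x)" by simp
  show "set_integrable lborel {0..b} (\<lambda>x. u2 x * v x - u x * v2 x)"
    by (rule AC_set_integrable[OF *]) (use assms in auto)
  show "(LBINT x:{0..b}. u2 x * v x - u x * v2 x) = (u1 b * v b - u b * v1 b) - (u1 0 * v 0 - u 0 * v1 0)"
    using AC_integral[OF * assms(5)] by simp
qed

text \<open>Bounded support is assumed for \<open>w\<close> only. Beyond it the derivative is
  computed on an interval where \<open>w\<close> vanishes; the additional unit in the bound keeps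
  that interval nondegenerate.\<close>

lemma bounded_support_eventually_0:
  assumes "AC w w1" "continuous_on {0..} w1" "bounded B" "\<forall>x\<in>{0..} - B. w x = 0"
  shows "\<exists>b>0. \<forall>x\<ge>b. w x = 0 \<and> w1 x = 0"
proof -
  obtain c where c: "\<And>x. x \<in> B \<Longrightarrow> norm x \<le> c" using assms(3) by (auto simp: bounded_iff)
  define d where "d = \<bar>c\<bar> + 1"
  have w0: "w x = 0" if "x \<ge> d" for x
    using assms(4) c[of x] that unfolding d_def by fastforce
  have w1: "w1 x = 0" if x: "x \<ge> d + 1" for x
  proof -
    have x0: "d > 0" "x > d" using that by (auto simp: d_def)
    have "(w has_vector_derivative w1 x) (at x within {d..x})"
      by (rule has_vector_derivative_within_subset[OF AC_has_vector_derivative[OF assms(1,2)]]) (use x0 in auto)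
    moreover have "(w has_vector_derivative 0) (at x within {d..x})"
      by (rule has_vector_derivative_transform[OF _ _ has_vector_derivative_const[of 0]]) (use w0 x0 in auto)
    ultimately show ?thesis
      using x0 by (intro vector_derivative_unique_within_closed_interval[of d x x w]) auto
  qed
  show ?thesis using w0 w1 by (intro exI[of _ "d + 1"]) (auto simp: d_def)
qed

text \<open>Conjugating \<open>y\<close> turns the conjugate coefficients into \<open>a\<close> and
  \<open>q\<close>, so the potential terms cancel and the derivative of a Wronskian remains. Since
  \<open>w\<close> and \<open>w1\<close> vanish far out, only the boundary term at 0 survives,
  whatever \<open>y\<close> does at infinity.\<close>

lemma green_compact_support:
  assumes u: "max_rep a q w w1 w2" and v: "max_rep (cnj a) (\<lambda>x. cnj (q x)) y y1 y2"
    and supp: "b > 0" "\<And>x. x \<ge> b \<Longrightarrow> w x = 0 \<and> w1 x = 0"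
  shows "l2inner {0..} (\<lambda>x. - a * w2 x - q x * w x) y - l2inner {0..} w (\<lambda>x. - cnj a * y2 x - cnj (q x) * y x)
    = a * (w1 0 * cnj (y 0) - w 0 * cnj (y1 0))"
proof -
  let ?F = "\<lambda>x. - a * w2 x - q x * w x" and ?G = "\<lambda>x. - cnj a * y2 x - cnj (q x) * y x"
  let ?Y = "\<lambda>x. cnj (y x)" and ?Y1 = "\<lambda>x. cnj (y1 x)" and ?Y2 = "\<lambda>x. cnj (y2 x)"
  have L: "w \<in> L2 {0..}" "?F \<in> L2 {0..}" "y \<in> L2 {0..}" "?G \<in> L2 {0..}"
    and ACs: "AC w w1" "AC w1 w2" "AC ?Y ?Y1" "AC ?Y1 ?Y2"
    using u v by (auto simp: max_rep_def intro: AC_cnj)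
  define h where "h x = ?F x * cnj (y x) - w x * cnj (?G x)" for x
  have h_eq: "h = (\<lambda>x. - a * (w2 x * ?Y x - w x * ?Y2 x))"
    by (auto simp: h_def fun_eq_iff algebra_simps)
  have int: "integrable (lebesgue_on {0..}) h"
    unfolding h_def by (intro Bochner_Integration.integrable_diff l2inner_integrable L)
  have I: "integral\<^sup>L (lebesgue_on {0..}) h = l2inner {0..} ?F y - l2inner {0..} w ?G"
    unfolding h_def l2inner_def by (intro Bochner_Integration.integral_diff l2inner_integrable L)
  have "integral\<^sup>L (lebesgue_on {0..real n}) h = a * (w1 0 * cnj (y 0) - w 0 * cnj (y1 0))" if "n \<ge> nat \<lceil>b\<rceil>" for n
  proof -
    have n: "real n \<ge> b" using that by linarith
    note g = AC_green[OF ACs, of "real n"]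
    have "set_integrable lborel {0..real n} h"
      unfolding h_eq by (rule set_integrable_mult_right) (use g(1) in auto)
    then have "integral\<^sup>L (lebesgue_on {0..real n}) h = (LBINT x:{0..real n}. h x)"
      by (rule lebesgue_on_set_integrable(2)) simp
    also have "\<dots> = - a * (LBINT x:{0..real n}. w2 x * ?Y x - w x * ?Y2 x)"
      unfolding h_eq by (rule set_integral_mult_right)
    also have "\<dots> = - a * ((w1 (real n) * ?Y (real n) - w (real n) * ?Y1 (real n)) - (w1 0 * ?Y 0 - w 0 * ?Y1 0))"
      using g(2) by simp
    also have "\<dots> = a * (w1 0 * cnj (y 0) - w 0 * cnj (y1 0))"
      using supp(2)[OF n] by (simp add: algebra_simps)
    finally show ?thesis .
  qed
  then have "(\<lambda>n. integral\<^sup>L (lebesgue_on {0..real n}) h) \<longlonglongrightarrow> a * (w1 0 * cnj (y 0) - w 0 * cnj (y1 0))"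
    by (intro tendsto_eventually eventually_sequentiallyI[of "nat \<lceil>b\<rceil>"])
  from LIMSEQ_unique[OF integral_lebesgue_on_LIMSEQ[OF int] this] show ?thesis unfolding I .
qed

text \<open>Integrating \<open>(\<chi>\<^sup>2 w' cnj w)'\<close> with \<open>\<chi> x = 1 - x / R\<close> and absorbing the term with \<open>\<chi>'\<close>
  bounds the integral of \<open>\<chi>\<^sup>2 |w'|\<^sup>2\<close> uniformly in \<open>R\<close>.\<close>
lemma max_rep_deriv_L2:
  assumes rep: "max_rep a q w w1 w2" and ca: "0 < Re (c * a)" and cq: "\<And>x. 0 \<le> x \<Longrightarrow> Re (c * q x) \<le> 0"
  shows "w1 \<in> L2 {0..}"
proof -
  define k where "k = Re (c * a)"
  have k: "k > 0" using ca by (simp add: k_def)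
  define F where "F x = - a * w2 x - q x * w x" for x
  have acw: "AC w w1" and acw1: "AC w1 w2" and wL: "w \<in> L2 {0..}" and FL: "F \<in> L2 {0..}"
    using rep by (auto simp: max_rep_def F_def[abs_def])
  have cw1: "continuous_on {0..} w1" using AC_continuous[OF acw1] .
  \<comment> \<open>The right-hand side of the estimate, built from products already known to be
    integrable. The coefficient \<open>2 / k\<close> is the price in Young's inequality for
    absorbing the cross term into \<open>k / 2\<close>.\<close>
  define G where "G x = cmod c * cmod (F x * cnj (w x)) + 2 * (cmod (c * a))\<^sup>2 / k * (cmod (w x))\<^sup>2" for x
  have Gi: "integrable (lebesgue_on {0..}) G"
    unfolding G_def using l2inner_integrable[OF FL wL] L2_integrable_sq[OF wL]
    by (intro Bochner_Integration.integrable_add integrable_mult_right integrable_norm)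
  have G0: "0 \<le> G x" for x unfolding G_def using k by simp
  define K where "K = integral\<^sup>L (lebesgue_on {0..}) G + cmod (c * a * (w1 0 * cnj (w 0)))"
  have K0: "0 \<le> K" unfolding K_def using G0 by (simp add: integral_nonneg_AE)
  have main: "k / 2 * integral\<^sup>L (lebesgue_on {0..R}) (\<lambda>x. (1 - x / R)\<^sup>2 * (cmod (w1 x))\<^sup>2) \<le> K" if R: "1 \<le> R" for R
  proof -
    \<comment> \<open>Left linear, without truncation: only \<open>{0..R}\<close> is integrated
      over, and \<open>ch R = 0\<close> removes the upper boundary term.\<close>
    define ch where "ch x = complex_of_real (1 - x / R)" for x
    define ch1 where "ch1 = complex_of_real (- (1 / R))"
    have "AC ch (\<lambda>x. ch1)"
      unfolding ch_def ch1_def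
      by (rule AC_C1) (use R in \<open>auto intro!: derivative_eq_intros has_vector_derivative_of_real simp flip: has_real_derivative_iff_has_vector_derivative\<close>)
    define E where "E x = (ch1 * ch x + ch x * ch1) * (w1 x * cnj (w x))
        + (ch x * ch x) * (w2 x * cnj (w x) + w1 x * cnj (w1 x))" for x
    have acE: "AC (\<lambda>x. ch x * ch x * (w1 x * cnj (w x))) E"
      unfolding E_def by (intro AC_mult AC_cnj acw acw1 \<open>AC ch (\<lambda>x. ch1)\<close>)
    have ER: "(LBINT x:{0..R}. E x) = - (w1 0 * cnj (w 0))"
      using AC_integral[OF acE, of R] R by (simp add: ch_def)
    have Ei: "set_integrable lborel {0..R} E" using AC_set_integrable[OF acE, of 0 R] R by simp
    note E' = lebesgue_on_set_integrable[OF Ei]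
    have i1: "integrable (lebesgue_on {0..R}) (\<lambda>x. (1 - x / R)\<^sup>2 * (cmod (w1 x))\<^sup>2)"
      by (rule continuous_imp_integrable_real) (use R in \<open>auto intro!: continuous_intros continuous_on_subset[OF cw1]\<close>)
    have i2: "integrable (lebesgue_on {0..R}) (\<lambda>x. Re (c * a * E x))"
      using E'(1) by (intro integrable_Re integrable_mult_right) auto
    have i3: "integrable (lebesgue_on {0..R}) G"
      by (rule integrable_lebesgue_on_subset[OF Gi]) auto
    \<comment> \<open>The derivative \<open>E\<close> is rewritten by the equation for
      \<open>w2\<close>. The potential appears with a favourable sign and is discarded; half of
      \<open>k\<close> is spent on the term with the derivative of the cutoff, leaving
      \<open>k / 2\<close>.\<close>
    have pt: "k / 2 * ((1 - x / R)\<^sup>2 * (cmod (w1 x))\<^sup>2) \<le> Re (c * a * E x) + G x" if x: "x \<in> {0..R}" for x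
    proof -
      define t where "t = 1 - x / R"
      have t: "0 \<le> t" using x R by (simp add: t_def)
      have "a * w2 x = - F x - q x * w x" by (simp add: F_def)
      then have "c * a * E x = c * (ch x * ch x) * ((- F x - q x * w x) * cnj (w x)) + c * a * (ch x * ch x) * (w1 x * cnj (w1 x))
          + 2 * c * a * ch1 * ch x * (w1 x * cnj (w x))"
        unfolding E_def by algebra
      also have "\<dots> = of_real (t\<^sup>2) * (- (c * (F x * cnj (w x)))) + of_real (t\<^sup>2 * (cmod (w x))\<^sup>2) * (- (c * q x))
          + of_real (t\<^sup>2 * (cmod (w1 x))\<^sup>2) * (c * a) + of_real (- 2 * t / R) * (c * a * (w1 x * cnj (w x)))"
        unfolding ch_def ch1_def t_def[symmetric] of_real_mult complex_norm_square
        by (simp add: power2_eq_square algebra_simps)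
      finally have Re: "Re (c * a * E x) = - t\<^sup>2 * Re (c * (F x * cnj (w x))) - (t\<^sup>2 * (cmod (w x))\<^sup>2) * Re (c * q x)
          + (t\<^sup>2 * (cmod (w1 x))\<^sup>2) * k - 2 * t / R * Re (c * a * (w1 x * cnj (w x)))"
        unfolding k_def by (simp only: plus_complex.simps Re_complex_of_real Im_complex_of_real times_complex.simps(1)
            mult_zero_left uminus_complex.simps)
      have "(t\<^sup>2 * (cmod (w x))\<^sup>2) * Re (c * q x) \<le> 0"
        using cq[of x] x by (intro mult_nonneg_nonpos) auto
      moreover have "t\<^sup>2 * Re (c * (F x * cnj (w x))) \<le> cmod c * cmod (F x * cnj (w x))"
      proof -
        have "t\<^sup>2 \<le> 1" using t x R by (simp add: t_def power_le_one)
        have "t\<^sup>2 * Re (c * (F x * cnj (w x))) \<le> t\<^sup>2 * cmod (c * (F x * cnj (w x)))"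
          by (intro mult_left_mono complex_Re_le_cmod) auto
        also have "\<dots> \<le> 1 * cmod (c * (F x * cnj (w x)))"
          using \<open>t\<^sup>2 \<le> 1\<close> by (intro mult_right_mono) auto
        finally show ?thesis by (simp add: norm_mult)
      qed
      moreover have "2 * t / R * Re (c * a * (w1 x * cnj (w x)))
          \<le> k / 2 * (t\<^sup>2 * (cmod (w1 x))\<^sup>2) + 2 * (cmod (c * a))\<^sup>2 / k * (cmod (w x))\<^sup>2"
      proof -
        define X Y where "X = t * cmod (w1 x)" and "Y = cmod (c * a) * cmod (w x)"
        have XY: "0 \<le> X" "0 \<le> Y" using t by (auto simp: X_def Y_def)
        have "2 * t / R * Re (c * a * (w1 x * cnj (w x))) \<le> 2 * t / R * cmod (c * a * (w1 x * cnj (w x)))"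
          using t R by (intro mult_left_mono complex_Re_le_cmod) auto
        also have "\<dots> = (2 * (X * Y)) / R" by (simp add: X_def Y_def norm_mult)
        also have "\<dots> \<le> (2 * (X * Y)) / 1" using XY R by (intro divide_left_mono) auto
        also have "\<dots> \<le> k / 2 * X\<^sup>2 + 2 / k * Y\<^sup>2"
        proof -
          have "0 \<le> (k / 2 * X - Y)\<^sup>2" by simp
          moreover have "(k / 2 * X - Y)\<^sup>2 = k\<^sup>2 / 4 * X\<^sup>2 - k * (X * Y) + Y\<^sup>2"
            by (simp add: power2_eq_square algebra_simps)
          moreover have "k * (k / 4 * X\<^sup>2 + Y\<^sup>2 / k) = k\<^sup>2 / 4 * X\<^sup>2 + Y\<^sup>2"
            using k by (simp add: field_simps power2_eq_square)
          ultimately have "k * (X * Y) \<le> k * (k / 4 * X\<^sup>2 + Y\<^sup>2 / k)" by linarith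
          then have "X * Y \<le> k / 4 * X\<^sup>2 + Y\<^sup>2 / k" using k by (rule mult_left_le_imp_le)
          then show ?thesis by simp
        qed
        finally show ?thesis by (simp add: X_def Y_def power_mult_distrib)
      qed
      ultimately show ?thesis unfolding Re G_def t_def[symmetric] by (simp add: algebra_simps)
    qed
    have "k / 2 * integral\<^sup>L (lebesgue_on {0..R}) (\<lambda>x. (1 - x / R)\<^sup>2 * (cmod (w1 x))\<^sup>2)
        = integral\<^sup>L (lebesgue_on {0..R}) (\<lambda>x. k / 2 * ((1 - x / R)\<^sup>2 * (cmod (w1 x))\<^sup>2))"
      by simp
    also have "\<dots> \<le> integral\<^sup>L (lebesgue_on {0..R}) (\<lambda>x. Re (c * a * E x) + G x)"
      using i1 i2 i3 pt by (intro integral_mono) auto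
    also have "\<dots> = Re (c * a * integral\<^sup>L (lebesgue_on {0..R}) E) + integral\<^sup>L (lebesgue_on {0..R}) G"
      using i2 i3 E'(1) by (simp add: integral_Re[symmetric] del: integral_Re)
    also have "integral\<^sup>L (lebesgue_on {0..R}) E = - (w1 0 * cnj (w 0))" using E'(2) ER by simp
    also have "Re (c * a * - (w1 0 * cnj (w 0))) + integral\<^sup>L (lebesgue_on {0..R}) G \<le> K"
      using integral_lebesgue_on_mono[OF Gi G0, of R] complex_Re_le_cmod[of "c * a * - (w1 0 * cnj (w 0))"]
      unfolding K_def by simp
    finally show ?thesis .
  qed
  have meas: "w1 \<in> borel_measurable (lebesgue_on {0..})"
    by (rule continuous_measurable_lebesgue_on[OF cw1]) simp
  have bound: "integral\<^sup>L (lebesgue_on {0..real n}) (\<lambda>x. (cmod (w1 x))\<^sup>2) \<le> 8 * K / k" if n: "n \<ge> 1" for n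
  proof -
    \<comment> \<open>With twice the radius the cutoff is at least 1/2 on
      \<open>{0..real n}\<close>, its square at least 1/4. Together with the factor
      \<open>k / 2\<close> of \<open>main\<close> this is the origin of the 8.\<close>
    define R where "R = 2 * real n"
    have R: "R \<ge> 1" using n by (simp add: R_def)
    have ci: "integrable (lebesgue_on {0..R}) (\<lambda>x. (1 - x / R)\<^sup>2 * (cmod (w1 x))\<^sup>2)"
      by (rule continuous_imp_integrable_real) (use R in \<open>auto intro!: continuous_intros continuous_on_subset[OF cw1]\<close>)
    have cj: "integrable (lebesgue_on {0..real n}) (\<lambda>x. (1 / 4) * (cmod (w1 x))\<^sup>2)"
      by (rule continuous_imp_integrable_real) (auto intro!: continuous_intros continuous_on_subset[OF cw1])
    have "(LINT x|lebesgue. indicator {0..real n} x *\<^sub>R ((1 / 4) * (cmod (w1 x))\<^sup>2))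
       \<le> (LINT x|lebesgue. indicator {0..R} x *\<^sub>R ((1 - x / R)\<^sup>2 * (cmod (w1 x))\<^sup>2))"
    proof (rule integral_mono)
      show "indicator {0..real n} x *\<^sub>R ((1 / 4) * (cmod (w1 x))\<^sup>2) \<le> indicator {0..R} x *\<^sub>R ((1 - x / R)\<^sup>2 * (cmod (w1 x))\<^sup>2)" for x
      proof (cases "x \<in> {0..real n}")
        case True
        then have "1 / 2 \<le> 1 - x / R" using n by (simp add: R_def field_simps)
        then have "(1 / 2)\<^sup>2 \<le> (1 - x / R)\<^sup>2" by (intro power_mono) auto
        then have "1 / 4 \<le> (1 - x / R)\<^sup>2" by (simp add: power2_eq_square)
        then have "1 / 4 * (cmod (w1 x))\<^sup>2 \<le> (1 - x / R)\<^sup>2 * (cmod (w1 x))\<^sup>2" by (intro mult_right_mono) auto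
        moreover have "x \<in> {0..R}" using True by (simp add: R_def)
        ultimately show ?thesis using True by (simp only: indicator_simps scaleR_one)
      qed simp
    qed (use ci cj in \<open>auto simp: integrable_restrict_space\<close>)
    then have "integral\<^sup>L (lebesgue_on {0..real n}) (\<lambda>x. (1 / 4) * (cmod (w1 x))\<^sup>2)
       \<le> integral\<^sup>L (lebesgue_on {0..R}) (\<lambda>x. (1 - x / R)\<^sup>2 * (cmod (w1 x))\<^sup>2)"
      by (subst (1 2) integral_restrict_space) auto
    then have "1 / 4 * integral\<^sup>L (lebesgue_on {0..real n}) (\<lambda>x. (cmod (w1 x))\<^sup>2)
       \<le> integral\<^sup>L (lebesgue_on {0..R}) (\<lambda>x. (1 - x / R)\<^sup>2 * (cmod (w1 x))\<^sup>2)" by simp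
    from mult_left_mono[OF this, of "k / 2"] main[OF R] k
    have "k / 2 * (1 / 4 * integral\<^sup>L (lebesgue_on {0..real n}) (\<lambda>x. (cmod (w1 x))\<^sup>2)) \<le> K" by linarith
    then show ?thesis using k by (simp add: field_simps)
  qed
  have "(\<integral>\<^sup>+x. ennreal ((cmod (w1 x))\<^sup>2) \<partial>lebesgue_on {0..}) \<le> ennreal ((sqrt (8 * K / k))\<^sup>2)"
  proof -
    \<comment> \<open>Integrability of the square of \<open>w1\<close> on the half-line is still
      open, so the passage to the limit uses nonnegative integrals and monotone convergence.\<close>
    let ?g = "\<lambda>n x. ennreal ((cmod (w1 x))\<^sup>2) * indicator {0..real (Suc n)} x"
    have m: "(\<lambda>x. ennreal ((cmod (w1 x))\<^sup>2) * indicator {0..} x) \<in> borel_measurable lebesgue"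
    proof -
      have "(\<lambda>x. ennreal ((cmod (w1 x))\<^sup>2)) \<in> borel_measurable (lebesgue_on {0..})" using meas by measurable
      then show ?thesis by (subst (asm) borel_measurable_restrict_space_iff_ennreal) auto
    qed
    have eq: "?g n = (\<lambda>x. (ennreal ((cmod (w1 x))\<^sup>2) * indicator {0..} x) * indicator {0..real (Suc n)} x)" for n
      by (auto simp: fun_eq_iff indicator_def)
    have "(\<integral>\<^sup>+x. ennreal ((cmod (w1 x))\<^sup>2) \<partial>lebesgue_on {0..}) = (\<integral>\<^sup>+x. ennreal ((cmod (w1 x))\<^sup>2) * indicator {0..} x \<partial>lebesgue)"
      by (rule nn_integral_restrict_space) simp
    also have "\<dots> = (\<integral>\<^sup>+x. (SUP n. ?g n x) \<partial>lebesgue)"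
    proof (rule nn_integral_cong)
      fix x :: real
      show "ennreal ((cmod (w1 x))\<^sup>2) * indicator {0..} x = (SUP n. ?g n x)"
      proof (rule antisym)
        have "x \<le> real (Suc (nat \<lceil>x\<rceil>))" by linarith
        then have "ennreal ((cmod (w1 x))\<^sup>2) * indicator {0..} x \<le> ?g (nat \<lceil>x\<rceil>) x"
          by (auto simp: indicator_def)
        then show "ennreal ((cmod (w1 x))\<^sup>2) * indicator {0..} x \<le> (SUP n. ?g n x)"
          by (rule SUP_upper2[rotated]) simp
        show "(SUP n. ?g n x) \<le> ennreal ((cmod (w1 x))\<^sup>2) * indicator {0..} x"
          by (rule SUP_least) (auto simp: indicator_def)
      qed
    qed
    also have "\<dots> = (SUP n. (\<integral>\<^sup>+x. ?g n x \<partial>lebesgue))"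
    proof (rule nn_integral_monotone_convergence_SUP)
      show "incseq ?g" by (auto simp: incseq_def le_fun_def indicator_def)
      show "?g n \<in> borel_measurable lebesgue" for n
        unfolding eq by (intro borel_measurable_times_ennreal m borel_measurable_indicator) simp
    qed
    also have "\<dots> \<le> ennreal (8 * K / k)"
    proof (rule SUP_least)
      fix n
      have "integrable (lebesgue_on {0..real (Suc n)}) (\<lambda>x. (cmod (w1 x))\<^sup>2)"
        by (rule continuous_imp_integrable_real) (auto intro!: continuous_intros continuous_on_subset[OF cw1])
      then have "(\<integral>\<^sup>+x. ennreal ((cmod (w1 x))\<^sup>2) \<partial>lebesgue_on {0..real (Suc n)})
          = ennreal (integral\<^sup>L (lebesgue_on {0..real (Suc n)}) (\<lambda>x. (cmod (w1 x))\<^sup>2))"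
        by (rule nn_integral_eq_integral) simp
      also have "\<dots> \<le> ennreal (8 * K / k)" by (intro ennreal_leI bound) simp
      finally show "(\<integral>\<^sup>+x. ?g n x \<partial>lebesgue) \<le> ennreal (8 * K / k)"
        by (subst (asm) nn_integral_restrict_space) auto
    qed
    also have "8 * K / k = (sqrt (8 * K / k))\<^sup>2" using K0 k by simp
    finally show ?thesis .
  qed
  then show ?thesis by (rule L2_if_nn_integral_le(1)[OF meas, rotated]) (use K0 k in simp)
qed

subsection \<open>Cutoffs\<close>

text \<open>At the kink the difference quotient is bounded by
  \<open>\<bar>h\<bar> ^ (k + 1)\<close>, which tends to 0 as the exponent is at least two.\<close>

lemma has_real_derivative_max_power:
  "((\<lambda>y::real. (max 0 y) ^ (k + 2)) has_real_derivative (real (k + 2) * (max 0 y) ^ (k + 1))) (at y)"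
proof -
  consider "y > 0" | "y < 0" | "y = 0" by linarith
  then show ?thesis
  proof cases
    case 1
    have "((\<lambda>y. y ^ (k + 2)) has_real_derivative (real (k + 2) * y ^ (k + 1))) (at y)"
      using DERIV_pow[of "k + 2" y] by simp
    then have "((\<lambda>y. (max 0 y) ^ (k + 2)) has_real_derivative (real (k + 2) * y ^ (k + 1))) (at y)"
      by (rule has_field_derivative_transform_within_open[of _ _ _ "{0<..}"]) (use 1 in auto)
    then show ?thesis using 1 by (simp add: max_def)
  next
    case 2
    have "((\<lambda>y::real. 0) has_real_derivative 0) (at y)" by simp
    then have "((\<lambda>y. (max 0 y) ^ (k + 2)) has_real_derivative 0) (at y)"
      by (rule has_field_derivative_transform_within_open[of _ _ _ "{..<0}"]) (use 2 in auto)
    then show ?thesis using 2 by (simp add: max_def)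
  next
    case 3
    have "(\<lambda>h. ((max 0 h) ^ (k + 2) - (max 0 0) ^ (k + 2)) / (h - 0)) \<midarrow>0\<rightarrow> (0::real)"
    proof (rule Lim_null_comparison)
      have "((\<lambda>h::real. \<bar>h\<bar> ^ (k + 1)) \<longlongrightarrow> \<bar>0\<bar> ^ (k + 1)) (at 0)" by (intro tendsto_intros)
      then show "((\<lambda>h::real. \<bar>h\<bar> ^ (k + 1)) \<longlongrightarrow> 0) (at 0)" by simp
      have "norm (((max 0 h) ^ (k + 2) - (max 0 0) ^ (k + 2)) / (h - 0)) \<le> \<bar>h\<bar> ^ (k + 1)" for h :: real
      proof (cases "h > 0")
        case True
        then show ?thesis by (simp add: abs_mult power_abs)
      next
        case False
        then have m: "max 0 h = 0" by simp
        show ?thesis unfolding m by (simp del: power_Suc)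
      qed
      then show "\<forall>\<^sub>F h in at 0. norm (((max 0 h) ^ (k + 2) - (max 0 0) ^ (k + 2)) / (h - 0)) \<le> \<bar>h\<bar> ^ (k + 1)" for h :: real
        by simp
    qed
    then show ?thesis using 3 by (simp add: has_field_derivative_iff)
  qed
qed

lemma AC_of_real_C1:
  assumes "\<And>x. 0 \<le> x \<Longrightarrow> (g has_real_derivative g' x) (at x)" "continuous_on {0..} g'"
  shows "AC (\<lambda>x. complex_of_real (g x)) (\<lambda>x. complex_of_real (g' x))"
proof (rule AC_C1)
  show "((\<lambda>x. complex_of_real (g x)) has_vector_derivative complex_of_real (g' x)) (at x)" if "0 \<le> x" for x
    using assms(1)[OF that] by (intro has_vector_derivative_of_real) (simp add: has_real_derivative_iff_has_vector_derivative)
qed (intro continuous_intros assms(2))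

text \<open>The third power makes the function twice continuously differentiable across
  \<open>x = R\<close>, so that multiplication by it preserves locally absolutely continuous first
  derivatives; its derivatives have size \<open>1 / R\<close> and
  \<open>1 / R\<^sup>2\<close>.\<close>

definition cutoff :: "real \<Rightarrow> real \<Rightarrow> complex" where
  "cutoff R x = of_real ((max 0 (1 - x / R)) ^ 3)"

definition cutoff1 :: "real \<Rightarrow> real \<Rightarrow> complex" where
  "cutoff1 R x = of_real (- 3 / R * (max 0 (1 - x / R)) ^ 2)"

definition cutoff2 :: "real \<Rightarrow> real \<Rightarrow> complex" where
  "cutoff2 R x = of_real (6 / R\<^sup>2 * max 0 (1 - x / R))"

lemma AC_cutoff:
  assumes R: "R > 0"
  shows "AC (cutoff R) (cutoff1 R)" "AC (cutoff1 R) (cutoff2 R)"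
proof -
  have inner: "((\<lambda>x. 1 - x / R) has_real_derivative (- 1 / R)) (at x)" for x
    using R by (auto intro!: derivative_eq_intros)
  have d3: "((\<lambda>x. (max 0 (1 - x / R)) ^ 3) has_real_derivative (- 3 / R * (max 0 (1 - x / R)) ^ 2)) (at x)" for x
    using DERIV_chain2[OF has_real_derivative_max_power[of 1] inner, of x] by (simp add: numeral_eq_Suc)
  have d2: "((\<lambda>x. (max 0 (1 - x / R)) ^ 2) has_real_derivative (- 2 / R * max 0 (1 - x / R))) (at x)" for x
    using DERIV_chain2[OF has_real_derivative_max_power[of 0] inner, of x] by (simp add: numeral_eq_Suc)
  have d2': "((\<lambda>x. - 3 / R * (max 0 (1 - x / R)) ^ 2) has_real_derivative (6 / R\<^sup>2 * max 0 (1 - x / R))) (at x)" for x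
    using DERIV_cmult[OF d2, of "- 3 / R" x] by (simp add: power2_eq_square)
  show "AC (cutoff R) (cutoff1 R)"
    unfolding cutoff_def cutoff1_def
    by (rule AC_of_real_C1[OF d3]) (use R in \<open>auto intro!: continuous_intros\<close>)
  show "AC (cutoff1 R) (cutoff2 R)"
    unfolding cutoff1_def cutoff2_def
    by (rule AC_of_real_C1[OF d2']) (use R in \<open>auto intro!: continuous_intros\<close>)
qed

lemma cutoff_bounds:
  assumes R: "R > 0" and x: "x \<ge> 0"
  shows "cmod (cutoff R x - 1) \<le> 1" "cmod (cutoff R x) \<le> 1" "cmod (cutoff1 R x) \<le> 3 / R" "cmod (cutoff2 R x) \<le> 6 / R\<^sup>2"
proof -
  define m where "m = max 0 (1 - x / R)"
  have m: "0 \<le> m" "m \<le> 1" using R x by (auto simp: m_def)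
  have p: "0 \<le> m ^ k" "m ^ k \<le> 1" for k using m by (auto intro: power_le_one)
  show "cmod (cutoff R x) \<le> 1" unfolding cutoff_def m_def[symmetric] norm_of_real using p[of 3] by simp
  have "cutoff R x - 1 = of_real (m ^ 3 - 1)" unfolding cutoff_def m_def[symmetric] by simp
  then show "cmod (cutoff R x - 1) \<le> 1" using p[of 3] by (simp only: norm_of_real)
  have "\<bar>- 3 / R * m\<^sup>2\<bar> = 3 / R * m\<^sup>2" using R p[of 2] by (simp add: abs_mult)
  also have "\<dots> \<le> 3 / R * 1" using R p[of 2] by (intro mult_left_mono) auto
  finally show "cmod (cutoff1 R x) \<le> 3 / R" unfolding cutoff1_def m_def[symmetric] norm_of_real by simp
  have "\<bar>6 / R\<^sup>2 * m\<bar> = 6 / R\<^sup>2 * m" using R m by (simp add: abs_mult)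
  also have "\<dots> \<le> 6 / R\<^sup>2 * 1" using R m by (intro mult_left_mono) auto
  finally show "cmod (cutoff2 R x) \<le> 6 / R\<^sup>2" unfolding cutoff2_def m_def[symmetric] norm_of_real by simp
qed

lemma cutoff_support: "R > 0 \<Longrightarrow> x \<ge> R \<Longrightarrow> cutoff R x = 0 \<and> cutoff1 R x = 0"
  by (simp add: cutoff_def cutoff1_def field_simps max_def)

lemma AC_measurable: "AC w w1 \<Longrightarrow> w \<in> borel_measurable (lebesgue_on {0..})"
  by (rule continuous_measurable_lebesgue_on[OF AC_continuous]) auto

lemma cutoff_measurable:
  assumes "R > 0"
  shows "cutoff R \<in> borel_measurable (lebesgue_on {0..})" "cutoff1 R \<in> borel_measurable (lebesgue_on {0..})"
    "cutoff2 R \<in> borel_measurable (lebesgue_on {0..})"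
proof -
  show "cutoff R \<in> borel_measurable (lebesgue_on {0..})" "cutoff1 R \<in> borel_measurable (lebesgue_on {0..})"
    using AC_measurable AC_cutoff[OF assms] by auto
  have "continuous_on {0..} (cutoff2 R)"
    unfolding cutoff2_def using assms by (intro continuous_intros) auto
  then show "cutoff2 R \<in> borel_measurable (lebesgue_on {0..})"
    by (rule continuous_measurable_lebesgue_on) simp
qed

lemma cutoff_tendsto_L2:
  assumes f: "f \<in> L2 {0..}"
  shows "(\<lambda>n. l2norm {0..} (\<lambda>x. (cutoff (real (Suc n)) x - 1) * f x)) \<longlonglongrightarrow> 0"
proof -
  have fm: "f \<in> borel_measurable (lebesgue_on {0..})" by (rule L2_measurable[OF f])
  have "(\<lambda>n. LINT x|lebesgue_on {0..}. (cmod ((cutoff (real (Suc n)) x - 1) * f x))\<^sup>2)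
      \<longlonglongrightarrow> (LINT x|lebesgue_on {0::real..}. 0 :: real)"
  proof (rule integral_dominated_convergence[where w = "\<lambda>x. (cmod (f x))\<^sup>2"])
    show "integrable (lebesgue_on {0..}) (\<lambda>x. (cmod (f x))\<^sup>2)" by (rule L2_integrable_sq[OF f])
    show "(\<lambda>x. (cmod ((cutoff (real (Suc n)) x - 1) * f x))\<^sup>2) \<in> borel_measurable (lebesgue_on {0..})" for n
      using fm cutoff_measurable(1)[of "real (Suc n)"] by measurable
    have "(\<lambda>n. (cmod ((cutoff (real (Suc n)) x - 1) * f x))\<^sup>2) \<longlonglongrightarrow> 0" for x
    proof -
      have "(\<lambda>n. x * inverse (real (Suc n))) \<longlonglongrightarrow> x * 0"
        by (intro tendsto_mult tendsto_const LIMSEQ_inverse_real_of_nat)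
      then have "(\<lambda>n. x / real (Suc n)) \<longlonglongrightarrow> 0"
        by (simp only: divide_inverse mult_zero_right)
      then have "(\<lambda>n. (cmod ((of_real ((max 0 (1 - x / real (Suc n))) ^ 3) - 1) * f x))\<^sup>2)
          \<longlonglongrightarrow> (cmod ((of_real ((max 0 (1 - 0)) ^ 3) - 1) * f x))\<^sup>2"
        by (intro tendsto_intros)
      then show ?thesis by (simp add: cutoff_def)
    qed
    then show "AE x in lebesgue_on {0..}. (\<lambda>n. (cmod ((cutoff (real (Suc n)) x - 1) * f x))\<^sup>2) \<longlonglongrightarrow> 0" by simp
    have "(cmod ((cutoff (real (Suc n)) x - 1) * f x))\<^sup>2 \<le> (cmod (f x))\<^sup>2" if "x \<in> {0..}" for n x
      using mult_right_mono[OF cutoff_bounds(1)[of "real (Suc n)" x], of "cmod (f x)"] that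
      by (intro power_mono) (auto simp: norm_mult)
    then show "AE x in lebesgue_on {0..}. norm ((cmod ((cutoff (real (Suc n)) x - 1) * f x))\<^sup>2) \<le> (cmod (f x))\<^sup>2" for n
      by (intro AE_I2) simp
  qed simp
  then have "(\<lambda>n. sqrt (LINT x|lebesgue_on {0..}. (cmod ((cutoff (real (Suc n)) x - 1) * f x))\<^sup>2)) \<longlonglongrightarrow> sqrt 0"
    by (intro tendsto_real_sqrt) simp
  then show ?thesis by (simp only: l2norm_def real_sqrt_zero)
qed

text \<open>Multiplication by the cutoffs produces approximants in the graph norm because the
  error terms \<open>\<chi>' w'\<close> and \<open>\<chi>'' w\<close> are controlled by \<open>w' \<in> L2\<close> and \<open>w \<in> L2\<close>.\<close>
lemma max_rep_zero_data_in_A0: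
  assumes q: "continuous_on {0..} q" and ca: "0 < Re (c * a)" and cq: "\<And>x. 0 \<le> x \<Longrightarrow> Re (c * q x) \<le> 0"
    and rep: "max_rep a q w w1 w2" and init: "w 0 = 0" "w1 0 = 0"
    and uf: "u \<in> L2 {0..}" "f \<in> L2 {0..}" "aeq {0..} u w" "aeq {0..} f (\<lambda>x. - a * w2 x - q x * w x)"
  shows "(u, f) \<in> A0 {0..} a q"
proof -
  define F where "F x = - a * w2 x - q x * w x" for x
  have acw: "AC w w1" and acw1: "AC w1 w2" and wL: "w \<in> L2 {0..}" and FL: "F \<in> L2 {0..}"
    using rep by (auto simp: max_rep_def F_def[abs_def])
  have w1L: "w1 \<in> L2 {0..}" using max_rep_deriv_L2[OF rep ca cq] .
  define U where "U n x = cutoff (real (Suc n)) x * w x" for n x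
  define U1 where "U1 n x = cutoff1 (real (Suc n)) x * w x + cutoff (real (Suc n)) x * w1 x" for n x
  define U2 where "U2 n x = (cutoff2 (real (Suc n)) x * w x + cutoff1 (real (Suc n)) x * w1 x)
      + (cutoff1 (real (Suc n)) x * w1 x + cutoff (real (Suc n)) x * w2 x)" for n x
  define V where "V n x = - a * U2 n x - q x * U n x" for n x
  \<comment> \<open>The commutator of the differential expression with the cutoff. The potential
    contributes nothing to it, so its growth does not matter.\<close>
  define Z where "Z n x = (-2 * a) * (cutoff1 (real (Suc n)) x * w1 x) + (- a) * (cutoff2 (real (Suc n)) x * w x)" for n x
  have V_eq: "V n = (\<lambda>x. cutoff (real (Suc n)) x * F x + Z n x)" for n
    by (auto simp: V_def U2_def U_def F_def Z_def fun_eq_iff algebra_simps)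
  note bd = L2_mult_bounded[where S="{0..}"]
  have n0: "real (Suc n) > 0" for n by simp
  have c1w1: "(\<lambda>x. cutoff1 (real (Suc n)) x * w1 x) \<in> L2 {0..}"
      "l2norm {0..} (\<lambda>x. cutoff1 (real (Suc n)) x * w1 x) \<le> 3 / real (Suc n) * l2norm {0..} w1" for n
    by (rule bd[OF w1L cutoff_measurable(2)[OF n0] cutoff_bounds(3)[OF n0]]; simp)+
  have c2w: "(\<lambda>x. cutoff2 (real (Suc n)) x * w x) \<in> L2 {0..}"
      "l2norm {0..} (\<lambda>x. cutoff2 (real (Suc n)) x * w x) \<le> 6 / (real (Suc n))\<^sup>2 * l2norm {0..} w" for n
    by (rule bd[OF wL cutoff_measurable(3)[OF n0] cutoff_bounds(4)[OF n0]]; simp)+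
  have cwL: "(\<lambda>x. cutoff (real (Suc n)) x * g x) \<in> L2 {0..}" if "g \<in> L2 {0..}" for g n
    by (rule bd(1)[OF that cutoff_measurable(1)[OF n0] cutoff_bounds(2)[OF n0]]; simp)
  have cw1L: "(\<lambda>x. (cutoff (real (Suc n)) x - 1) * g x) \<in> L2 {0..}" if "g \<in> L2 {0..}" for g n
    using L2_diff[OF cwL[OF that, of n] that] by (simp add: algebra_simps)
  have ZL: "Z n \<in> L2 {0..}" for n
    unfolding Z_def by (intro L2_add L2_scale c1w1(1) c2w(1))
  have ZB: "l2norm {0..} (Z n) \<le> 2 * cmod a * (3 / real (Suc n) * l2norm {0..} w1) + cmod a * (6 / (real (Suc n))\<^sup>2 * l2norm {0..} w)" for n
  proof -
    have "l2norm {0..} (Z n) \<le> l2norm {0..} (\<lambda>x. (-2 * a) * (cutoff1 (real (Suc n)) x * w1 x))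
        + l2norm {0..} (\<lambda>x. (- a) * (cutoff2 (real (Suc n)) x * w x))"
      unfolding Z_def by (intro l2norm_triangle L2_scale c1w1(1) c2w(1))
    also have "\<dots> = 2 * cmod a * l2norm {0..} (\<lambda>x. cutoff1 (real (Suc n)) x * w1 x)
        + cmod a * l2norm {0..} (\<lambda>x. cutoff2 (real (Suc n)) x * w x)"
      unfolding l2norm_scale by (simp add: norm_mult)
    also have "\<dots> \<le> 2 * cmod a * (3 / real (Suc n) * l2norm {0..} w1) + cmod a * (6 / (real (Suc n))\<^sup>2 * l2norm {0..} w)"
      by (intro add_mono mult_left_mono c1w1(2) c2w(2)) auto
    finally show ?thesis .
  qed
  have UL: "U n \<in> L2 {0..}" for n unfolding U_def by (rule cwL[OF wL])
  have VL: "V n \<in> L2 {0..}" for n unfolding V_eq by (intro L2_add cwL FL ZL)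
  have pre: "(U n, V n) \<in> A0pre {0..} a q" for n
  proof -
    have "AC (U n) (U1 n)" "AC (U1 n) (U2 n)"
      unfolding U_def U1_def U2_def by (intro AC_add AC_mult AC_cutoff[OF n0] acw acw1)+
    moreover have "U n 0 = 0" "U1 n 0 = 0" using init by (auto simp: U_def U1_def)
    moreover have "\<exists>B. bounded B \<and> (\<forall>x\<in>{0..} - B. U n x = 0)"
      by (rule exI[of _ "{0..real (Suc n)}"]) (use cutoff_support[OF n0[of n]] in \<open>auto simp: U_def\<close>)
    moreover have "aeq {0..} (V n) (\<lambda>x. - a * U2 n x - q x * U n x)" by (simp add: V_def[abs_def])
    ultimately show ?thesis unfolding A0pre_def using UL VL aeq_refl by blast
  qed
  have "(\<lambda>n. l2norm {0..} (\<lambda>x. U n x - u x)) \<longlonglongrightarrow> 0"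
  proof -
    have "l2norm {0..} (\<lambda>x. U n x - u x) = l2norm {0..} (\<lambda>x. (cutoff (real (Suc n)) x - 1) * w x)" for n
    proof (rule l2norm_cong_aeq[OF L2_diff[OF UL uf(1)] cw1L[OF wL]])
      show "aeq {0..} (\<lambda>x. U n x - u x) (\<lambda>x. (cutoff (real (Suc n)) x - 1) * w x)"
        using uf(3) unfolding aeq_def by eventually_elim (simp add: U_def algebra_simps)
    qed
    then show ?thesis using cutoff_tendsto_L2[OF wL] by simp
  qed
  moreover have "(\<lambda>n. l2norm {0..} (\<lambda>x. V n x - f x)) \<longlonglongrightarrow> 0"
  proof (rule Lim_null_comparison)
    let ?e = "\<lambda>n. 2 * cmod a * (3 / real (Suc n) * l2norm {0..} w1) + cmod a * (6 / (real (Suc n))\<^sup>2 * l2norm {0..} w)"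
    have i: "(\<lambda>n. inverse (real (Suc n))) \<longlonglongrightarrow> 0" by (rule LIMSEQ_inverse_real_of_nat)
    have "(\<lambda>n. 2 * cmod a * (3 * inverse (real (Suc n)) * l2norm {0..} w1)
        + cmod a * (6 * (inverse (real (Suc n)))\<^sup>2 * l2norm {0..} w)) \<longlonglongrightarrow> 
        2 * cmod a * (3 * 0 * l2norm {0..} w1) + cmod a * (6 * 0\<^sup>2 * l2norm {0..} w)"
      by (intro tendsto_intros i)
    then have "?e \<longlonglongrightarrow> 0" by (simp add: divide_inverse power_inverse)
    from tendsto_add[OF cutoff_tendsto_L2[OF FL] this]
    show "(\<lambda>n. l2norm {0..} (\<lambda>x. (cutoff (real (Suc n)) x - 1) * F x) + ?e n) \<longlonglongrightarrow> 0" by simp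
    have "l2norm {0..} (\<lambda>x. V n x - f x) \<le> l2norm {0..} (\<lambda>x. (cutoff (real (Suc n)) x - 1) * F x) + ?e n" for n
    proof -
      have "l2norm {0..} (\<lambda>x. V n x - f x) = l2norm {0..} (\<lambda>x. (cutoff (real (Suc n)) x - 1) * F x + Z n x)"
      proof (rule l2norm_cong_aeq[OF L2_diff[OF VL uf(2)] L2_add[OF cw1L[OF FL] ZL]])
        show "aeq {0..} (\<lambda>x. V n x - f x) (\<lambda>x. (cutoff (real (Suc n)) x - 1) * F x + Z n x)"
          using uf(4) unfolding aeq_def F_def[symmetric] by eventually_elim (simp add: V_eq algebra_simps)
      qed
      also have "\<dots> \<le> l2norm {0..} (\<lambda>x. (cutoff (real (Suc n)) x - 1) * F x) + l2norm {0..} (Z n)"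
        by (rule l2norm_triangle[OF cw1L[OF FL] ZL])
      finally show ?thesis using ZB[of n] by linarith
    qed
    then show "\<forall>\<^sub>F n in sequentially. norm (l2norm {0..} (\<lambda>x. V n x - f x))
        \<le> l2norm {0..} (\<lambda>x. (cutoff (real (Suc n)) x - 1) * F x) + ?e n" by simp
  qed
  ultimately show ?thesis unfolding A0_def opclosure_def using pre uf by blast
qed

subsection \<open>Weak solutions\<close>

text \<open>Adjoint elements are merely Lebesgue measurable, while their primitives are formed with
  \<open>lborel\<close>. Real and imaginary parts are corrected on null sets separately.\<close>

lemma lebesgue_on_borel_representative:
  fixes v :: "real \<Rightarrow> complex"
  assumes "v \<in> borel_measurable (lebesgue_on {0..})"
  shows "\<exists>v'\<in>borel_measurable borel. aeq {0..} v v'"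
proof -
  have m: "(\<lambda>x. indicator {0..} x *\<^sub>R v x) \<in> borel_measurable (completion lborel)"
    using assms by (subst (asm) borel_measurable_restrict_space_iff) auto
  have "(\<lambda>x. Re (indicator {0..} x *\<^sub>R v x)) \<in> borel_measurable (completion lborel)"
    "(\<lambda>x. Im (indicator {0..} x *\<^sub>R v x)) \<in> borel_measurable (completion lborel)"
    using m by measurable
  from this[THEN completion_ex_borel_measurable_real]
  obtain r i where [measurable]: "r \<in> borel_measurable lborel" "i \<in> borel_measurable lborel"
    and ae: "AE x in lborel. Re (indicator {0..} x *\<^sub>R v x) = r x" "AE x in lborel. Im (indicator {0..} x *\<^sub>R v x) = i x"
    by auto
  have [measurable]: "r \<in> borel_measurable borel" "i \<in> borel_measurable borel"
    using \<open>r \<in> borel_measurable lborel\<close> \<open>i \<in> borel_measurable lborel\<close> by simp_all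
  have "(\<lambda>x. complex_of_real (r x) + \<i> * complex_of_real (i x)) \<in> borel_measurable borel"
    by measurable
  moreover have "AE x in lebesgue. x \<in> {0..} \<longrightarrow> v x = complex_of_real (r x) + \<i> * complex_of_real (i x)"
    using AE_completion[OF ae(1)] AE_completion[OF ae(2)]
    by eventually_elim (auto simp: complex_eq_iff)
  then have "aeq {0..} v (\<lambda>x. complex_of_real (r x) + \<i> * complex_of_real (i x))"
    unfolding aeq_def by (subst AE_restrict_space_iff) auto
  ultimately show ?thesis by blast
qed

lemma L2_Icc_integrable:
  assumes "v \<in> L2 {a..b}"
  shows "integrable (lebesgue_on {a..b}) v"
proof -
  have "(\<lambda>x. 1) \<in> L2 {a..b}"
    unfolding L2_def using continuous_imp_integrable_real[of a b "\<lambda>x. 1"] by simp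
  from L2_mult_integrable[OF assms this] show ?thesis by simp
qed

lemma L2_borel_locally_integrable:
  assumes "v \<in> L2 {0..}" "v \<in> borel_measurable borel"
  shows "set_integrable lborel {0..b} v"
proof (rule set_integrable_lborelI)
  have "v \<in> L2 {0..b}" by (rule L2_subset[OF assms(1)]) auto
  then show "integrable (lebesgue_on {0..b}) v" by (rule L2_Icc_integrable)
qed (use assms(2) in measurable)

lemma AE_exists_in_interval:
  fixes c d :: real
  assumes "AE x in lebesgue_on S. P x" "{c<..<d} \<subseteq> S" "c < d" "S \<in> sets lebesgue"
  shows "\<exists>x\<in>{c<..<d}. P x"
proof (rule ccontr)
  assume no: "\<not> ?thesis"
  have "AE x in lebesgue. x \<in> S \<longrightarrow> P x"
    using assms(1,4) by (subst (asm) AE_restrict_space_iff) auto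
  then have "AE x in lebesgue. x \<notin> {c<..<d}"
    by eventually_elim (use no assms(2) in blast)
  then have "{c<..<d} \<in> null_sets lebesgue"
    by (subst (asm) AE_iff_null_sets[symmetric]) auto
  then show False using assms(3) by (auto simp: null_sets_def)
qed

text \<open>The coefficients of the projection onto the affine functions: the system is the Gram
  matrix of 1 and \<open>x\<close> on \<open>[0, R]\<close>, whose determinant is
  \<open>R ^ 4 / 12\<close>.\<close>

lemma affine_moments:
  fixes h0 h1 :: complex and R :: real
  assumes "R > 0"
  shows "\<exists>\<alpha> \<beta>. h0 = \<alpha> * of_real R + \<beta> * of_real (R\<^sup>2 / 2) \<and> h1 = \<alpha> * of_real (R\<^sup>2 / 2) + \<beta> * of_real (R ^ 3 / 3)"
proof -
  define r where "r = complex_of_real R"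
  have r: "r \<noteq> 0" using assms by (simp add: r_def)
  \<comment> \<open>Cramer's rule; the 12 is the reciprocal of the constant in the
    determinant.\<close>
  define \<beta> where "\<beta> = 12 * (h1 - h0 * r / 2) / r ^ 3"
  define \<alpha> where "\<alpha> = h0 / r - \<beta> * r / 2"
  have e1: "\<beta> * r ^ 3 = 12 * h1 - 6 * h0 * r" unfolding \<beta>_def using r by (simp add: field_simps)
  have e2: "\<alpha> * r = h0 - \<beta> * r\<^sup>2 / 2" unfolding \<alpha>_def using r by (simp add: field_simps power2_eq_square)
  have "\<alpha> * r\<^sup>2 = \<alpha> * r * r" by (simp add: power2_eq_square)
  also have "\<dots> = h0 * r - \<beta> * r ^ 3 / 2"
    unfolding e2 by (simp add: algebra_simps power2_eq_square power3_eq_cube)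
  finally have e3: "\<alpha> * r\<^sup>2 = h0 * r - \<beta> * r ^ 3 / 2" .
  have "\<alpha> * (r\<^sup>2 / 2) + \<beta> * (r ^ 3 / 3) = (\<alpha> * r\<^sup>2) / 2 + (\<beta> * r ^ 3) / 3" by simp
  also have "\<dots> = h1" unfolding e3 e1 by (simp add: field_simps)
  finally have "h0 = \<alpha> * r + \<beta> * (r\<^sup>2 / 2)" "h1 = \<alpha> * (r\<^sup>2 / 2) + \<beta> * (r ^ 3 / 3)"
    using e2 by (simp_all add: algebra_simps)
  then show ?thesis unfolding r_def by (intro exI[of _ \<alpha>] exI[of _ \<beta>]) simp
qed

lemma LBINT_powers:
  assumes "0 \<le> R"
  shows "(LBINT x:{0..R}. (1::complex)) = of_real R"
    "(LBINT x:{0..R}. complex_of_real x) = of_real (R\<^sup>2 / 2)"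
    "(LBINT x:{0..R}. complex_of_real x * complex_of_real x) = of_real (R ^ 3 / 3)"
proof -
  have "AC (\<lambda>x. of_real x) (\<lambda>x. of_real 1)"
    by (rule AC_of_real_C1) (auto intro!: derivative_eq_intros)
  from AC_integral[OF this assms] show "(LBINT x:{0..R}. (1::complex)) = of_real R" by simp
  have "AC (\<lambda>x. of_real (x\<^sup>2 / 2)) (\<lambda>x. of_real x)"
    by (rule AC_of_real_C1) (auto intro!: derivative_eq_intros continuous_intros)
  from AC_integral[OF this assms] show "(LBINT x:{0..R}. complex_of_real x) = of_real (R\<^sup>2 / 2)" by simp
  have "AC (\<lambda>x. of_real (x ^ 3 / 3)) (\<lambda>x. of_real (x * x))"
    by (rule AC_of_real_C1) (auto intro!: derivative_eq_intros continuous_intros simp: power2_eq_square)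
  from AC_integral[OF this assms] show "(LBINT x:{0..R}. complex_of_real x * complex_of_real x) = of_real (R ^ 3 / 3)" by simp
qed

lemma AC_of_real: "AC (\<lambda>x. complex_of_real x) (\<lambda>x. 1)"
  using AC_of_real_C1[of "\<lambda>x. x" "\<lambda>x. 1"] by simp

lemma L2_Icc_continuous:
  assumes "continuous_on {a..b} f" shows "f \<in> L2 {a..b}"
proof -
  have "integrable (lebesgue_on {a..b}) (\<lambda>x. (cmod (f x))\<^sup>2)"
    by (rule continuous_imp_integrable_real) (intro continuous_intros assms)
  then show ?thesis
    using continuous_measurable_lebesgue_on[OF assms] by (simp add: L2_def)
qed

lemma L2_extend_zero:
  assumes "f \<in> L2 {0..b}" "\<And>x. x \<notin> {0..b} \<Longrightarrow> 0 \<le> x \<Longrightarrow> f x = 0"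
  shows "f \<in> L2 {0..}"
proof -
  have ind: "(\<lambda>x. indicator {0..} x *\<^sub>R f x) = (\<lambda>x. indicator {0..b} x *\<^sub>R f x)"
    using assms(2) by (auto simp: indicator_def fun_eq_iff)
  have ind2: "(\<lambda>x. indicator {0..} x *\<^sub>R (cmod (f x))\<^sup>2) = (\<lambda>x. indicator {0..b} x *\<^sub>R (cmod (f x))\<^sup>2)"
    using assms(2) by (auto simp: indicator_def fun_eq_iff)
  have "f \<in> borel_measurable (lebesgue_on {0..b})" using assms(1) by (rule L2_measurable)
  then have "f \<in> borel_measurable (lebesgue_on {0..})"
    by (subst borel_measurable_restrict_space_iff, simp, unfold ind, subst (asm) borel_measurable_restrict_space_iff) auto
  moreover have "integrable (lebesgue_on {0..}) (\<lambda>x. (cmod (f x))\<^sup>2)"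
    using L2_integrable_sq[OF assms(1)]
    by (subst integrable_restrict_space, simp, unfold ind2, subst (asm) integrable_restrict_space) auto
  ultimately show ?thesis by (simp add: L2_def)
qed

lemma integral_lebesgue_on_support:
  fixes h :: "real \<Rightarrow> complex"
  assumes "\<And>x. x > b \<Longrightarrow> h x = 0"
  shows "integral\<^sup>L (lebesgue_on {0..}) h = integral\<^sup>L (lebesgue_on {0..b}) h"
proof -
  have "(\<lambda>x. indicator {0..} x *\<^sub>R h x) = (\<lambda>x. indicator {0..b} x *\<^sub>R h x)"
    using assms by (auto simp: indicator_def fun_eq_iff)
  then show ?thesis by (subst (1 2) integral_restrict_space) auto
qed

lemma LBINT_point: "set_integrable lborel {0..0} f \<Longrightarrow> (LBINT y:{0..0::real}. f y :: complex) = 0"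
  using set_borel_integral_eq_integral(2)[of "{0..0}" f] by simp

text \<open>If \<open>-a w'' - q w\<close> tested against \<open>v\<close> equals \<open>w\<close> tested against \<open>g\<close>, and \<open>W\<close> is a second
  primitive of the \<open>k\<close> that \<open>v''\<close> ought to be, then \<open>v - W\<close> is affine on \<open>[0, R]\<close>: choose for \<open>w''\<close>
  the component of \<open>v - W\<close> orthogonal to the affine functions, so that \<open>w\<close> vanishes to second order at
  both endpoints.\<close>
lemma weak_solution_affine_on_Icc:
  assumes q: "continuous_on {0..} q" and a0: "a \<noteq> 0"
    and vL: "v \<in> L2 {0..}" and gL: "g \<in> L2 {0..}" and vB: "v \<in> borel_measurable borel"
    and adj: "\<And>u f. (u, f) \<in> A0pre {0..} a q \<Longrightarrow> l2inner {0..} f v = l2inner {0..} u g"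
    and W: "AC W W1" "AC W1 k" and gk: "\<And>x. g x = - cnj a * k x - cnj (q x) * v x"
    and R: "0 < R"
  shows "\<exists>\<alpha> \<beta>. AE x in lebesgue_on {0..R}. v x = W x + \<alpha> + \<beta> * of_real x"
proof -
  have cW: "continuous_on {0..R} W" using AC_continuous[OF W(1)] by (rule continuous_on_subset) auto
  define h where "h x = v x - W x" for x
  have hi: "set_integrable lborel {0..R} h"
    unfolding h_def by (rule set_integral_diff(1)[OF L2_borel_locally_integrable[OF vL vB] borel_integrable_atLeastAtMost'[OF cW]])
  have xc: "continuous_on {0..R} (\<lambda>x. complex_of_real x)" by (intro continuous_intros)
  note hxi = set_integrable_mult_continuous[OF hi xc]
  obtain \<alpha> \<beta> where m0: "(LBINT x:{0..R}. h x) = \<alpha> * of_real R + \<beta> * of_real (R\<^sup>2 / 2)"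
    and m1: "(LBINT x:{0..R}. h x * of_real x) = \<alpha> * of_real (R\<^sup>2 / 2) + \<beta> * of_real (R ^ 3 / 3)"
    using affine_moments[OF R] by blast
  define e where "e x = \<alpha> + \<beta> * of_real x" for x
  define p where "p x = h x - e x" for x
  have ec: "continuous_on {0..R} e" unfolding e_def by (intro continuous_intros)
  note ei = borel_integrable_atLeastAtMost'[OF ec]
  have exi: "set_integrable lborel {0..R} (\<lambda>x. e x * of_real x)"
    by (rule set_integrable_mult_continuous[OF ei xc])
  have pi: "set_integrable lborel {0..R} p" unfolding p_def by (rule set_integral_diff(1)[OF hi ei])
  have i1: "set_integrable lborel {0..R} (\<lambda>x. 1 :: complex)"
    by (rule borel_integrable_atLeastAtMost') (intro continuous_intros)
  note ix = borel_integrable_atLeastAtMost'[OF xc] and ixx = set_integrable_mult_continuous[OF borel_integrable_atLeastAtMost'[OF xc] xc]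
  note pow = LBINT_powers[OF less_imp_le[OF R]]
  have e0: "(LBINT x:{0..R}. e x) = \<alpha> * of_real R + \<beta> * of_real (R\<^sup>2 / 2)"
  proof -
    have "(LBINT x:{0..R}. e x) = (LBINT x:{0..R}. \<alpha> * 1 + \<beta> * of_real x)" by (simp add: e_def)
    also have "\<dots> = (LBINT x:{0..R}. \<alpha> * 1) + (LBINT x:{0..R}. \<beta> * of_real x)"
      by (intro set_integral_add set_integrable_mult_right i1 ix)
    also have "\<dots> = \<alpha> * of_real R + \<beta> * of_real (R\<^sup>2 / 2)"
      unfolding set_integral_mult_right pow ..
    finally show ?thesis .
  qed
  have e1: "(LBINT x:{0..R}. e x * of_real x) = \<alpha> * of_real (R\<^sup>2 / 2) + \<beta> * of_real (R ^ 3 / 3)"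
  proof -
    have "(LBINT x:{0..R}. e x * of_real x) = (LBINT x:{0..R}. \<alpha> * of_real x + \<beta> * (of_real x * of_real x))"
      by (simp add: e_def algebra_simps)
    also have "\<dots> = (LBINT x:{0..R}. \<alpha> * of_real x) + (LBINT x:{0..R}. \<beta> * (of_real x * of_real x))"
      by (intro set_integral_add set_integrable_mult_right ix ixx)
    also have "\<dots> = \<alpha> * of_real (R\<^sup>2 / 2) + \<beta> * of_real (R ^ 3 / 3)"
      unfolding set_integral_mult_right pow ..
    finally show ?thesis .
  qed
  have p0: "(LBINT x:{0..R}. p x) = 0"
    unfolding p_def set_integral_diff(2)[OF hi ei] e0 m0 by simp
  have p1: "(LBINT x:{0..R}. p x * of_real x) = 0"
    unfolding p_def left_diff_distrib set_integral_diff(2)[OF hxi exi] e1 m1 by simp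
  \<comment> \<open>Integrating \<open>p\<close> twice from 0 gives zero data at 0. The vanishing
    moments \<open>p0\<close> and \<open>p1\<close> take care of the other end, so \<open>w\<close>
    is an admissible test function.\<close>
  define w2 where "w2 x = indicator {0..R} x *\<^sub>R p x" for x
  have w2i: "set_integrable lborel {0..b} w2" for b
    unfolding set_integrable_def
    by (rule integrable_mult_indicator) (use pi in \<open>auto simp: set_integrable_def w2_def[abs_def]\<close>)
  define w1 where "w1 x = 0 + (LBINT y:{0..x}. w2 y)" for x
  have ac1: "AC w1 w2" unfolding w1_def by (rule AC_primitive[OF w2i])
  have cw1: "continuous_on {0..} w1" using AC_continuous[OF ac1] .
  have w1i: "set_integrable lborel {0..b} w1" for b
    by (rule borel_integrable_atLeastAtMost'[OF continuous_on_subset[OF cw1]]) auto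
  define w where "w x = 0 + (LBINT y:{0..x}. w1 y)" for x
  have ac: "AC w w1" unfolding w_def by (rule AC_primitive[OF w1i])
  have init: "w 0 = 0" "w1 0 = 0" using w_def[of 0] w1_def[of 0] LBINT_point[OF w1i] LBINT_point[OF w2i] by simp_all
  have w1R: "w1 x = 0" if "x \<ge> R" for x
  proof -
    have "(\<lambda>y. indicator {0..x} y *\<^sub>R w2 y) = (\<lambda>y. indicator {0..R} y *\<^sub>R p y)"
      using that by (auto simp: w2_def indicator_def fun_eq_iff)
    then have "(LBINT y:{0..x}. w2 y) = (LBINT y:{0..R}. p y)" by (simp add: set_lebesgue_integral_def)
    then show ?thesis by (simp add: w1_def p0)
  qed
  \<comment> \<open>Integration of the derivative of \<open>x * w1\<close> expresses the integral of
    \<open>w1\<close> over \<open>{0..R}\<close> through \<open>w1 R\<close> and the first moment of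
    \<open>p\<close>, both zero.\<close>
  have w_R: "w R = 0"
  proof -
    have "set_integrable lborel {0..R} (\<lambda>x. of_real x * w2 x)"
      using set_integrable_mult_continuous[OF w2i xc] by (simp add: mult.commute)
    moreover have "(LBINT x:{0..R}. of_real x * w2 x) = (LBINT x:{0..R}. p x * of_real x)"
      by (rule set_lebesgue_integral_cong) (auto simp: w2_def)
    moreover have "of_real R * w1 R - of_real 0 * w1 0 = (LBINT x:{0..R}. 1 * w1 x + of_real x * w2 x)"
      using AC_integral[OF AC_mult[OF AC_of_real ac1], of R] R by simp
    ultimately have "(LBINT x:{0..R}. w1 x) = 0"
      using set_integral_add(2)[OF w1i, of R "\<lambda>x. of_real x * w2 x"] w1R[of R] p1 by simp
    then show ?thesis by (simp add: w_def)
  qed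
  have wR: "w x = 0" if "x \<ge> R" for x
  proof -
    have "w x - w R = (LBINT y:{R..x}. w1 y)" using ac R that by (simp add: ac_loc_with_deriv_def)
    also have "\<dots> = (LBINT y:{R..x}. 0)" by (rule set_lebesgue_integral_cong) (use w1R in auto)
    finally show ?thesis using w_R by simp
  qed
  define F where "F x = - a * w2 x - q x * w x" for x
  have hL: "h \<in> L2 {0..R}" unfolding h_def
    by (intro L2_diff L2_Icc_continuous[OF cW] L2_subset[OF vL]) auto
  have eL: "e \<in> L2 {0..R}" by (rule L2_Icc_continuous[OF ec])
  have pL: "p \<in> L2 {0..R}" unfolding p_def by (rule L2_diff[OF hL eL])
  have cw: "continuous_on {0..} w" using AC_continuous[OF ac] .
  have wL: "w \<in> L2 {0..}"
    by (rule L2_extend_zero[OF L2_Icc_continuous[OF continuous_on_subset[OF cw]], of R]) (use wR in auto)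
  have qwL: "(\<lambda>x. q x * w x) \<in> L2 {0..}"
    by (rule L2_extend_zero[OF L2_Icc_continuous, of R])
       (use wR in \<open>auto intro!: continuous_intros continuous_on_subset[OF cw] continuous_on_subset[OF q]\<close>)
  have w2L: "w2 \<in> L2 {0..}"
  proof (rule L2_extend_zero[of _ R])
    have "w2 \<in> borel_measurable (lebesgue_on {0..})"
      by (rule locally_integrable_measurable_lebesgue_on[OF w2i])
    then have "w2 \<in> borel_measurable (lebesgue_on {0..R})"
      by (rule measurable_lebesgue_on_subset) auto
    moreover have "aeq {0..R} p w2" unfolding aeq_def by (rule AE_I2) (auto simp: w2_def)
    ultimately show "w2 \<in> L2 {0..R}" using L2_cong[OF pL] by blast
  qed (auto simp: w2_def)
  have FL: "F \<in> L2 {0..}" unfolding F_def by (intro L2_diff L2_scale w2L qwL)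
  have "(w, F) \<in> A0pre {0..} a q"
  proof -
    have "\<exists>B. bounded B \<and> (\<forall>x\<in>{0..} - B. w x = 0)"
      by (rule exI[of _ "{0..R}"]) (use wR in auto)
    moreover have "aeq {0..} F (\<lambda>x. - a * w2 x - q x * w x)" by (simp add: F_def[abs_def])
    ultimately show ?thesis unfolding A0pre_def using wL FL ac ac1 init aeq_refl by blast
  qed
  then have eq: "l2inner {0..} F v = l2inner {0..} w g" by (rule adj)
  \<comment> \<open>The tested identity after the terms with \<open>q\<close> have cancelled and the
    factor \<open>- a\<close> is split off; its integral over \<open>{0..R}\<close> is zero.\<close>
  define A where "A x = w2 x * cnj (v x) - w x * cnj (k x)" for x
  have A_eq: "(\<lambda>x. F x * cnj (v x) - w x * cnj (g x)) = (\<lambda>x. - a * A x)"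
    by (auto simp: F_def A_def gk fun_eq_iff algebra_simps)
  have Ai0: "integrable (lebesgue_on {0..}) (\<lambda>x. - a * A x)"
    unfolding A_eq[symmetric] by (intro Bochner_Integration.integrable_diff l2inner_integrable FL vL wL gL)
  have Ai: "integrable (lebesgue_on {0..R}) A"
  proof -
    have "integrable (lebesgue_on {0..R}) (\<lambda>x. - a * A x)"
      by (rule integrable_lebesgue_on_subset[OF Ai0]) auto
    then have "integrable (lebesgue_on {0..R}) (\<lambda>x. (- 1 / a) * (- a * A x))" by (intro integrable_mult_right[where c = "- 1 / a"])
    then show ?thesis using a0 by simp
  qed
  have "integral\<^sup>L (lebesgue_on {0..}) (\<lambda>x. - a * A x) = 0"
    unfolding A_eq[symmetric] using eq unfolding l2inner_def
    by (subst Bochner_Integration.integral_diff) (auto intro!: l2inner_integrable FL vL wL gL)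
  then have "integral\<^sup>L (lebesgue_on {0..}) A = 0" using a0 by simp
  then have AI: "integral\<^sup>L (lebesgue_on {0..R}) A = 0"
    by (subst (asm) integral_lebesgue_on_support[of R]) (use wR in \<open>auto simp: A_def w2_def\<close>)
  note gr = AC_green[OF ac ac1 AC_cnj[OF W(1)] AC_cnj[OF W(2)] less_imp_le[OF R]]
  \<comment> \<open>The same expression with \<open>W\<close> in place of \<open>v\<close>, where
    Green's formula applies because \<open>W\<close> has second derivative \<open>k\<close>. In the
    difference \<open>A - C\<close> the terms with \<open>k\<close> drop out and only
    \<open>w2\<close> against \<open>h = v - W\<close> is left.\<close>
  define C where "C x = w2 x * cnj (W x) - w x * cnj (k x)" for x
  have Cs: "set_integrable lborel {0..R} C" "(LBINT x:{0..R}. C x) = 0"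
    using gr w1R[of R] wR[of R] init by (simp_all add: C_def[abs_def])
  note C = lebesgue_on_set_integrable[OF Cs(1)]
  have "l2inner {0..R} w2 h = integral\<^sup>L (lebesgue_on {0..R}) (\<lambda>x. A x - C x)"
    unfolding l2inner_def by (simp add: A_def C_def h_def algebra_simps)
  also have "\<dots> = 0"
    using Bochner_Integration.integral_diff[OF Ai C(1)] AI C(2) Cs(2) by simp
  finally have "l2inner {0..R} w2 h = 0" .
  moreover have "l2inner {0..R} w2 h = l2inner {0..R} p h"
    unfolding l2inner_def by (rule Bochner_Integration.integral_cong) (auto simp: w2_def)
  ultimately have ph: "l2inner {0..R} p h = 0" by simp
  have pe: "l2inner {0..R} p e = 0"
  proof -
    have i: "set_integrable lborel {0..R} (\<lambda>x. cnj \<alpha> * p x)" "set_integrable lborel {0..R} (\<lambda>x. cnj \<beta> * (p x * of_real x))"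
      using pi set_integrable_mult_continuous[OF pi xc] by (auto intro!: set_integrable_mult_right)
    have pe_eq: "(\<lambda>x. p x * cnj (e x)) = (\<lambda>x. cnj \<alpha> * p x + cnj \<beta> * (p x * of_real x))"
      by (auto simp: e_def fun_eq_iff algebra_simps)
    have "l2inner {0..R} p e = (LBINT x:{0..R}. cnj \<alpha> * p x + cnj \<beta> * (p x * of_real x))"
      unfolding l2inner_def pe_eq by (rule lebesgue_on_set_integrable(2)[OF set_integral_add(1)[OF i]]) simp
    also have "\<dots> = 0"
      unfolding set_integral_add(2)[OF i] set_integral_mult_right p0 p1 by simp
    finally show ?thesis .
  qed
  \<comment> \<open>As \<open>p = h - e\<close>, orthogonality of \<open>p\<close> to both
    \<open>h\<close> and the affine \<open>e\<close> makes it orthogonal to itself.\<close>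
  have "complex_of_real ((l2norm {0..R} p)\<^sup>2) = l2inner {0..R} p (\<lambda>x. h x - e x)"
    unfolding l2inner_self[symmetric] by (simp add: p_def[abs_def])
  also have "\<dots> = 0" using l2inner_diff_right[OF hL eL pL] ph pe by simp
  finally have "l2norm {0..R} p = 0" by simp
  then have "aeq {0..R} p (\<lambda>x. 0)" using l2norm_eq_0_iff[OF pL] by simp
  then have "AE x in lebesgue_on {0..R}. v x = W x + \<alpha> + \<beta> * of_real x"
    unfolding aeq_def by eventually_elim (simp add: p_def h_def e_def algebra_simps)
  then show ?thesis by blast
qed

text \<open>On every \<open>[0, R]\<close> the adjoint element equals a twice integrated density up
  to an affine function. Affine functions that agree on \<open>[0, 1]\<close> almost everywhere
  coincide, so one affine correction serves the whole half-line.\<close>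

lemma adjoint_A0pre_subset_Amax:
  assumes q: "continuous_on {0..} q" and a0: "a \<noteq> 0"
    and vg: "(v, g) \<in> adjoint {0..} (A0pre {0..} a q)"
  shows "(v, g) \<in> Amax {0..} (cnj a) (\<lambda>x. cnj (q x))"
proof -
  have vL: "v \<in> L2 {0..}" and gL: "g \<in> L2 {0..}"
    and adj: "\<And>u f. (u, f) \<in> A0pre {0..} a q \<Longrightarrow> l2inner {0..} f v = l2inner {0..} u g"
    using vg by (auto simp: adjoint_def)
  obtain v' where vB: "v' \<in> borel_measurable borel" and vv: "aeq {0..} v v'"
    using lebesgue_on_borel_representative[OF L2_measurable[OF vL]] by blast
  obtain g0 where g0B: "g0 \<in> borel_measurable borel" and gg0: "aeq {0..} g g0"
    using lebesgue_on_borel_representative[OF L2_measurable[OF gL]] by blast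
  have lm: "f \<in> borel_measurable (lebesgue_on {0..})" if "f \<in> borel_measurable borel" for f :: "real \<Rightarrow> complex"
    using that by (intro measurable_restrict_space1 measurable_completion) simp
  have v'L: "v' \<in> L2 {0..}" by (rule L2_cong[OF vL lm[OF vB] vv])
  have g0L: "g0 \<in> L2 {0..}" by (rule L2_cong[OF gL lm[OF g0B] gg0])
  have cq: "continuous_on {0..} (\<lambda>x. cnj (q x))" using q by (intro continuous_intros)
  \<comment> \<open>The adjoint equation solved for the second derivative that the element should
    have.\<close>
  define k where "k x = (- 1 / cnj a) * (g0 x + v' x * cnj (q x))" for x
  have ki: "set_integrable lborel {0..b} k" for b
  proof -
    have "continuous_on {0..b} (\<lambda>x. cnj (q x))" by (rule continuous_on_subset[OF cq]) auto
    from set_integrable_mult_continuous[OF L2_borel_locally_integrable[OF v'L vB] this]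
    have "set_integrable lborel {0..b} (\<lambda>x. g0 x + v' x * cnj (q x))"
      by (rule set_integral_add(1)[OF L2_borel_locally_integrable[OF g0L g0B]])
    then have "set_integrable lborel {0..b} (\<lambda>x. (- 1 / cnj a) * (g0 x + v' x * cnj (q x)))"
      by (intro set_integrable_mult_right)
    also have "(\<lambda>x. (- 1 / cnj a) * (g0 x + v' x * cnj (q x))) = k" by (simp only: k_def[abs_def])
    finally show ?thesis .
  qed
  define W1 where "W1 x = 0 + (LBINT y:{0..x}. k y)" for x
  have acW1: "AC W1 k" unfolding W1_def by (rule AC_primitive[OF ki])
  have W1i: "set_integrable lborel {0..b} W1" for b
    by (rule borel_integrable_atLeastAtMost'[OF continuous_on_subset[OF AC_continuous[OF acW1]]]) auto
  define W where "W x = 0 + (LBINT y:{0..x}. W1 y)" for x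
  have acW: "AC W W1" unfolding W_def by (rule AC_primitive[OF W1i])
  have gk: "g0 x = - cnj a * k x - cnj (q x) * v' x" for x
    using a0 by (simp add: k_def field_simps)
  have adj': "l2inner {0..} f v' = l2inner {0..} u g0" if "(u, f) \<in> A0pre {0..} a q" for u f
  proof -
    have "u \<in> L2 {0..}" "f \<in> L2 {0..}" using that by (auto simp: A0pre_def)
    then show ?thesis
      using adj[OF that] l2inner_cong_aeq[OF _ _ vL v'L aeq_refl vv, of f] l2inner_cong_aeq[OF _ _ gL g0L aeq_refl gg0, of u]
      by simp
  qed
  note aff = weak_solution_affine_on_Icc[OF q a0 v'L g0L vB adj' acW acW1 gk]
  have "\<forall>n. \<exists>\<alpha> \<beta>. AE x in lebesgue_on {0..real (Suc n)}. v' x = W x + \<alpha> + \<beta> * of_real x"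
    by (intro allI aff) simp_all
  then obtain \<alpha> \<beta> where ab: "\<And>n. AE x in lebesgue_on {0..real (Suc n)}. v' x = W x + \<alpha> n + \<beta> n * of_real x"
    by metis
  have same: "\<alpha> n = \<alpha> 0 \<and> \<beta> n = \<beta> 0" for n
  proof -
    have "AE x in lebesgue_on {0..1}. v' x = W x + \<alpha> n + \<beta> n * of_real x"
    proof -
      have "AE x in lebesgue. x \<in> {0..real (Suc n)} \<longrightarrow> v' x = W x + \<alpha> n + \<beta> n * of_real x"
        using ab[of n] by (subst (asm) AE_restrict_space_iff) auto
      then have "AE x in lebesgue. x \<in> {0..1} \<longrightarrow> v' x = W x + \<alpha> n + \<beta> n * of_real x"
        by eventually_elim auto
      then show ?thesis by (subst AE_restrict_space_iff) auto
    qed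
    moreover have "AE x in lebesgue_on {0..1}. v' x = W x + \<alpha> 0 + \<beta> 0 * of_real x" using ab[of 0, unfolded One_nat_def[symmetric] of_nat_1] .
    ultimately have ae: "AE x in lebesgue_on {0..1}. \<alpha> n + \<beta> n * of_real x = \<alpha> 0 + \<beta> 0 * of_real x"
      by eventually_elim (simp add: add.assoc)
    \<comment> \<open>Two disjoint open intervals supply two different points, enough to determine
      both coefficients of an affine function.\<close>
    have sub: "{0<..<1/2} \<subseteq> {0..1::real}" "{1/2<..<1} \<subseteq> {0..1::real}" by auto
    obtain x where x: "x \<in> {0<..<1/2}" "\<alpha> n + \<beta> n * of_real x = \<alpha> 0 + \<beta> 0 * of_real x"
      using AE_exists_in_interval[OF ae sub(1)] by force
    obtain y where y: "y \<in> {1/2<..<1}" "\<alpha> n + \<beta> n * of_real y = \<alpha> 0 + \<beta> 0 * of_real y"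
      using AE_exists_in_interval[OF ae sub(2)] by force
    have "(\<beta> n - \<beta> 0) * of_real (y - x) = (\<alpha> n + \<beta> n * of_real y - (\<alpha> 0 + \<beta> 0 * of_real y)) - (\<alpha> n + \<beta> n * of_real x - (\<alpha> 0 + \<beta> 0 * of_real x))"
      by (simp add: algebra_simps)
    also have "\<dots> = 0" unfolding x(2) y(2) by simp
    finally have "(\<beta> n - \<beta> 0) * of_real (y - x) = 0" .
    moreover have "complex_of_real (y - x) \<noteq> 0" using x(1) y(1) by (simp only: of_real_eq_0_iff) auto
    ultimately have "\<beta> n = \<beta> 0" by (simp only: mult_eq_0_iff) simp
    then show ?thesis using x(2) by simp
  qed
  define y where "y x = W x + (\<alpha> 0 + \<beta> 0 * of_real x)" for x
  have vy: "aeq {0..} v' y"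
  proof -
    have "AE x in lebesgue. x \<in> {0..real (Suc n)} \<longrightarrow> v' x = y x" for n
    proof -
      have "AE x in lebesgue_on {0..real (Suc n)}. v' x = y x"
        using ab[of n] same[of n] by (simp add: y_def add.assoc)
      then show ?thesis by (subst (asm) AE_restrict_space_iff) auto
    qed
    then have "AE x in lebesgue. \<forall>n. x \<in> {0..real (Suc n)} \<longrightarrow> v' x = y x"
      by (simp only: AE_all_countable) blast
    then have "AE x in lebesgue. x \<in> {0..} \<longrightarrow> v' x = y x"
    proof eventually_elim
      case (elim x)
      have "x \<le> real (Suc (nat \<lceil>x\<rceil>))" by linarith
      then show ?case using elim by auto
    qed
    then show ?thesis unfolding aeq_def by (subst AE_restrict_space_iff) auto
  qed
  have "AC (\<lambda>x. \<alpha> 0 + \<beta> 0 * of_real x) (\<lambda>x. 0 + \<beta> 0 * 1)"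
    by (intro AC_add AC_scale AC_of_real AC_C1) auto
  from AC_add[OF acW this] have "AC y (\<lambda>x. W1 x + \<beta> 0)" unfolding y_def by simp
  moreover have "AC (\<lambda>x. W1 x + \<beta> 0) (\<lambda>x. k x + 0)"
    by (intro AC_add acW1 AC_C1) auto
  then have "AC (\<lambda>x. W1 x + \<beta> 0) k" by simp
  moreover have "aeq {0..} v y" by (rule aeq_trans[OF vv vy])
  moreover have "aeq {0..} g (\<lambda>x. - cnj a * k x - cnj (q x) * y x)"
    using gg0 vy unfolding aeq_def by eventually_elim (simp add: gk)
  ultimately show ?thesis unfolding Amax_def using vL gL by blast
qed

subsection \<open>Adjoints and closures\<close>

lemma opclosureI:
  assumes "u \<in> L2 S" "f \<in> L2 S" "\<And>n. (U n, F n) \<in> T"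
    "(\<lambda>n. l2norm S (\<lambda>x. U n x - u x)) \<longlonglongrightarrow> 0" "(\<lambda>n. l2norm S (\<lambda>x. F n x - f x)) \<longlonglongrightarrow> 0"
  shows "(u, f) \<in> opclosure S T"
  using assms unfolding opclosure_def by blast

lemma A0preI:
  assumes "u \<in> L2 S" "f \<in> L2 S" "ac_loc_with_deriv S w w1" "ac_loc_with_deriv S w1 w2" "w 0 = 0" "w1 0 = 0"
    "bounded B" "\<And>x. x \<in> S - B \<Longrightarrow> w x = 0" "aeq S u w" "aeq S f (\<lambda>x. - a * w2 x - q x * w x)"
  shows "(u, f) \<in> A0pre S a q"
  using assms unfolding A0pre_def by blast

text \<open>The identity tested by the adjoint is continuous in the graph norm. Adjoints of minimal
  operators can therefore be computed on compactly supported elements.\<close>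

lemma adjoint_opclosure:
  assumes T: "T \<subseteq> L2 S \<times> L2 S"
  shows "adjoint S (opclosure S T) = adjoint S T"
proof (rule set_eqI, clarify)
  fix v g
  show "(v, g) \<in> adjoint S (opclosure S T) \<longleftrightarrow> (v, g) \<in> adjoint S T"
  proof
    have sub: "T \<subseteq> opclosure S T"
    proof clarify
      fix u f assume uf: "(u, f) \<in> T"
      have "(\<lambda>n::nat. l2norm S (\<lambda>x. h x - h x)) \<longlonglongrightarrow> 0" for h by (simp add: l2norm_def)
      then show "(u, f) \<in> opclosure S T"
        using uf T by (intro opclosureI[of _ _ _ "\<lambda>n. u" "\<lambda>n. f"]) auto
    qed
    assume "(v, g) \<in> adjoint S (opclosure S T)"
    then show "(v, g) \<in> adjoint S T" using sub unfolding adjoint_def by blast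
  next
    assume vg: "(v, g) \<in> adjoint S T"
    then have vL: "v \<in> L2 S" and gL: "g \<in> L2 S"
      and eq: "\<And>u f. (u, f) \<in> T \<Longrightarrow> l2inner S f v = l2inner S u g" by (auto simp: adjoint_def)
    have "l2inner S f v = l2inner S u g" if uf: "(u, f) \<in> opclosure S T" for u f
    proof -
      obtain U F where UF: "\<And>n. (U n, F n) \<in> T" and lim: "(\<lambda>n. l2norm S (\<lambda>x. U n x - u x)) \<longlonglongrightarrow> 0"
          "(\<lambda>n. l2norm S (\<lambda>x. F n x - f x)) \<longlonglongrightarrow> 0" and L: "u \<in> L2 S" "f \<in> L2 S"
        using uf unfolding opclosure_def by blast
      have UL: "U n \<in> L2 S" and FL: "F n \<in> L2 S" for n using UF[of n] T by auto
      have z: "(\<lambda>n::nat. l2norm S (\<lambda>x. h x - h x)) \<longlonglongrightarrow> 0" for h by (simp add: l2norm_def)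
      have l1: "(\<lambda>n. l2inner S (F n) v) \<longlonglongrightarrow> l2inner S f v"
        by (rule l2inner_tendsto[OF FL vL L(2) vL lim(2) z])
      have l2: "(\<lambda>n. l2inner S (U n) g) \<longlonglongrightarrow> l2inner S u g"
        by (rule l2inner_tendsto[OF UL gL L(1) gL lim(1) z])
      from LIMSEQ_unique[OF l1[unfolded eq[OF UF]] l2] show ?thesis .
    qed
    then show "(v, g) \<in> adjoint S (opclosure S T)" using vL gL by (auto simp: adjoint_def)
  qed
qed

text \<open>Adjoints are linear, saturated under almost everywhere equality and closed. Minimal and
  maximal operators inherit these properties later by being recognised as adjoints, which spares
  working with their definitions.\<close>

lemma adjoint_lin:
  assumes T: "T \<subseteq> L2 S \<times> L2 S" and "(v, g) \<in> adjoint S T" "(v', g') \<in> adjoint S T"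
  shows "(\<lambda>x. v x + c * v' x, \<lambda>x. g x + c * g' x) \<in> adjoint S T"
proof -
  have L: "v \<in> L2 S" "g \<in> L2 S" "v' \<in> L2 S" "g' \<in> L2 S" using assms by (auto simp: adjoint_def)
  have "l2inner S f (\<lambda>x. v x + c * v' x) = l2inner S u (\<lambda>x. g x + c * g' x)" if "(u, f) \<in> T" for u f
  proof -
    have uf: "u \<in> L2 S" "f \<in> L2 S" using that T by auto
    have "l2inner S f v = l2inner S u g" "l2inner S f v' = l2inner S u g'" using that assms by (auto simp: adjoint_def)
    then show ?thesis
      using l2inner_add_right[OF L(1) L2_scale[OF L(3), of c] uf(2)] l2inner_add_right[OF L(2) L2_scale[OF L(4), of c] uf(1)]
      by (simp add: l2inner_scale_right)
  qed
  then show ?thesis using L by (auto simp: adjoint_def intro!: L2_add L2_scale)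
qed

lemma adjoint_aeq:
  assumes T: "T \<subseteq> L2 S \<times> L2 S" and vg: "(v, g) \<in> adjoint S T"
    and L': "v' \<in> L2 S" "g' \<in> L2 S" and "aeq S v v'" "aeq S g g'"
  shows "(v', g') \<in> adjoint S T"
proof -
  have L: "v \<in> L2 S" "g \<in> L2 S" using vg by (auto simp: adjoint_def)
  have "l2inner S f v' = l2inner S u g'" if "(u, f) \<in> T" for u f
  proof -
    have uf: "u \<in> L2 S" "f \<in> L2 S" using that T by auto
    have "l2inner S f v = l2inner S u g" using that vg by (auto simp: adjoint_def)
    then show ?thesis
      using l2inner_cong_aeq[OF uf(2) uf(2) L(1) L'(1) aeq_refl assms(5)]
        l2inner_cong_aeq[OF uf(1) uf(1) L(2) L'(2) aeq_refl assms(6)] by simp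
  qed
  then show ?thesis using L' by (auto simp: adjoint_def)
qed

lemma adjoint_closed:
  assumes T: "T \<subseteq> L2 S \<times> L2 S" and UF: "\<And>n. (U n, F n) \<in> adjoint S T" and L: "u \<in> L2 S" "f \<in> L2 S"
    and lim: "(\<lambda>n. l2norm S (\<lambda>x. U n x - u x)) \<longlonglongrightarrow> 0" "(\<lambda>n. l2norm S (\<lambda>x. F n x - f x)) \<longlonglongrightarrow> 0"
  shows "(u, f) \<in> adjoint S T"
proof -
  have z: "(\<lambda>n::nat. l2norm S (\<lambda>x. h x - h x)) \<longlonglongrightarrow> 0" for h by (simp add: l2norm_def)
  have UL: "U n \<in> L2 S" and FL: "F n \<in> L2 S" for n using UF[of n] by (auto simp: adjoint_def)
  have "l2inner S g u = l2inner S v f" if vg: "(v, g) \<in> T" for v g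
  proof -
    have vL: "v \<in> L2 S" "g \<in> L2 S" using vg T by auto
    have l1: "(\<lambda>n. l2inner S g (U n)) \<longlonglongrightarrow> l2inner S g u"
      by (rule l2inner_tendsto[OF vL(2) UL vL(2) L(1) z lim(1)])
    have l2: "(\<lambda>n. l2inner S v (F n)) \<longlonglongrightarrow> l2inner S v f"
      by (rule l2inner_tendsto[OF vL(1) FL vL(1) L(2) z lim(2)])
    have eq: "l2inner S g (U n) = l2inner S v (F n)" for n
      using UF[of n] vg by (auto simp: adjoint_def)
    from LIMSEQ_unique[OF l1[unfolded eq] l2] show ?thesis .
  qed
  then show ?thesis using L by (auto simp: adjoint_def)
qed

section \<open>Regular representatives and compactly supported elements\<close>

lemma Amax_L2: "Amax S a q \<subseteq> L2 S \<times> L2 S"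
  by (auto simp: Amax_def)

lemma A0pre_L2: "A0pre S a q \<subseteq> L2 S \<times> L2 S"
  by (auto simp: A0pre_def)

lemma A0_L2: "A0 S a q \<subseteq> L2 S \<times> L2 S"
  by (auto simp: A0_def opclosure_def)

lemma A0pre_subset_Amax: "A0pre S a q \<subseteq> Amax S a q"
  unfolding A0pre_def Amax_def by blast

lemma A0pre_rep:
  assumes q: "continuous_on {0..} q" and uf: "(u, f) \<in> A0pre {0..} a q"
  obtains w w1 w2 b where "max_rep a q w w1 w2" "w 0 = 0" "w1 0 = 0" "b > 0" "\<And>x. x \<ge> b \<Longrightarrow> w x = 0 \<and> w1 x = 0"
    "aeq {0..} u w" "aeq {0..} f (\<lambda>x. - a * w2 x - q x * w x)"
proof -
  obtain w w1 w2 B where *: "u \<in> L2 {0..}" "f \<in> L2 {0..}" "AC w w1" "AC w1 w2" "w 0 = 0" "w1 0 = 0"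
    "bounded B" "\<forall>x\<in>{0..} - B. w x = 0" "aeq {0..} u w" "aeq {0..} f (\<lambda>x. - a * w2 x - q x * w x)"
    using uf unfolding A0pre_def by blast
  have "max_rep a q w w1 w2" unfolding max_rep_def
    using * L2_cong[OF *(1) _ *(9)] L2_cong[OF *(2) tau_measurable[OF q *(3,4)] *(10)] AC_measurable[OF *(3)] by simp
  moreover obtain b where "b > 0" "\<forall>x\<ge>b. w x = 0 \<and> w1 x = 0"
    using bounded_support_eventually_0[OF *(3) AC_continuous[OF *(4)] *(7,8)] by blast
  ultimately show ?thesis using that * by blast
qed

lemma max_rep_lin:
  assumes "max_rep a q w w1 w2" "max_rep a q y y1 y2"
  shows "max_rep a q (\<lambda>x. w x + c * y x) (\<lambda>x. w1 x + c * y1 x) (\<lambda>x. w2 x + c * y2 x)"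
proof -
  have "(\<lambda>x. - a * (w2 x + c * y2 x) - q x * (w x + c * y x))
      = (\<lambda>x. (- a * w2 x - q x * w x) + c * (- a * y2 x - q x * y x))"
    by (auto simp: algebra_simps)
  then show ?thesis using assms unfolding max_rep_def by (auto intro!: AC_add AC_scale L2_add L2_scale)
qed

lemma max_rep_cnj:
  assumes "max_rep a q w w1 w2"
  shows "max_rep (cnj a) (\<lambda>x. cnj (q x)) (\<lambda>x. cnj (w x)) (\<lambda>x. cnj (w1 x)) (\<lambda>x. cnj (w2 x))"
  using assms L2_cnj[of "\<lambda>x. - a * w2 x - q x * w x" "{0..}"] unfolding max_rep_def
  by (auto intro!: AC_cnj L2_cnj)

lemma max_rep_compact_support:
  assumes q: "continuous_on {0..} q" and "AC w w1" "AC w1 w2" "continuous_on {0..} w2"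
    and supp: "\<And>x. x \<ge> b \<Longrightarrow> w x = 0 \<and> w2 x = 0"
  shows "max_rep a q w w1 w2"
proof -
  have cw: "continuous_on {0..} w" using AC_continuous[OF assms(2)] .
  have "w \<in> L2 {0..}"
    by (rule L2_extend_zero[OF L2_Icc_continuous, of b]) (use supp in \<open>auto intro!: continuous_on_subset[OF cw]\<close>)
  moreover have "(\<lambda>x. - a * w2 x - q x * w x) \<in> L2 {0..}"
    by (rule L2_extend_zero[OF L2_Icc_continuous, of b])
       (use supp in \<open>auto intro!: continuous_intros continuous_on_subset[OF cw] continuous_on_subset[OF q] continuous_on_subset[OF assms(4)]\<close>)
  ultimately show ?thesis using assms by (simp add: max_rep_def)
qed

text \<open>Two functions that lie in the maximal domain for every continuous potential and whose
  data \<open>(1, -3)\<close> and \<open>(0, 1)\<close> at 0 are linearly independent. They detect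
  boundary values through Green's formula and form a basis of the quotient of the two
  domains.\<close>

definition bump :: "nat \<Rightarrow> real \<Rightarrow> complex" where
  "bump i x = (if i = 0 then cutoff 1 x else of_real x * cutoff 1 x)"

text \<open>The explicit factor \<open>1\<close> here, like the factor \<open>0\<close> in
  \<open>bump2\<close>, keeps the shape in which the product rule \<open>AC_mult\<close> delivers
  the derivative.\<close>

definition bump1 :: "nat \<Rightarrow> real \<Rightarrow> complex" where
  "bump1 i x = (if i = 0 then cutoff1 1 x else 1 * cutoff 1 x + of_real x * cutoff1 1 x)"

definition bump2 :: "nat \<Rightarrow> real \<Rightarrow> complex" where
  "bump2 i x = (if i = 0 then cutoff2 1 x
   else (0 * cutoff 1 x + 1 * cutoff1 1 x) + (1 * cutoff1 1 x + of_real x * cutoff2 1 x))"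

lemma AC_bump: "AC (bump i) (bump1 i)" "AC (bump1 i) (bump2 i)"
proof -
  note c = AC_cutoff[OF zero_less_one]
  have one: "AC (\<lambda>x. 1) (\<lambda>x. 0)" by (rule AC_C1) auto
  have z: "AC (bump 0) (bump1 0)" "AC (bump1 0) (bump2 0)"
    unfolding bump_def bump1_def bump2_def using c by (simp_all add: fun_eq_iff)
  have s: "AC (bump i) (bump1 i)" "AC (bump1 i) (bump2 i)" if "i \<noteq> 0"
    unfolding bump_def bump1_def bump2_def if_not_P[OF that]
    by (intro AC_add AC_mult c one AC_of_real)+
  show "AC (bump i) (bump1 i)" "AC (bump1 i) (bump2 i)" using z s by (cases "i = 0"; simp)+
qed

lemma bump_support: "x \<ge> 1 \<Longrightarrow> bump i x = 0 \<and> bump1 i x = 0 \<and> bump2 i x = 0"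
  using cutoff_support[of 1 x] by (auto simp: bump_def bump1_def bump2_def cutoff2_def)

lemma bump_init: "bump 0 0 = 1" "bump1 0 0 = - 3" "bump (Suc 0) 0 = 0" "bump1 (Suc 0) 0 = 1"
  by (simp_all add: bump_def bump1_def cutoff_def cutoff1_def)

lemma max_rep_bump:
  assumes "continuous_on {0..} q"
  shows "max_rep a q (bump i) (bump1 i) (bump2 i)"
proof (rule max_rep_compact_support[OF assms AC_bump, where b = 1])
  have c2: "continuous_on {0..} (cutoff2 1)" unfolding cutoff2_def by (intro continuous_intros) auto
  show "continuous_on {0..} (bump2 i)"
    unfolding bump2_def using c2 AC_continuous[OF AC_cutoff(1)[OF zero_less_one]] AC_continuous[OF AC_cutoff(2)[OF zero_less_one]]
    by (cases "i = 0") (auto intro!: continuous_intros)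
qed (use bump_support in auto)

lemma bump_in_Amax:
  assumes "continuous_on {0..} q"
  shows "(bump i, \<lambda>x. - a * bump2 i x - q x * bump i x) \<in> Amax {0..} a q"
  using max_rep_bump[OF assms, of a i] unfolding Amax_iff[OF assms] by (auto simp: max_rep_def intro!: exI)

text \<open>In Green's formula the end at infinity vanishes by compact support and the end at 0 by
  the zero data of the preminimal element.\<close>

lemma Amax_subset_adjoint_A0pre:
  assumes q: "continuous_on {0..} q"
  shows "Amax {0..} (cnj a) (\<lambda>x. cnj (q x)) \<subseteq> adjoint {0..} (A0pre {0..} a q)"
proof clarify
  have q': "continuous_on {0..} (\<lambda>x. cnj (q x))" using q by (intro continuous_intros)
  fix v g assume "(v, g) \<in> Amax {0..} (cnj a) (\<lambda>x. cnj (q x))"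
  then obtain y y1 y2 where L: "v \<in> L2 {0..}" "g \<in> L2 {0..}" and y: "max_rep (cnj a) (\<lambda>x. cnj (q x)) y y1 y2"
    and ae: "aeq {0..} v y" "aeq {0..} g (\<lambda>x. - cnj a * y2 x - cnj (q x) * y x)"
    unfolding Amax_iff[OF q'] by blast
  have "l2inner {0..} f v = l2inner {0..} u g" if uf: "(u, f) \<in> A0pre {0..} a q" for u f
  proof -
    obtain w w1 w2 b where w: "max_rep a q w w1 w2" "w 0 = 0" "w1 0 = 0" "b > 0" "\<And>x. x \<ge> b \<Longrightarrow> w x = 0 \<and> w1 x = 0"
      "aeq {0..} u w" "aeq {0..} f (\<lambda>x. - a * w2 x - q x * w x)"
      using A0pre_rep[OF q uf] by blast
    have ufL: "u \<in> L2 {0..}" "f \<in> L2 {0..}" using uf by (auto simp: A0pre_def)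
    have "l2inner {0..} f v = l2inner {0..} (\<lambda>x. - a * w2 x - q x * w x) y"
      using ufL L w y ae unfolding max_rep_def by (intro l2inner_cong_aeq) auto
    moreover have "l2inner {0..} u g = l2inner {0..} w (\<lambda>x. - cnj a * y2 x - cnj (q x) * y x)"
      using ufL L w y ae unfolding max_rep_def by (intro l2inner_cong_aeq) auto
    ultimately show ?thesis using green_compact_support[OF w(1) y w(4,5)] w(2,3) by simp
  qed
  then show "(v, g) \<in> adjoint {0..} (A0pre {0..} a q)" using L by (auto simp: adjoint_def)
qed

lemma adjoint_A0:
  assumes q: "continuous_on {0..} q" and a0: "a \<noteq> 0"
  shows "adjoint {0..} (A0 {0..} a q) = Amax {0..} (cnj a) (\<lambda>x. cnj (q x))"
  unfolding A0_def adjoint_opclosure[OF A0pre_L2]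
  using Amax_subset_adjoint_A0pre[OF q, of a] adjoint_A0pre_subset_Amax[OF q a0] by auto

lemma conjop_A0:
  "conjop (A0 {0..} a q) \<subseteq> A0 {0..} (cnj a) (\<lambda>x. cnj (q x))"
proof -
  have pre: "(\<lambda>x. cnj (u x), \<lambda>x. cnj (f x)) \<in> A0pre {0..} (cnj a) (\<lambda>x. cnj (q x))"
    if uf: "(u, f) \<in> A0pre {0..} a q" for u f
  proof -
    obtain w w1 w2 B where *: "u \<in> L2 {0..}" "f \<in> L2 {0..}" "AC w w1" "AC w1 w2" "w 0 = 0" "w1 0 = 0"
      "bounded B" "\<forall>x\<in>{0..} - B. w x = 0" "aeq {0..} u w" "aeq {0..} f (\<lambda>x. - a * w2 x - q x * w x)"
      using uf unfolding A0pre_def by blast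
    have "aeq {0..} (\<lambda>x. cnj (u x)) (\<lambda>x. cnj (w x))"
      using *(9) unfolding aeq_def by eventually_elim simp
    moreover have "aeq {0..} (\<lambda>x. cnj (f x)) (\<lambda>x. - cnj a * cnj (w2 x) - cnj (q x) * cnj (w x))"
      using *(10) unfolding aeq_def by eventually_elim simp
    ultimately show ?thesis
      using * by (intro A0preI[OF _ _ AC_cnj[OF *(3)] AC_cnj[OF *(4)] _ _ *(7)] L2_cnj) auto
  qed
  have cd: "l2norm {0..} (\<lambda>x. cnj (f x) - cnj (g x)) = l2norm {0..} (\<lambda>x. f x - g x)" for f g
    using l2norm_cnj[of "{0..}" "\<lambda>x. f x - g x"] by simp
  show ?thesis
  proof (clarsimp simp: conjop_def)
    fix u f assume "(u, f) \<in> A0 {0..} a q"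
    then obtain U F where L: "u \<in> L2 {0..}" "f \<in> L2 {0..}" and UF: "\<And>n. (U n, F n) \<in> A0pre {0..} a q"
      and lim: "(\<lambda>n. l2norm {0..} (\<lambda>x. U n x - u x)) \<longlonglongrightarrow> 0" "(\<lambda>n. l2norm {0..} (\<lambda>x. F n x - f x)) \<longlonglongrightarrow> 0"
      unfolding A0_def opclosure_def by blast
    show "(\<lambda>x. cnj (u x), \<lambda>x. cnj (f x)) \<in> A0 {0..} (cnj a) (\<lambda>x. cnj (q x))"
      unfolding A0_def
      by (rule opclosureI[OF L2_cnj[OF L(1)] L2_cnj[OF L(2)], where U = "\<lambda>n x. cnj (U n x)" and F = "\<lambda>n x. cnj (F n x)"])
         (simp_all add: pre[OF UF] cd lim)
  qed
qed

subsection \<open>The numerical range and the minimal domain\<close>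

text \<open>After integration by parts the form is the integral of \<open>c * a\<close> times the
  square of \<open>|w'|\<close> minus \<open>c * q\<close> times the square of \<open>|w|\<close>,
  both with nonnegative real part. The inequality passes to the closure because the inner product is
  continuous.\<close>

lemma A0_form_nonneg:
  assumes q: "continuous_on {0..} q" and ca: "0 \<le> Re (c * a)" and cq: "\<And>x. 0 \<le> x \<Longrightarrow> Re (c * q x) \<le> 0"
    and uf: "(u, f) \<in> A0 {0..} a q"
  shows "0 \<le> Re (c * l2inner {0..} f u)"
proof -
  have pre: "0 \<le> Re (c * l2inner {0..} f u)" if uf: "(u, f) \<in> A0pre {0..} a q" for u f
  proof -
    obtain w w1 w2 b where w: "max_rep a q w w1 w2" "w 0 = 0" "w1 0 = 0" "b > 0" "\<And>x. x \<ge> b \<Longrightarrow> w x = 0 \<and> w1 x = 0"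
      "aeq {0..} u w" "aeq {0..} f (\<lambda>x. - a * w2 x - q x * w x)"
      using A0pre_rep[OF q uf] by blast
    define F where "F x = - a * w2 x - q x * w x" for x
    have acw: "AC w w1" and acw1: "AC w1 w2" and wL: "w \<in> L2 {0..}" and FL: "F \<in> L2 {0..}"
      using w(1) by (auto simp: max_rep_def F_def[abs_def])
    have "u \<in> L2 {0..}" "f \<in> L2 {0..}" using uf by (auto simp: A0pre_def)
    then have eq: "l2inner {0..} f u = l2inner {0..} F w"
      using wL FL w unfolding F_def by (intro l2inner_cong_aeq) auto
    have int: "integrable (lebesgue_on {0..}) (\<lambda>x. F x * cnj (w x))" by (rule l2inner_integrable[OF FL wL])
    have "0 \<le> Re (c * integral\<^sup>L (lebesgue_on {0..real n}) (\<lambda>x. F x * cnj (w x)))" if n: "n \<ge> nat \<lceil>b\<rceil>" for n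
    proof -
      have nb: "real n \<ge> b" using n by linarith
      define E where "E x = w2 x * cnj (w x) + w1 x * cnj (w1 x)" for x
      have acE: "AC (\<lambda>x. w1 x * cnj (w x)) E" unfolding E_def by (intro AC_mult AC_cnj acw acw1)
      have Ei: "set_integrable lborel {0..real n} E" by (rule AC_set_integrable[OF acE]) auto
      have E0: "(LBINT x:{0..real n}. E x) = 0"
        using AC_integral[OF acE, of "real n"] w(2,3) w(5)[OF nb] by simp
      note E' = lebesgue_on_set_integrable[OF Ei]
      have Fi: "integrable (lebesgue_on {0..real n}) (\<lambda>x. F x * cnj (w x))"
        by (rule integrable_lebesgue_on_subset[OF int]) auto
      have Ei': "integrable (lebesgue_on {0..real n}) E" using E'(1) by simp
      have EI': "integral\<^sup>L (lebesgue_on {0..real n}) E = 0" using E'(2) E0 by simp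
      \<comment> \<open>Adding \<open>a * E\<close>, the derivative of
        \<open>a * (w1 * cnj w)\<close>, leaves the integral unchanged as the boundary terms vanish.
        It replaces \<open>- a * w2 * cnj w\<close> by \<open>a\<close> times the square of
        \<open>|w1|\<close>, so positivity holds pointwise.\<close>
      have i: "integrable (lebesgue_on {0..real n}) (\<lambda>x. c * (F x * cnj (w x) + a * E x))"
        by (intro integrable_mult_right Bochner_Integration.integrable_add Fi Ei')
      have "integral\<^sup>L (lebesgue_on {0..real n}) (\<lambda>x. c * (F x * cnj (w x) + a * E x))
          = c * (integral\<^sup>L (lebesgue_on {0..real n}) (\<lambda>x. F x * cnj (w x)) + a * integral\<^sup>L (lebesgue_on {0..real n}) E)"
        using Fi Ei' by simp
      then have cI: "c * integral\<^sup>L (lebesgue_on {0..real n}) (\<lambda>x. F x * cnj (w x))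
          = integral\<^sup>L (lebesgue_on {0..real n}) (\<lambda>x. c * (F x * cnj (w x) + a * E x))"
        by (simp only: EI' mult_zero_right add_0_right)
      have ReI: "Re (c * integral\<^sup>L (lebesgue_on {0..real n}) (\<lambda>x. F x * cnj (w x)))
          = integral\<^sup>L (lebesgue_on {0..real n}) (\<lambda>x. Re (c * (F x * cnj (w x) + a * E x)))"
        unfolding cI integral_Re[OF i] ..
      have nonneg: "0 \<le> Re (c * (F x * cnj (w x) + a * E x))" if "x \<in> {0..real n}" for x
      proof -
        have "c * (F x * cnj (w x) + a * E x) = of_real ((cmod (w1 x))\<^sup>2) * (c * a) + of_real ((cmod (w x))\<^sup>2) * (- (c * q x))"
          unfolding complex_norm_square F_def E_def by (simp add: algebra_simps)
        then have "Re (c * (F x * cnj (w x) + a * E x)) = (cmod (w1 x))\<^sup>2 * Re (c * a) + (cmod (w x))\<^sup>2 * (- Re (c * q x))"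
          by (simp only: plus_complex.simps Re_complex_of_real Im_complex_of_real times_complex.simps(1)
              mult_zero_left uminus_complex.simps diff_0_right)
        then show ?thesis using ca cq[of x] that by (auto intro!: add_nonneg_nonneg mult_nonneg_nonneg)
      qed
      show ?thesis unfolding ReI by (rule integral_nonneg_AE[OF AE_I2]) (rule nonneg, simp)
    qed
    then have "0 \<le> Re (c * integral\<^sup>L (lebesgue_on {0..}) (\<lambda>x. F x * cnj (w x)))"
      using integral_lebesgue_on_LIMSEQ[OF int]
      by (intro LIMSEQ_le_const[of "\<lambda>n. Re (c * integral\<^sup>L (lebesgue_on {0..real n}) (\<lambda>x. F x * cnj (w x)))"]
          tendsto_Re tendsto_mult tendsto_const exI[of _ "nat \<lceil>b\<rceil>"]) auto
    then show ?thesis unfolding eq unfolding l2inner_def .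
  qed
  obtain U F where L: "u \<in> L2 {0..}" "f \<in> L2 {0..}" and UF: "\<And>n. (U n, F n) \<in> A0pre {0..} a q"
    and lim: "(\<lambda>n. l2norm {0..} (\<lambda>x. U n x - u x)) \<longlonglongrightarrow> 0" "(\<lambda>n. l2norm {0..} (\<lambda>x. F n x - f x)) \<longlonglongrightarrow> 0"
    using uf unfolding A0_def opclosure_def by blast
  have UL: "U n \<in> L2 {0..}" and FL: "F n \<in> L2 {0..}" for n using UF[of n] A0pre_L2 by auto
  have "(\<lambda>n. Re (c * l2inner {0..} (F n) (U n))) \<longlonglongrightarrow> Re (c * l2inner {0..} f u)"
    by (intro tendsto_Re tendsto_mult tendsto_const l2inner_tendsto FL UL L lim)
  then show ?thesis by (rule LIMSEQ_le_const) (use pre[OF UF] in auto)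
qed

text \<open>The numerical range lies in the half-plane where \<open>Re (c * \<zeta>)\<close> is
  nonnegative, and the constant of regularity is the distance of \<open>z\<close> from it, by
  Cauchy-Schwarz. Weak inequalities on \<open>c\<close> admit half-planes whose boundary contains an
  edge of the sector, as the full complement of \<open>Qset\<close> requires.\<close>

lemma regtype_A0:
  assumes q: "continuous_on {0..} q" and ca: "0 \<le> Re (c * a)" and cq: "\<And>x. 0 \<le> x \<Longrightarrow> Re (c * q x) \<le> 0"
    and z: "Re (c * z) < 0"
  shows "z \<in> regtype {0..} (A0 {0..} a q)"
proof -
  have c: "cmod c > 0" using z by (cases "c = 0") auto
  define k where "k = - Re (c * z) / cmod c"
  have k: "k > 0" using c z by (simp add: k_def)
  have "k * l2norm {0..} u \<le> l2norm {0..} (\<lambda>x. f x - z * u x)" if uf: "(u, f) \<in> A0 {0..} a q" for u f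
  proof (cases "l2norm {0..} u = 0")
    case False
    then have un: "l2norm {0..} u > 0" using l2norm_nonneg[of "{0..}" u] by linarith
    have L: "u \<in> L2 {0..}" "f \<in> L2 {0..}" using uf A0_L2 by auto
    have e: "l2inner {0..} (\<lambda>x. f x - z * u x) u = l2inner {0..} f u - z * of_real ((l2norm {0..} u)\<^sup>2)"
      using l2inner_diff_left[OF L(2) L2_scale[OF L(1)] L(1)] by (simp only: l2inner_scale_left l2inner_self)
    have "Re (c * (A - z * of_real t)) = Re (c * A) - Re (c * z) * t" for A t
      by (simp add: algebra_simps)
    then have "Re (c * l2inner {0..} (\<lambda>x. f x - z * u x) u) = Re (c * l2inner {0..} f u) - Re (c * z) * (l2norm {0..} u)\<^sup>2"
      unfolding e .
    moreover have "Re (c * l2inner {0..} (\<lambda>x. f x - z * u x) u) \<le> cmod c * (l2norm {0..} (\<lambda>x. f x - z * u x) * l2norm {0..} u)"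
      by (rule order_trans[OF complex_Re_le_cmod])
         (use l2inner_bound[OF L2_diff[OF L(2) L2_scale[OF L(1)]] L(1)] in \<open>auto simp: norm_mult intro: mult_left_mono\<close>)
    ultimately have "- Re (c * z) * (l2norm {0..} u)\<^sup>2 \<le> cmod c * (l2norm {0..} (\<lambda>x. f x - z * u x) * l2norm {0..} u)"
      using A0_form_nonneg[OF q ca cq uf] by linarith
    then have "(- Re (c * z) * l2norm {0..} u) * l2norm {0..} u \<le> (cmod c * l2norm {0..} (\<lambda>x. f x - z * u x)) * l2norm {0..} u"
      by (simp only: power2_eq_square mult.assoc)
    then have "- Re (c * z) * l2norm {0..} u \<le> cmod c * l2norm {0..} (\<lambda>x. f x - z * u x)"
      using un by (simp only: mult_le_cancel_right_pos)
    then show ?thesis using c by (simp add: k_def field_simps)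
  qed simp
  then show ?thesis unfolding regtype_def using k by auto
qed

lemma conjopI: "(u, f) \<in> T \<Longrightarrow> (\<lambda>x. cnj (u x), \<lambda>x. cnj (f x)) \<in> conjop T"
  unfolding conjop_def by blast

text \<open>Strict positivity at the leading coefficient is what the energy estimate consumes; for
  the potential a weak sign suffices, since its term is only discarded. The class is stable under
  conjugation, so each result for \<tau> holds for its formal adjoint too.\<close>

locale halfline_operator =
  fixes a :: complex and q :: "real \<Rightarrow> complex" and c :: complex
  assumes q: "continuous_on {0..} q" and ca: "0 < Re (c * a)" and cq: "\<And>x. 0 \<le> x \<Longrightarrow> Re (c * q x) \<le> 0"
begin

lemma a0: "a \<noteq> 0" using ca by auto

lemma conj: "halfline_operator (cnj a) (\<lambda>x. cnj (q x)) (cnj c)"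
proof
  show "continuous_on {0..} (\<lambda>x. cnj (q x))" using q by (intro continuous_intros)
  show "0 < Re (cnj c * cnj a)" using ca by simp
  show "Re (cnj c * cnj (q x)) \<le> 0" if "0 \<le> x" for x using cq[OF that] by simp
qed

lemma A0_subset_adjoint: "A0 {0..} a q \<subseteq> adjoint {0..} (Amax {0..} (cnj a) (\<lambda>x. cnj (q x)))"
proof clarify
  fix u f assume uf: "(u, f) \<in> A0 {0..} a q"
  have "l2inner {0..} g u = l2inner {0..} v f" if "(v, g) \<in> Amax {0..} (cnj a) (\<lambda>x. cnj (q x))" for v g
  proof -
    have "l2inner {0..} f v = l2inner {0..} u g"
      using that uf unfolding adjoint_A0[OF q a0, symmetric] adjoint_def by auto
    then show ?thesis using l2inner_commute[of "{0..}" g u] l2inner_commute[of "{0..}" v f] by simp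
  qed
  then show "(u, f) \<in> adjoint {0..} (Amax {0..} (cnj a) (\<lambda>x. cnj (q x)))"
    using uf A0_L2[of "{0..}" a q] unfolding adjoint_def by auto
qed

text \<open>Testing against compactly supported elements first places the pair in the maximal
  operator; testing against the two bump functions then turns Green's boundary term into two
  independent linear conditions on the data at 0.\<close>

lemma adjoint_Amax_zero_data:
  assumes "(u, f) \<in> adjoint {0..} (Amax {0..} (cnj a) (\<lambda>x. cnj (q x)))"
  shows "\<exists>w w1 w2. max_rep a q w w1 w2 \<and> w 0 = 0 \<and> w1 0 = 0 \<and> aeq {0..} u w \<and> aeq {0..} f (\<lambda>x. - a * w2 x - q x * w x)"
proof -
  interpret cj: halfline_operator "cnj a" "\<lambda>x. cnj (q x)" "cnj c" by (rule conj)
  have "(u, f) \<in> adjoint {0..} (A0pre {0..} (cnj a) (\<lambda>x. cnj (q x)))"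
    using assms A0pre_subset_Amax unfolding adjoint_def by blast
  from adjoint_A0pre_subset_Amax[OF cj.q cj.a0 this] have "(u, f) \<in> Amax {0..} a q" by simp
  then obtain w w1 w2 where L: "u \<in> L2 {0..}" "f \<in> L2 {0..}" and w: "max_rep a q w w1 w2"
    and ae: "aeq {0..} u w" "aeq {0..} f (\<lambda>x. - a * w2 x - q x * w x)"
    unfolding Amax_iff[OF q] by blast
  have w': "max_rep (cnj (cnj a)) (\<lambda>x. cnj (cnj (q x))) w w1 w2" using w by simp
  have bd: "bump1 i 0 * cnj (w 0) - bump i 0 * cnj (w1 0) = 0" for i
  proof -
    let ?G = "\<lambda>x. - cnj a * bump2 i x - cnj (q x) * bump i x"
    have b: "max_rep (cnj a) (\<lambda>x. cnj (q x)) (bump i) (bump1 i) (bump2 i)" by (rule max_rep_bump[OF cj.q])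
    have bL: "bump i \<in> L2 {0..}" "?G \<in> L2 {0..}" using b by (auto simp: max_rep_def)
    have "l2inner {0..} ?G u = l2inner {0..} (bump i) f"
      using assms bump_in_Amax[OF cj.q, of i "cnj a"] unfolding adjoint_def by blast
    moreover have "l2inner {0..} ?G u = l2inner {0..} ?G w"
      using L w ae bL unfolding max_rep_def by (intro l2inner_cong_aeq) auto
    moreover have "l2inner {0..} (bump i) f = l2inner {0..} (bump i) (\<lambda>x. - cnj (cnj a) * w2 x - cnj (cnj (q x)) * w x)"
      using L w ae bL unfolding max_rep_def by (intro l2inner_cong_aeq) auto
    ultimately have "cnj a * (bump1 i 0 * cnj (w 0) - bump i 0 * cnj (w1 0)) = 0"
      using green_compact_support[OF b w' zero_less_one] bump_support by simp
    then show ?thesis using cj.a0 by (simp only: mult_eq_0_iff) blast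
  qed
  have "w 0 = 0" using bd[of "Suc 0"] by (simp add: bump_init)
  moreover have "w1 0 = 0" using bd[of 0] \<open>w 0 = 0\<close> by (simp add: bump_init)
  ultimately show ?thesis using w ae by blast
qed

lemma adjoint_Amax: "adjoint {0..} (Amax {0..} (cnj a) (\<lambda>x. cnj (q x))) = A0 {0..} a q"
proof
  show "A0 {0..} a q \<subseteq> adjoint {0..} (Amax {0..} (cnj a) (\<lambda>x. cnj (q x)))" by (rule A0_subset_adjoint)
  show "adjoint {0..} (Amax {0..} (cnj a) (\<lambda>x. cnj (q x))) \<subseteq> A0 {0..} a q"
  proof clarify
    fix u f assume uf: "(u, f) \<in> adjoint {0..} (Amax {0..} (cnj a) (\<lambda>x. cnj (q x)))"
    then have L: "u \<in> L2 {0..}" "f \<in> L2 {0..}" by (auto simp: adjoint_def)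
    obtain w w1 w2 where w: "max_rep a q w w1 w2" "w 0 = 0" "w1 0 = 0" "aeq {0..} u w" "aeq {0..} f (\<lambda>x. - a * w2 x - q x * w x)"
      using adjoint_Amax_zero_data[OF uf] by blast
    show "(u, f) \<in> A0 {0..} a q"
      by (rule max_rep_zero_data_in_A0[OF q ca cq w(1-3) L w(4,5)])
  qed
qed

text \<open>Backward, this is the cutoff approximation. Forward, the representative and its zero
  data come from the adjoint of the conjugate maximal operator, which contains the closure.\<close>

lemma A0_iff:
  "(u, f) \<in> A0 {0..} a q \<longleftrightarrow> u \<in> L2 {0..} \<and> f \<in> L2 {0..} \<and> (\<exists>w w1 w2. max_rep a q w w1 w2 \<and> w 0 = 0 \<and> w1 0 = 0
    \<and> aeq {0..} u w \<and> aeq {0..} f (\<lambda>x. - a * w2 x - q x * w x))"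
proof
  assume uf: "(u, f) \<in> A0 {0..} a q"
  then show "u \<in> L2 {0..} \<and> f \<in> L2 {0..} \<and> (\<exists>w w1 w2. max_rep a q w w1 w2 \<and> w 0 = 0 \<and> w1 0 = 0
    \<and> aeq {0..} u w \<and> aeq {0..} f (\<lambda>x. - a * w2 x - q x * w x))"
    using adjoint_Amax_zero_data[of u f] A0_subset_adjoint A0_L2[of "{0..}" a q] by blast
next
  assume "u \<in> L2 {0..} \<and> f \<in> L2 {0..} \<and> (\<exists>w w1 w2. max_rep a q w w1 w2 \<and> w 0 = 0 \<and> w1 0 = 0
    \<and> aeq {0..} u w \<and> aeq {0..} f (\<lambda>x. - a * w2 x - q x * w x))"
  then show "(u, f) \<in> A0 {0..} a q" using max_rep_zero_data_in_A0[OF q ca cq] by blast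
qed

lemma A0_subset_Amax: "A0 {0..} a q \<subseteq> Amax {0..} a q"
proof clarify
  fix u f assume "(u, f) \<in> A0 {0..} a q"
  then show "(u, f) \<in> Amax {0..} a q" unfolding A0_iff Amax_iff[OF q] by blast
qed

text \<open>Conjugation is an involution, so the inclusion for the conjugate coefficients supplies
  the converse.\<close>

lemma conjop_A0_eq: "conjop (A0 {0..} a q) = A0 {0..} (cnj a) (\<lambda>x. cnj (q x))"
proof
  show "conjop (A0 {0..} a q) \<subseteq> A0 {0..} (cnj a) (\<lambda>x. cnj (q x))" by (rule conjop_A0)
  show "A0 {0..} (cnj a) (\<lambda>x. cnj (q x)) \<subseteq> conjop (A0 {0..} a q)"
  proof clarify
    fix u f assume "(u, f) \<in> A0 {0..} (cnj a) (\<lambda>x. cnj (q x))"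
    then have "(\<lambda>x. cnj (u x), \<lambda>x. cnj (f x)) \<in> A0 {0..} a q"
      using conjop_A0[of "cnj a" "\<lambda>x. cnj (q x)"] by (auto simp: conjop_def)
    then have "(\<lambda>x. cnj (cnj (u x)), \<lambda>x. cnj (cnj (f x))) \<in> conjop (A0 {0..} a q)"
      by (rule conjopI)
    then show "(u, f) \<in> conjop (A0 {0..} a q)" by simp
  qed
qed

lemma conjop_A0_subset_adjoint: "conjop (A0 {0..} a q) \<subseteq> adjoint {0..} (A0 {0..} a q)"
proof -
  interpret cj: halfline_operator "cnj a" "\<lambda>x. cnj (q x)" "cnj c" by (rule conj)
  show ?thesis unfolding adjoint_A0[OF q a0] using conjop_A0[of a q] cj.A0_subset_Amax by blast
qed

text \<open>The minimal domain is the kernel of the map sending an element of the maximal domain to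
  its value and slope at 0, and the bump functions show that this map is onto.\<close>

lemma quotdim_Amax_A0: "quotdim (opdom (Amax {0..} a q)) (opdom (A0 {0..} a q)) 2"
proof -
  have two: "{..<2::nat} = {0, Suc 0}" by auto
  have ind: "\<forall>i<2. d i = 0" if mem: "(\<lambda>x. \<Sum>i<2. d i * bump i x) \<in> opdom (A0 {0..} a q)" for d :: "nat \<Rightarrow> complex"
  proof -
    define y where "y x = d 0 * bump 0 x + d (Suc 0) * bump (Suc 0) x" for x
    define y1 where "y1 x = d 0 * bump1 0 x + d (Suc 0) * bump1 (Suc 0) x" for x
    define y2 where "y2 x = d 0 * bump2 0 x + d (Suc 0) * bump2 (Suc 0) x" for x
    have acy: "AC y y1" "AC y1 y2" unfolding y_def y1_def y2_def by (intro AC_add AC_scale AC_bump)+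
    have "y \<in> opdom (A0 {0..} a q)" using mem by (simp add: two y_def[abs_def])
    then obtain f where "(y, f) \<in> A0 {0..} a q" by (auto simp: opdom_def)
    then obtain w w1 w2 where w: "max_rep a q w w1 w2" "w 0 = 0" "w1 0 = 0" "aeq {0..} y w"
      unfolding A0_iff by blast
    have acw: "AC w w1" "AC w1 w2" using w(1) by (auto simp: max_rep_def)
    have eq: "y x = w x" if "0 \<le> x" for x
      by (rule aeq_imp_eq_continuous[OF AC_continuous[OF acy(1)] AC_continuous[OF acw(1)] w(4) that])
    have "y1 0 = w1 0"
      by (rule AC_deriv_unique[OF acy(1) acw(1) AC_continuous[OF acy(2)] AC_continuous[OF acw(2)] eq]) auto
    then have "y1 0 = 0" "y 0 = 0" using w eq[of 0] by auto
    then have "d 0 = 0" "d (Suc 0) = 0" by (auto simp: y_def y1_def bump_init)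
    then show ?thesis by (auto simp: less_2_cases_iff)
  qed
  have span: "\<exists>d :: nat \<Rightarrow> complex. (\<lambda>x. h x - (\<Sum>i<2. d i * bump i x)) \<in> opdom (A0 {0..} a q)"
    if "h \<in> opdom (Amax {0..} a q)" for h
  proof -
    obtain f where hf: "(h, f) \<in> Amax {0..} a q" using \<open>h \<in> _\<close> by (auto simp: opdom_def)
    then obtain w w1 w2 where L: "h \<in> L2 {0..}" "f \<in> L2 {0..}" and w: "max_rep a q w w1 w2"
      and ae: "aeq {0..} h w" "aeq {0..} f (\<lambda>x. - a * w2 x - q x * w x)"
      unfolding Amax_iff[OF q] by blast
    \<comment> \<open>The summand \<open>3 * w 0\<close> compensates the slope \<open>-3\<close>
      that \<open>bump 0\<close> has at the origin.\<close>
    define d where "d i = (if i = (0::nat) then w 0 else w1 0 + 3 * w 0)" for i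
    define y where "y x = (w x + (- d 0) * bump 0 x) + (- d (Suc 0)) * bump (Suc 0) x" for x
    define y1 where "y1 x = (w1 x + (- d 0) * bump1 0 x) + (- d (Suc 0)) * bump1 (Suc 0) x" for x
    define y2 where "y2 x = (w2 x + (- d 0) * bump2 0 x) + (- d (Suc 0)) * bump2 (Suc 0) x" for x
    have y: "max_rep a q y y1 y2" unfolding y_def y1_def y2_def by (intro max_rep_lin max_rep_bump[OF q] w)
    have y0: "y 0 = 0" "y1 0 = 0" by (simp_all add: y_def y1_def bump_init d_def)
    have bL: "bump i \<in> L2 {0..}" for i using max_rep_bump[OF q, of a i] by (simp add: max_rep_def)
    have hL: "(\<lambda>x. h x - (\<Sum>i<2. d i * bump i x)) \<in> L2 {0..}"
      unfolding two by (simp, intro L2_diff L2_add L2_scale L bL)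
    have "aeq {0..} (\<lambda>x. h x - (\<Sum>i<2. d i * bump i x)) y"
      using ae(1) unfolding aeq_def by eventually_elim (simp add: two y_def)
    then have "((\<lambda>x. h x - (\<Sum>i<2. d i * bump i x)), (\<lambda>x. - a * y2 x - q x * y x)) \<in> A0 {0..} a q"
      unfolding A0_iff using hL y[unfolded max_rep_def] y y0 aeq_refl by blast
    then show ?thesis unfolding opdom_def by (intro exI[of _ d]) force
  qed
  have "bump i \<in> opdom (Amax {0..} a q)" for i
    using bump_in_Amax[OF q, of i a] unfolding opdom_def by force
  then show ?thesis unfolding quotdim_def using ind span by blast
qed

end

subsection \<open>Deficiency\<close>

lemma regtype_conjop: "z \<in> regtype S T \<Longrightarrow> cnj z \<in> regtype S (conjop T)"
proof -
  assume "z \<in> regtype S T"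
  then obtain k where k: "k > 0" and le: "\<And>u f. (u, f) \<in> T \<Longrightarrow> k * l2norm S u \<le> l2norm S (\<lambda>x. f x - z * u x)"
    unfolding regtype_def by blast
  have "k * l2norm S u' \<le> l2norm S (\<lambda>x. f' x - cnj z * u' x)" if cj: "(u', f') \<in> conjop T" for u' f'
  proof -
    obtain u f where uf: "(u, f) \<in> T" "u' = (\<lambda>x. cnj (u x))" "f' = (\<lambda>x. cnj (f x))"
      using cj unfolding conjop_def by blast
    show ?thesis using le[OF uf(1)] l2norm_cnj[of S u] l2norm_cnj[of S "\<lambda>x. f x - z * u x"] by (simp add: uf(2,3))
  qed
  then show ?thesis unfolding regtype_def using k by blast
qed

context halfline_operator
begin

lemma Amax_cnj:
  assumes "(u, f) \<in> Amax {0..} a q"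
  shows "(\<lambda>x. cnj (u x), \<lambda>x. cnj (f x)) \<in> Amax {0..} (cnj a) (\<lambda>x. cnj (q x))"
proof -
  interpret cj: halfline_operator "cnj a" "\<lambda>x. cnj (q x)" "cnj c" by (rule conj)
  obtain w w1 w2 where L: "u \<in> L2 {0..}" "f \<in> L2 {0..}" and w: "max_rep a q w w1 w2"
    and ae: "aeq {0..} u w" "aeq {0..} f (\<lambda>x. - a * w2 x - q x * w x)"
    using assms unfolding Amax_iff[OF q] by blast
  have "aeq {0..} (\<lambda>x. cnj (u x)) (\<lambda>x. cnj (w x))"
    using ae(1) unfolding aeq_def by eventually_elim simp
  moreover have "aeq {0..} (\<lambda>x. cnj (f x)) (\<lambda>x. - cnj a * cnj (w2 x) - cnj (q x) * cnj (w x))"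
    using ae(2) unfolding aeq_def by eventually_elim simp
  ultimately show ?thesis unfolding Amax_iff[OF cj.q] using L2_cnj[OF L(1)] L2_cnj[OF L(2)] max_rep_cnj[OF w] by blast
qed

text \<open>Limit-point property: the Wronskian of two square integrable solutions is constant, and it is
  integrable because their derivatives are square integrable as well, hence it vanishes.\<close>
lemma wronskian_zero:
  assumes u: "max_rep a q u u1 u2" "aeq {0..} (\<lambda>x. - a * u2 x - q x * u x) (\<lambda>x. z * u x)"
    and v: "max_rep a q v v1 v2" "aeq {0..} (\<lambda>x. - a * v2 x - q x * v x) (\<lambda>x. z * v x)"
  shows "u1 0 * v 0 - u 0 * v1 0 = 0"
proof -
  have acs: "AC u u1" "AC u1 u2" "AC v v1" "AC v1 v2" and L: "u \<in> L2 {0..}" "v \<in> L2 {0..}"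
    using u v by (auto simp: max_rep_def)
  have L1: "u1 \<in> L2 {0..}" "v1 \<in> L2 {0..}"
    using max_rep_deriv_L2[OF u(1) ca cq] max_rep_deriv_L2[OF v(1) ca cq] by auto
  have ae0: "AE x in lebesgue_on {0..}. u2 x * v x - u x * v2 x = 0"
    using u(2) v(2) unfolding aeq_def
  proof eventually_elim
    case (elim x)
    have "a * (u2 x * v x - u x * v2 x)
        = u x * (- a * v2 x - q x * v x) - (- a * u2 x - q x * u x) * v x"
      by (simp add: algebra_simps)
    also have "\<dots> = 0" unfolding elim by simp
    finally show ?case using a0 by simp
  qed
  have const: "u1 b * v b - u b * v1 b = u1 0 * v 0 - u 0 * v1 0" if b: "0 \<le> b" for b
  proof -
    note g = AC_green[OF acs b]
    have "AE x in lebesgue. x \<in> {0..} \<longrightarrow> u2 x * v x - u x * v2 x = 0"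
      using ae0 by (subst (asm) AE_restrict_space_iff) auto
    then have "AE x in lebesgue. x \<in> {0..b} \<longrightarrow> u2 x * v x - u x * v2 x = 0"
      by eventually_elim auto
    then have "AE x in lebesgue_on {0..b}. u2 x * v x - u x * v2 x = 0"
      by (subst AE_restrict_space_iff) auto
    then have "integral\<^sup>L (lebesgue_on {0..b}) (\<lambda>x. u2 x * v x - u x * v2 x) = 0"
      by (rule integral_eq_zero_AE)
    then show ?thesis using lebesgue_on_set_integrable(2)[OF g(1)] g(2) by simp
  qed
  have "integrable (lebesgue_on {0..}) (\<lambda>x. u1 x * v x - u x * v1 x)"
    by (intro Bochner_Integration.integrable_diff L2_mult_integrable L L1)
  from integrable_const_imp_0[OF this const] show ?thesis .
qed

lemma regtype_kernel_trivial:
  assumes z: "z \<in> regtype {0..} (A0 {0..} a q)" and "(u, f) \<in> A0 {0..} a q" "aeq {0..} f (\<lambda>x. z * u x)"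
  shows "aeq {0..} u (\<lambda>x. 0)"
proof -
  obtain k where k: "k > 0" "k * l2norm {0..} u \<le> l2norm {0..} (\<lambda>x. f x - z * u x)"
    using z assms(2) unfolding regtype_def by blast
  have L: "u \<in> L2 {0..}" "f \<in> L2 {0..}" using assms(2) A0_L2[of "{0..}" a q] by auto
  have "aeq {0..} (\<lambda>x. f x - z * u x) (\<lambda>x. 0)" using assms(3) unfolding aeq_def by eventually_elim simp
  then have "l2norm {0..} (\<lambda>x. f x - z * u x) = 0" using l2norm_eq_0_iff[OF L2_diff[OF L(2) L2_scale[OF L(1)]]] by simp
  then have "k * l2norm {0..} u \<le> 0" using k(2) by simp
  then have "l2norm {0..} u = 0" using k(1) l2norm_nonneg[of "{0..}" u] by (simp add: mult_le_0_iff)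
  then show ?thesis using l2norm_eq_0_iff[OF L(1)] by simp
qed

text \<open>A vanishing Wronskian makes the initial data proportional. A combination with zero data
  lies in the minimal operator, where regularity at \<open>z\<close> forces it to vanish; this
  stands in for uniqueness of the initial value problem and also shows that a nonzero kernel element
  has nonzero data.\<close>

lemma kernel_Amax_dim_le_1:
  assumes z: "z \<in> regtype {0..} (A0 {0..} a q)"
    and u: "(u, \<lambda>x. z * u x) \<in> Amax {0..} a q" and v: "(v, \<lambda>x. z * v x) \<in> Amax {0..} a q"
    and nz: "\<not> aeq {0..} u (\<lambda>x. 0)"
  shows "\<exists>m. aeq {0..} v (\<lambda>x. m * u x)"
proof -
  obtain y y1 y2 where y: "max_rep a q y y1 y2" "aeq {0..} u y" "aeq {0..} (\<lambda>x. z * u x) (\<lambda>x. - a * y2 x - q x * y x)"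
    and uL: "u \<in> L2 {0..}"
    using u unfolding Amax_iff[OF q] by blast
  obtain w w1 w2 where w: "max_rep a q w w1 w2" "aeq {0..} v w" "aeq {0..} (\<lambda>x. z * v x) (\<lambda>x. - a * w2 x - q x * w x)"
    and vL: "v \<in> L2 {0..}"
    using v unfolding Amax_iff[OF q] by blast
  have yz: "aeq {0..} (\<lambda>x. - a * y2 x - q x * y x) (\<lambda>x. z * y x)"
    using y(2,3) unfolding aeq_def by eventually_elim simp
  have wz: "aeq {0..} (\<lambda>x. - a * w2 x - q x * w x) (\<lambda>x. z * w x)"
    using w(2,3) unfolding aeq_def by eventually_elim simp
  have W: "y1 0 * w 0 = y 0 * w1 0" using wronskian_zero[OF y(1) yz w(1) wz] by simp
  have ne: "y 0 \<noteq> 0 \<or> y1 0 \<noteq> 0"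
  proof (rule ccontr)
    assume "\<not> ?thesis"
    then have "(u, \<lambda>x. z * u x) \<in> A0 {0..} a q"
      unfolding A0_iff using y uL L2_scale[OF uL, of z] by blast
    from regtype_kernel_trivial[OF z this aeq_refl] nz show False by simp
  qed
  obtain m where m: "w 0 = m * y 0" "w1 0 = m * y1 0"
  proof (cases "y 0 = 0")
    case True
    then show ?thesis using W ne that[of "w1 0 / y1 0"] by simp
  next
    case False
    then have "w1 0 = w 0 / y 0 * y1 0" using W by (simp add: field_simps)
    then show ?thesis using False that[of "w 0 / y 0"] by simp
  qed
  let ?d = "\<lambda>x. v x + (- m) * u x"
  have rep: "max_rep a q (\<lambda>x. w x + (- m) * y x) (\<lambda>x. w1 x + (- m) * y1 x) (\<lambda>x. w2 x + (- m) * y2 x)"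
    by (rule max_rep_lin[OF w(1) y(1)])
  have dL: "?d \<in> L2 {0..}" by (intro L2_add L2_scale uL vL)
  have "aeq {0..} ?d (\<lambda>x. w x + (- m) * y x)"
    using y(2) w(2) unfolding aeq_def by eventually_elim simp
  moreover have "aeq {0..} (\<lambda>x. z * ?d x) (\<lambda>x. - a * (w2 x + (- m) * y2 x) - q x * (w x + (- m) * y x))"
    using y(2) w(2) yz wz unfolding aeq_def
  proof eventually_elim
    case (elim x)
    have "- a * (w2 x + (- m) * y2 x) - q x * (w x + (- m) * y x)
      = (- a * w2 x - q x * w x) - m * (- a * y2 x - q x * y x)" by (simp add: algebra_simps)
    also have "\<dots> = z * ?d x" unfolding elim by (simp add: algebra_simps)
    finally show ?case by simp
  qed
  moreover have "w 0 + (- m) * y 0 = 0" "w1 0 + (- m) * y1 0 = 0" using m by auto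
  ultimately have "(?d, \<lambda>x. z * ?d x) \<in> A0 {0..} a q"
    unfolding A0_iff using rep dL L2_scale[OF dL, of z] by blast
  from regtype_kernel_trivial[OF z this aeq_refl]
  have "aeq {0..} v (\<lambda>x. m * u x)" unfolding aeq_def by eventually_elim simp
  then show ?thesis by blast
qed

text \<open>Presents the maximal operator as an adjoint, from which its linearity is read
  off.\<close>

lemma Amax_eq_adjoint: "Amax {0..} a q = adjoint {0..} (A0 {0..} (cnj a) (\<lambda>x. cnj (q x)))"
proof -
  interpret cj: halfline_operator "cnj a" "\<lambda>x. cnj (q x)" "cnj c" by (rule conj)
  show ?thesis using adjoint_A0[OF cj.q cj.a0] by simp
qed

text \<open>Regularity at \<open>z\<close> makes the range of \<open>A - z\<close> closed, so
  \<open>L2\<close> splits into it and its orthogonal complement. Conjugation identifies that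
  complement with the kernel of the maximal operator minus \<open>z\<close>, of dimension at most
  one by the Wronskian and at least one by codimension two of the domains.\<close>

lemma quotdim_range:
  assumes z: "z \<in> regtype {0..} (A0 {0..} a q)"
  shows "quotdim (L2 {0..}) (opran (opshift (A0 {0..} a q) z)) 1"
proof -
  define A where "A = A0 {0..} a q"
  define R where "R = opran (opshift A z)"
  have R_iff: "h \<in> R \<longleftrightarrow> (\<exists>u f. (u, f) \<in> A \<and> h = (\<lambda>x. f x - z * u x))" for h
    unfolding R_def opran_def opshift_def by force
  have AL: "A \<subseteq> L2 {0..} \<times> L2 {0..}" unfolding A_def by (rule A0_L2)
  note T' = Amax_L2[of "{0..}" "cnj a" "\<lambda>x. cnj (q x)"]
  have A_adj: "A = adjoint {0..} (Amax {0..} (cnj a) (\<lambda>x. cnj (q x)))" unfolding A_def adjoint_Amax ..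
  have A_lin: "(\<lambda>x. u x + d * v x, \<lambda>x. f x + d * g x) \<in> A" if "(u, f) \<in> A" "(v, g) \<in> A" for u f v g d
    using adjoint_lin[OF T'] that unfolding A_adj by blast
  have A_aeq: "(u', f') \<in> A" if "(u, f) \<in> A" "u' \<in> L2 {0..}" "f' \<in> L2 {0..}" "aeq {0..} u u'" "aeq {0..} f f'" for u f u' f'
    using adjoint_aeq[OF T'] that unfolding A_adj by blast
  obtain k where k: "k > 0" and kle: "\<And>u f. (u, f) \<in> A \<Longrightarrow> k * l2norm {0..} u \<le> l2norm {0..} (\<lambda>x. f x - z * u x)"
    using z unfolding regtype_def A_def by blast
  have RL: "R \<subseteq> L2 {0..}"
  proof
    fix h assume "h \<in> R"
    then obtain u f where "(u, f) \<in> A" "h = (\<lambda>x. f x - z * u x)" unfolding R_iff by blast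
    then show "h \<in> L2 {0..}" using AL by (auto intro!: L2_diff L2_scale)
  qed
  have R_lin: "(\<lambda>x. f x + d * g x) \<in> R" if "f \<in> R" "g \<in> R" for f g d
  proof -
    obtain u p v r where *: "(u, p) \<in> A" "f = (\<lambda>x. p x - z * u x)" "(v, r) \<in> A" "g = (\<lambda>x. r x - z * v x)"
      using \<open>f \<in> R\<close> \<open>g \<in> R\<close> unfolding R_iff by blast
    have "(\<lambda>x. f x + d * g x) = (\<lambda>x. (p x + d * r x) - z * (u x + d * v x))"
      unfolding *(2,4) by (auto simp: algebra_simps)
    then show ?thesis using A_lin[OF *(1,3), of d] unfolding R_iff by blast
  qed
  have R_aeq: "h' \<in> R" if h: "h \<in> R" "h' \<in> L2 {0..}" "aeq {0..} h h'" for h h'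
  proof -
    obtain u f where uf: "(u, f) \<in> A" "h = (\<lambda>x. f x - z * u x)" using h(1) unfolding R_iff by blast
    have L: "u \<in> L2 {0..}" "f \<in> L2 {0..}" using uf AL by auto
    have "aeq {0..} f (\<lambda>x. h' x + z * u x)" using h(3) unfolding uf(2) aeq_def by eventually_elim (simp add: diff_eq_eq)
    then have "(u, \<lambda>x. h' x + z * u x) \<in> A"
      using L h(2) by (intro A_aeq[OF uf(1)] L2_add L2_scale) auto
    moreover have "h' = (\<lambda>x. (h' x + z * u x) - z * u x)" by simp
    ultimately show ?thesis unfolding R_iff by blast
  qed
  have A_zero: "(\<lambda>x. 0, \<lambda>x. 0) \<in> A" unfolding A_adj adjoint_def by (auto simp: l2inner_def)
  have R_zero: "(\<lambda>x. 0) \<in> R" unfolding R_iff using A_zero by (intro exI conjI) auto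
  \<comment> \<open>The lower bound turns convergence of the images into a Cauchy condition on the
    preimages; their limit stays in \<open>A\<close> because \<open>A\<close>, being an adjoint, is
    closed.\<close>
  have R_closed: "h \<in> R" if H: "\<And>n. H n \<in> R" and h: "h \<in> L2 {0..}" and lim: "(\<lambda>n. l2norm {0..} (\<lambda>x. H n x - h x)) \<longlonglongrightarrow> 0" for H h
  proof -
    have "\<forall>n. \<exists>u f. (u, f) \<in> A \<and> H n = (\<lambda>x. f x - z * u x)" using H unfolding R_iff by blast
    then obtain U F where UF: "\<And>n. (U n, F n) \<in> A" and HU: "\<And>n. H n = (\<lambda>x. F n x - z * U n x)" by metis
    have UL: "U n \<in> L2 {0..}" and FL: "F n \<in> L2 {0..}" for n using UF[of n] AL by auto
    have HL: "H n \<in> L2 {0..}" for n using H RL by blast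
    have diff: "k * l2norm {0..} (\<lambda>x. U m x - U n x) \<le> l2norm {0..} (\<lambda>x. H m x - h x) + l2norm {0..} (\<lambda>x. H n x - h x)" for m n
    proof -
      have "(\<lambda>x. U m x + (-1) * U n x, \<lambda>x. F m x + (-1) * F n x) \<in> A" by (rule A_lin[OF UF UF])
      from kle[OF this] have "k * l2norm {0..} (\<lambda>x. U m x - U n x) \<le> l2norm {0..} (\<lambda>x. H m x - H n x)"
        by (simp add: HU algebra_simps)
      also have "\<dots> \<le> l2norm {0..} (\<lambda>x. H m x - h x) + l2norm {0..} (\<lambda>x. h x - H n x)"
        by (rule l2norm_triangle_diff3[OF HL h HL])
      finally show ?thesis using l2norm_minus_commute[of "{0..}" h "H n"] by simp
    qed
    have "\<exists>u\<in>L2 {0..}. (\<lambda>n. l2norm {0..} (\<lambda>x. U n x - u x)) \<longlonglongrightarrow> 0"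
    proof (rule L2_complete[OF UL])
      fix e :: real assume e: "0 < e"
      then obtain M where M: "\<And>n. n \<ge> M \<Longrightarrow> l2norm {0..} (\<lambda>x. H n x - h x) < k * e / 2"
        using LIMSEQ_D[OF lim, of "k * e / 2"] k by auto
      have "l2norm {0..} (\<lambda>x. U m x - U n x) < e" if "m \<ge> M" "n \<ge> M" for m n
      proof -
        have "k * l2norm {0..} (\<lambda>x. U m x - U n x) < k * e" using diff[of m n] M[OF that(1)] M[OF that(2)] by linarith
        then show ?thesis using k by simp
      qed
      then show "\<exists>N. \<forall>m\<ge>N. \<forall>n\<ge>N. l2norm {0..} (\<lambda>x. U m x - U n x) < e" by blast
    qed
    then obtain u where uL: "u \<in> L2 {0..}" and ulim: "(\<lambda>n. l2norm {0..} (\<lambda>x. U n x - u x)) \<longlonglongrightarrow> 0" by blast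
    have fL: "(\<lambda>x. h x + z * u x) \<in> L2 {0..}" by (intro L2_add L2_scale h uL)
    have "(\<lambda>n. l2norm {0..} (\<lambda>x. F n x - (h x + z * u x))) \<longlonglongrightarrow> 0"
    proof (rule Lim_null_comparison)
      show "(\<lambda>n. l2norm {0..} (\<lambda>x. H n x - h x) + cmod z * l2norm {0..} (\<lambda>x. U n x - u x)) \<longlonglongrightarrow> 0"
        using tendsto_add[OF lim tendsto_mult[OF tendsto_const ulim, of "cmod z"]] by simp
      have "l2norm {0..} (\<lambda>x. F n x - (h x + z * u x)) \<le> l2norm {0..} (\<lambda>x. H n x - h x) + cmod z * l2norm {0..} (\<lambda>x. U n x - u x)" for n
      proof -
        have "(\<lambda>x. F n x - (h x + z * u x)) = (\<lambda>x. (H n x - h x) + z * (U n x - u x))"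
          by (auto simp: HU algebra_simps)
        then show ?thesis
          using l2norm_triangle[OF L2_diff[OF HL h] L2_scale[OF L2_diff[OF UL uL], of z], of n n]
          by (simp only: l2norm_scale)
      qed
      then show "\<forall>\<^sub>F n in sequentially. norm (l2norm {0..} (\<lambda>x. F n x - (h x + z * u x)))
          \<le> l2norm {0..} (\<lambda>x. H n x - h x) + cmod z * l2norm {0..} (\<lambda>x. U n x - u x)" by simp
    qed
    then have "(u, \<lambda>x. h x + z * u x) \<in> A"
      using adjoint_closed[OF T' _ uL fL ulim] UF unfolding A_adj by blast
    moreover have "h = (\<lambda>x. (h x + z * u x) - z * u x)" by simp
    ultimately show ?thesis unfolding R_iff by blast
  qed
  have proj: "\<exists>r\<in>R. \<forall>g\<in>R. l2inner {0..} (\<lambda>x. h x - r x) g = 0" if h: "h \<in> L2 {0..}" for h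
  proof (rule L2_projection[OF RL R_zero])
    show "(\<lambda>x. f x + d * g x) \<in> R" if "f \<in> R" "g \<in> R" for f g d by (rule R_lin[OF that])
    show "f \<in> R" if "\<And>n. F n \<in> R" "f \<in> L2 {0..}" "(\<lambda>n. l2norm {0..} (\<lambda>x. F n x - f x)) \<longlonglongrightarrow> 0" for F f
      by (rule R_closed[OF that])
  qed (rule h)
  \<comment> \<open>Orthogonality to the range says that \<open>p\<close> is an eigenfunction of the
    adjoint for \<open>cnj z\<close>. Its conjugate is then one of the maximal operator for
    \<open>z\<close>.\<close>
  have perp: "(\<lambda>x. cnj (p x), \<lambda>x. z * cnj (p x)) \<in> Amax {0..} a q"
    if p: "p \<in> L2 {0..}" "\<And>r. r \<in> R \<Longrightarrow> l2inner {0..} p r = 0" for p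
  proof -
    interpret cj: halfline_operator "cnj a" "\<lambda>x. cnj (q x)" "cnj c" by (rule conj)
    have "l2inner {0..} f p = l2inner {0..} u (\<lambda>x. cnj z * p x)" if uf: "(u, f) \<in> A" for u f
    proof -
      have L: "u \<in> L2 {0..}" "f \<in> L2 {0..}" using uf AL by auto
      have "(\<lambda>x. f x - z * u x) \<in> R" unfolding R_iff using uf by blast
      then have "l2inner {0..} (\<lambda>x. f x - z * u x) p = 0"
        using p(2) l2inner_commute[of "{0..}" "\<lambda>x. f x - z * u x" p] by simp
      then show ?thesis using l2inner_diff_left[OF L(2) L2_scale[OF L(1), of z] p(1)]
        by (simp add: l2inner_scale_left l2inner_scale_right)
    qed
    then have "(p, \<lambda>x. cnj z * p x) \<in> adjoint {0..} A"
      using p(1) L2_scale[OF p(1)] by (auto simp: adjoint_def)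
    then have "(p, \<lambda>x. cnj z * p x) \<in> Amax {0..} (cnj a) (\<lambda>x. cnj (q x))"
      unfolding A_def adjoint_A0[OF q a0] .
    from cj.Amax_cnj[OF this] show ?thesis by simp
  qed
  \<comment> \<open>With a trivial complement \<open>A - z\<close> is onto. For \<open>g 0\<close>
    in the maximal but not in the minimal domain, the image under the maximal operator minus
    \<open>z\<close> is also attained at some \<open>v\<close> in the minimal domain. The conjugate
    of \<open>g 0 - v\<close> is orthogonal to \<open>R\<close>, hence null, which puts
    \<open>g 0\<close> into the minimal domain after all.\<close>
  have ex: "\<exists>p\<in>L2 {0..}. (\<forall>r\<in>R. l2inner {0..} p r = 0) \<and> \<not> aeq {0..} p (\<lambda>x. 0)"
  proof (rule ccontr)
    assume no: "\<not> ?thesis"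
    have all: "h \<in> R" if h: "h \<in> L2 {0..}" for h
    proof -
      obtain r where r: "r \<in> R" "\<forall>g\<in>R. l2inner {0..} (\<lambda>x. h x - r x) g = 0" using proj[OF h] by blast
      have "(\<lambda>x. h x - r x) \<in> L2 {0..}" using h r RL by (auto intro!: L2_diff)
      then have "aeq {0..} (\<lambda>x. h x - r x) (\<lambda>x. 0)" using no r(2) by blast
      then have "aeq {0..} r h" unfolding aeq_def by eventually_elim simp
      then show ?thesis by (rule R_aeq[OF r(1) h])
    qed
    obtain g :: "nat \<Rightarrow> real \<Rightarrow> complex" where g: "g 0 \<in> opdom (Amax {0..} a q)"
      and ind: "\<And>d :: nat \<Rightarrow> complex. (\<lambda>x. \<Sum>i<2. d i * g i x) \<in> opdom (A0 {0..} a q) \<Longrightarrow> d 0 = 0"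
      using quotdim_Amax_A0 unfolding quotdim_def by (metis pos2)
    have g0: "g 0 \<notin> opdom (A0 {0..} a q)"
    proof
      assume "g 0 \<in> opdom (A0 {0..} a q)"
      then show False using ind[of "\<lambda>i. if i = 0 then 1 else 0"] by (simp add: lessThan_Suc numeral_2_eq_2)
    qed
    obtain f where f: "(g 0, f) \<in> Amax {0..} a q" using g by (auto simp: opdom_def)
    have L: "g 0 \<in> L2 {0..}" "f \<in> L2 {0..}" using f by (auto simp: Amax_def)
    have "(\<lambda>x. f x - z * g 0 x) \<in> R" by (intro all L2_diff L2_scale L)
    then obtain v p where vp: "(v, p) \<in> A" "(\<lambda>x. f x - z * g 0 x) = (\<lambda>x. p x - z * v x)" unfolding R_iff by blast
    have vL: "v \<in> L2 {0..}" "p \<in> L2 {0..}" using vp AL by auto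
    define d where "d x = g 0 x - v x" for x
    have "(\<lambda>x. g 0 x + (-1) * v x, \<lambda>x. f x + (-1) * p x) \<in> Amax {0..} a q"
      using f vp(1) A0_subset_Amax unfolding Amax_eq_adjoint A_def
      by (intro adjoint_lin[OF A0_L2]) auto
    moreover have "(\<lambda>x. f x + (-1) * p x) = (\<lambda>x. z * d x)"
      using vp(2) by (auto simp: d_def fun_eq_iff algebra_simps)
    ultimately have dA: "(d, \<lambda>x. z * d x) \<in> Amax {0..} a q" by (simp add: d_def[abs_def])
    have dL: "d \<in> L2 {0..}" unfolding d_def by (rule L2_diff[OF L(1) vL(1)])
    have "(\<lambda>x. cnj (d x), \<lambda>x. cnj z * cnj (d x)) \<in> adjoint {0..} A"
      using Amax_cnj[OF dA] unfolding A_def adjoint_A0[OF q a0] by simp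
    then have adj: "l2inner {0..} f (\<lambda>x. cnj (d x)) = l2inner {0..} u (\<lambda>x. cnj z * cnj (d x))" if "(u, f) \<in> A" for u f
      using that unfolding adjoint_def by blast
    have "l2inner {0..} (\<lambda>x. cnj (d x)) r = 0" if r: "r \<in> R" for r
    proof -
      obtain u f where uf: "(u, f) \<in> A" "r = (\<lambda>x. f x - z * u x)" using r unfolding R_iff by blast
      have ufL: "u \<in> L2 {0..}" "f \<in> L2 {0..}" using uf AL by auto
      have "l2inner {0..} r (\<lambda>x. cnj (d x)) = 0"
        using adj[OF uf(1)] l2inner_diff_left[OF ufL(2) L2_scale[OF ufL(1), of z] L2_cnj[OF dL]] unfolding uf(2)
        by (simp add: l2inner_scale_left l2inner_scale_right)
      then show ?thesis using l2inner_commute[of "{0..}" "\<lambda>x. cnj (d x)" r] by simp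
    qed
    then have "aeq {0..} (\<lambda>x. cnj (d x)) (\<lambda>x. 0)" using no L2_cnj[OF dL] by blast
    then have "aeq {0..} v (g 0)" unfolding aeq_def by eventually_elim (simp add: d_def)
    then have "(g 0, p) \<in> A" by (intro A_aeq[OF vp(1) L(1) vL(2) _ aeq_refl])
    then show False using g0 unfolding A_def opdom_def by force
  qed
  then obtain p where pL: "p \<in> L2 {0..}" and pR: "\<And>r. r \<in> R \<Longrightarrow> l2inner {0..} p r = 0" and pn: "\<not> aeq {0..} p (\<lambda>x. 0)" by blast
  have pn': "\<not> aeq {0..} (\<lambda>x. cnj (p x)) (\<lambda>x. 0)" using pn by (simp add: aeq_def)
  have ind: "d = 0" if "(\<lambda>x. d * p x) \<in> R" for d
  proof -
    have "cnj d * l2inner {0..} p p = 0" using pR[OF that] by (simp add: l2inner_scale_right)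
    moreover have "l2inner {0..} p p \<noteq> 0" using pn l2norm_eq_0_iff[OF pL] unfolding l2inner_self by simp
    ultimately show ?thesis by simp
  qed
  have span: "\<exists>d. (\<lambda>x. h x - d * p x) \<in> R" if h: "h \<in> L2 {0..}" for h
  proof -
    obtain r where r: "r \<in> R" "\<forall>g\<in>R. l2inner {0..} (\<lambda>x. h x - r x) g = 0" using proj[OF h] by blast
    have eL: "(\<lambda>x. h x - r x) \<in> L2 {0..}" using h r RL by (auto intro!: L2_diff)
    obtain m where "aeq {0..} (\<lambda>x. cnj (h x - r x)) (\<lambda>x. m * cnj (p x))"
      using kernel_Amax_dim_le_1[OF z perp[OF pL pR] perp[OF eL] pn'] r(2) by blast
    then have "aeq {0..} r (\<lambda>x. h x - cnj m * p x)" unfolding aeq_def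
    proof eventually_elim
      case (elim x)
      have "h x - r x = cnj (cnj (h x - r x))" by simp
      also have "\<dots> = cnj m * p x" unfolding elim by simp
      finally show ?case by (simp add: algebra_simps)
    qed
    from R_aeq[OF r(1) _ this] show ?thesis using L2_diff[OF h L2_scale[OF pL]] by blast
  qed
  show ?thesis unfolding quotdim_def A_def[symmetric] R_def[symmetric]
  proof (intro exI[of _ "\<lambda>i::nat. p"] conjI ballI allI impI)
    fix d :: "nat \<Rightarrow> complex" and i :: nat
    assume "(\<lambda>x. \<Sum>i<1. d i * p x) \<in> R" "i < 1"
    then show "d i = 0" using ind[of "d 0"] by simp
  next
    fix h assume "h \<in> L2 {0..}"
    then obtain d where "(\<lambda>x. h x - d * p x) \<in> R" using span by blast
    then show "\<exists>c :: nat \<Rightarrow> complex. (\<lambda>x. h x - (\<Sum>i<1. c i * p x)) \<in> R" by (intro exI[of _ "\<lambda>i. d"]) simp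
  qed (rule pL)
qed

end

subsection \<open>Reflection\<close>

lemma integrable_lebesgue_on_reflect:
  fixes f :: "real \<Rightarrow> 'a::euclidean_space"
  shows "integrable (lebesgue_on {..0}) f \<longleftrightarrow> integrable (lebesgue_on {0..}) (\<lambda>x. f (- x))"
proof -
  have "integrable (lebesgue_on {0..}) (\<lambda>x. f (- x)) \<longleftrightarrow> integrable lebesgue (\<lambda>x. indicator {..0::real} (0 + (-1) * x) *\<^sub>R f (0 + (-1) * x))"
    by (subst integrable_restrict_space) (auto simp: indicator_def)
  also have "\<dots> \<longleftrightarrow> integrable lebesgue (\<lambda>x. indicator {..0::real} x *\<^sub>R f x)"
    by (rule lebesgue_integrable_real_affine_iff) simp
  also have "\<dots> \<longleftrightarrow> integrable (lebesgue_on {..0}) f"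
    by (subst integrable_restrict_space) auto
  finally show ?thesis by simp
qed

lemma integral_lebesgue_on_reflect:
  fixes f :: "real \<Rightarrow> 'a::euclidean_space"
  shows "integral\<^sup>L (lebesgue_on {..0}) f = integral\<^sup>L (lebesgue_on {0..}) (\<lambda>x. f (- x))"
proof -
  have "integral\<^sup>L (lebesgue_on {..0}) f = (LINT x|lebesgue. indicator {..0::real} x *\<^sub>R f x)"
    by (subst integral_restrict_space) auto
  also have "\<dots> = \<bar>-1\<bar> *\<^sub>R (LINT x|lebesgue. indicator {..0::real} (0 + (-1) * x) *\<^sub>R f (0 + (-1) * x))"
    by (rule lebesgue_integral_real_affine) simp
  also have "\<dots> = integral\<^sup>L (lebesgue_on {0..}) (\<lambda>x. f (- x))"
    by (subst integral_restrict_space) (auto simp: indicator_def)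
  finally show ?thesis .
qed

lemma measurable_lebesgue_on_reflect:
  fixes f :: "real \<Rightarrow> complex"
  assumes f: "f \<in> borel_measurable (lebesgue_on S)" and S: "S \<in> sets lebesgue" and T: "T = uminus ` S"
    and T': "T \<in> sets lebesgue"
  shows "(\<lambda>x. f (- x)) \<in> borel_measurable (lebesgue_on T)"
proof -
  have "(\<lambda>x. indicator S x *\<^sub>R f x) \<in> borel_measurable lebesgue"
    using f S by (subst (asm) borel_measurable_restrict_space_iff) auto
  from borel_measurable_affine[OF this, of "-1" 0]
  have "(\<lambda>x. indicator S (- x) *\<^sub>R f (- x)) \<in> borel_measurable lebesgue" by simp
  also have "(\<lambda>x. indicator S (- x) *\<^sub>R f (- x)) = (\<lambda>x. indicator T x *\<^sub>R f (- x))"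
    unfolding T by (auto simp: indicator_def fun_eq_iff image_iff)
  finally show ?thesis using T' by (subst borel_measurable_restrict_space_iff) auto
qed

lemma uminus_atLeast_0: "uminus ` {0..} = {..0::real}" "uminus ` {..0} = {0::real..}"
  by (auto simp: image_iff)

text \<open>Differentiable maps of the line send negligible sets to negligible sets.\<close>

lemma AE_lebesgue_reflect:
  assumes "AE x::real in lebesgue. P x"
  shows "AE x in lebesgue. P (- x)"
proof -
  have n: "negligible {x. \<not> P x}"
    using assms unfolding negligible_iff_null_sets completion.AE_iff_null_sets by simp
  have "negligible (uminus ` {x. \<not> P x})"
    by (rule negligible_differentiable_image_negligible[OF order_refl n])
       (intro differentiable_on_minus differentiable_on_ident)
  also have "uminus ` {x. \<not> P x} = {x. \<not> P (- x)}"
    by (auto simp: image_iff) (metis add.inverse_inverse)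
  finally show ?thesis unfolding negligible_iff_null_sets completion.AE_iff_null_sets by simp
qed

lemma aeq_reflect: "aeq {..0} f g \<longleftrightarrow> aeq {0..} (\<lambda>x. f (- x)) (\<lambda>x. g (- x))"
proof -
  have "aeq {..0} f g \<longleftrightarrow> (AE x in lebesgue. x \<in> {..0} \<longrightarrow> f x = g x)"
    unfolding aeq_def by (subst AE_restrict_space_iff) auto
  also have "\<dots> \<longleftrightarrow> (AE x in lebesgue. x \<in> {0..} \<longrightarrow> f (- x) = g (- x))"
  proof
    assume "AE x in lebesgue. x \<in> {..0} \<longrightarrow> f x = g x"
    from AE_lebesgue_reflect[OF this] show "AE x in lebesgue. x \<in> {0..} \<longrightarrow> f (- x) = g (- x)" by simp
  next
    assume "AE x in lebesgue. x \<in> {0..} \<longrightarrow> f (- x) = g (- x)"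
    from AE_lebesgue_reflect[OF this] show "AE x in lebesgue. x \<in> {..0} \<longrightarrow> f x = g x" by simp
  qed
  also have "\<dots> \<longleftrightarrow> aeq {0..} (\<lambda>x. f (- x)) (\<lambda>x. g (- x))"
    unfolding aeq_def by (subst AE_restrict_space_iff) auto
  finally show ?thesis .
qed

lemma L2_reflect: "f \<in> L2 {..0} \<longleftrightarrow> (\<lambda>x. f (- x)) \<in> L2 {0..}"
proof -
  have "f \<in> borel_measurable (lebesgue_on {..0}) \<longleftrightarrow> (\<lambda>x. f (- x)) \<in> borel_measurable (lebesgue_on {0..})"
  proof
    assume "f \<in> borel_measurable (lebesgue_on {..0})"
    then show "(\<lambda>x. f (- x)) \<in> borel_measurable (lebesgue_on {0..})"
      by (rule measurable_lebesgue_on_reflect) (auto simp: uminus_atLeast_0)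
  next
    assume "(\<lambda>x. f (- x)) \<in> borel_measurable (lebesgue_on {0..})"
    then have "(\<lambda>x. f (- (- x))) \<in> borel_measurable (lebesgue_on {..0})"
      by (rule measurable_lebesgue_on_reflect) (auto simp: uminus_atLeast_0)
    then show "f \<in> borel_measurable (lebesgue_on {..0})" by simp
  qed
  then show ?thesis unfolding L2_def using integrable_lebesgue_on_reflect[of "\<lambda>x. (cmod (f x))\<^sup>2"] by simp
qed

lemma l2inner_reflect: "l2inner {..0} f g = l2inner {0..} (\<lambda>x. f (- x)) (\<lambda>x. g (- x))"
  unfolding l2inner_def by (rule integral_lebesgue_on_reflect)

lemma l2norm_reflect: "l2norm {..0} f = l2norm {0..} (\<lambda>x. f (- x))"
  unfolding l2norm_def by (subst integral_lebesgue_on_reflect) simp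

lemma set_integral_reflect_Icc:
  fixes f :: "real \<Rightarrow> complex"
  shows "set_integrable lborel {a..b} f \<longleftrightarrow> set_integrable lborel {-b..-a} (\<lambda>x. f (- x))"
    "(LBINT x:{a..b}. f x) = (LBINT x:{-b..-a}. f (- x))"
proof -
  have e: "(\<lambda>x. indicator {a..b} (0 + (-1) * x) *\<^sub>R f (0 + (-1) * x)) = (\<lambda>x. indicator {-b..-a} x *\<^sub>R f (- x))"
    by (auto simp: indicator_def fun_eq_iff)
  show "set_integrable lborel {a..b} f \<longleftrightarrow> set_integrable lborel {-b..-a} (\<lambda>x. f (- x))"
    unfolding set_integrable_def e[symmetric] by (rule lborel_integrable_real_affine_iff[symmetric]) simp
  have "(LBINT x. indicator {a..b} x *\<^sub>R f x) = \<bar>-1\<bar> *\<^sub>R (LBINT x. indicator {a..b} (0 + (-1) * x) *\<^sub>R f (0 + (-1) * x))"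
    by (rule lborel_integral_real_affine) simp
  then show "(LBINT x:{a..b}. f x) = (LBINT x:{-b..-a}. f (- x))"
    unfolding set_lebesgue_integral_def e by simp
qed

section \<open>Reflection of local absolute continuity and of operators\<close>

lemma ac_locD:
  assumes "ac_loc_with_deriv S w w1" "a \<in> S" "b \<in> S" "a \<le> b"
  shows "set_integrable lborel {a..b} w1 \<and> w b - w a = (LBINT x:{a..b}. w1 x)"
  using assms unfolding ac_loc_with_deriv_def by blast

lemma ac_reflect:
  "ac_loc_with_deriv {..0} w w1 \<longleftrightarrow> ac_loc_with_deriv {0..} (\<lambda>x. w (- x)) (\<lambda>x. - w1 (- x))"
proof -
  have pt: "(set_integrable lborel {-b..-a} w1 \<and> w (- a) - w (- b) = (LBINT x:{-b..-a}. w1 x)) \<longleftrightarrow>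
     (set_integrable lborel {a..b} (\<lambda>x. - w1 (- x)) \<and> w (- b) - w (- a) = (LBINT x:{a..b}. - w1 (- x)))" for a b
  proof -
    have i: "set_integrable lborel {-b..-a} w1 \<longleftrightarrow> set_integrable lborel {a..b} (\<lambda>x. w1 (- x))"
      "(LBINT x:{-b..-a}. w1 x) = (LBINT x:{a..b}. w1 (- x))"
      using set_integral_reflect_Icc[of "-b" "-a" w1] by auto
    have s: "set_integrable lborel {a..b} (\<lambda>x. - w1 (- x)) \<longleftrightarrow> set_integrable lborel {a..b} (\<lambda>x. w1 (- x))"
      using set_integrable_mult_right_iff[of "-1::complex" lborel "{a..b}" "\<lambda>x. w1 (- x)"] by simp
    have n: "(LBINT x:{a..b}. - w1 (- x)) = - (LBINT x:{a..b}. w1 (- x))"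
      using set_integral_mult_right[of lborel "{a..b}" "-1::complex" "\<lambda>x. w1 (- x)"] by simp
    show ?thesis unfolding i s n by (auto simp: algebra_simps eq_neg_iff_add_eq_0)
  qed
  show ?thesis
  proof
    assume l: "ac_loc_with_deriv {..0} w w1"
    show "ac_loc_with_deriv {0..} (\<lambda>x. w (- x)) (\<lambda>x. - w1 (- x))"
      unfolding ac_loc_with_deriv_def
    proof (intro ballI impI)
      fix a b :: real assume "a \<in> {0..}" "b \<in> {0..}" "a \<le> b"
      then have "set_integrable lborel {-b..-a} w1 \<and> w (- a) - w (- b) = (LBINT x:{-b..-a}. w1 x)"
        by (intro ac_locD[OF l]) auto
      then show "set_integrable lborel {a..b} (\<lambda>x. - w1 (- x)) \<and> w (- b) - w (- a) = (LBINT x:{a..b}. - w1 (- x))"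
        unfolding pt .
    qed
  next
    assume r: "ac_loc_with_deriv {0..} (\<lambda>x. w (- x)) (\<lambda>x. - w1 (- x))"
    show "ac_loc_with_deriv {..0} w w1"
      unfolding ac_loc_with_deriv_def
    proof (intro ballI impI)
      fix a b :: real assume ab: "a \<in> {..0}" "b \<in> {..0}" "a \<le> b"
      have "set_integrable lborel {-b..-a} (\<lambda>x. - w1 (- x)) \<and> w (- (- a)) - w (- (- b)) = (LBINT x:{-b..-a}. - w1 (- x))"
        by (rule ac_locD[OF r]) (use ab in auto)
      then show "set_integrable lborel {a..b} w1 \<and> w b - w a = (LBINT x:{a..b}. w1 x)"
        using pt[where a = "-b" and b = "-a"] by simp
    qed
  qed
qed

text \<open>An equivalence rather than an implication, so that each relation determines the other;
  equalities of operators on the positive half-line can then be pulled back.\<close>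

definition reflected :: "op \<Rightarrow> op \<Rightarrow> bool" where
  "reflected T T' \<longleftrightarrow> (\<forall>u f. (u, f) \<in> T \<longleftrightarrow> (\<lambda>x. u (- x), \<lambda>x. f (- x)) \<in> T')"

lemma reflectedD: "reflected T T' \<Longrightarrow> (u, f) \<in> T \<Longrightarrow> (\<lambda>x. u (- x), \<lambda>x. f (- x)) \<in> T'"
  by (simp add: reflected_def)

lemma reflectedD': "reflected T T' \<Longrightarrow> (u, f) \<in> T' \<Longrightarrow> (\<lambda>x. u (- x), \<lambda>x. f (- x)) \<in> T"
  by (simp add: reflected_def)

lemma reflectedI:
  assumes "\<And>u f. (u, f) \<in> T \<Longrightarrow> (\<lambda>x. u (- x), \<lambda>x. f (- x)) \<in> T'"
    and "\<And>u f. (u, f) \<in> T' \<Longrightarrow> (\<lambda>x. u (- x), \<lambda>x. f (- x)) \<in> T"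
  shows "reflected T T'"
  unfolding reflected_def
proof (intro allI iffI)
  fix u f assume "(\<lambda>x. u (- x), \<lambda>x. f (- x)) \<in> T'"
  from assms(2)[OF this] show "(u, f) \<in> T" by simp
qed (rule assms(1))

lemma reflected_unique: "reflected T T' \<Longrightarrow> reflected U T' \<Longrightarrow> T = U"
  unfolding reflected_def by auto

lemma Amax_reflect1:
  assumes "(u, f) \<in> Amax {..0} a q"
  shows "(\<lambda>x. u (- x), \<lambda>x. f (- x)) \<in> Amax {0..} a (\<lambda>x. q (- x))"
proof -
  obtain w w1 w2 where *: "u \<in> L2 {..0}" "f \<in> L2 {..0}" "ac_loc_with_deriv {..0} w w1" "ac_loc_with_deriv {..0} w1 w2"
    "aeq {..0} u w" "aeq {..0} f (\<lambda>x. - a * w2 x - q x * w x)"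
    using assms unfolding Amax_def by blast
  have "AC (\<lambda>x. w (- x)) (\<lambda>x. - w1 (- x))" using *(3) ac_reflect by blast
  moreover have "AC (\<lambda>x. - w1 (- x)) (\<lambda>x. w2 (- x))"
    using AC_scale[OF *(4)[unfolded ac_reflect[of w1]], of "-1"] by simp
  moreover have "aeq {0..} (\<lambda>x. u (- x)) (\<lambda>x. w (- x))" using *(5) unfolding aeq_reflect .
  moreover have "aeq {0..} (\<lambda>x. f (- x)) (\<lambda>x. - a * w2 (- x) - q (- x) * w (- x))" using *(6) unfolding aeq_reflect .
  ultimately show ?thesis unfolding Amax_def using *(1,2) unfolding L2_reflect by blast
qed

lemma Amax_reflect2:
  assumes "(u, f) \<in> Amax {0..} a (\<lambda>x. q (- x))"
  shows "(\<lambda>x. u (- x), \<lambda>x. f (- x)) \<in> Amax {..0} a q"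
proof -
  obtain w w1 w2 where *: "u \<in> L2 {0..}" "f \<in> L2 {0..}" "AC w w1" "AC w1 w2"
    "aeq {0..} u w" "aeq {0..} f (\<lambda>x. - a * w2 x - q (- x) * w x)"
    using assms unfolding Amax_def by blast
  have "ac_loc_with_deriv {..0} (\<lambda>x. w (- x)) (\<lambda>x. - w1 (- x))" unfolding ac_reflect using *(3) by simp
  moreover have "ac_loc_with_deriv {..0} (\<lambda>x. - w1 (- x)) (\<lambda>x. w2 (- x))"
    unfolding ac_reflect using AC_scale[OF *(4), of "-1"] by simp
  moreover have "aeq {..0} (\<lambda>x. u (- x)) (\<lambda>x. w (- x))" unfolding aeq_reflect using *(5) by simp
  moreover have "aeq {..0} (\<lambda>x. f (- x)) (\<lambda>x. - a * w2 (- x) - q x * w (- x))" unfolding aeq_reflect using *(6) by simp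
  moreover have "(\<lambda>x. u (- x)) \<in> L2 {..0}" "(\<lambda>x. f (- x)) \<in> L2 {..0}" unfolding L2_reflect using *(1,2) by simp_all
  ultimately show ?thesis unfolding Amax_def by blast
qed

lemma reflected_Amax: "reflected (Amax {..0} a q) (Amax {0..} a (\<lambda>x. q (- x)))"
  by (rule reflectedI[OF Amax_reflect1 Amax_reflect2])

lemma A0pre_reflect1:
  assumes "(u, f) \<in> A0pre {..0} a q"
  shows "(\<lambda>x. u (- x), \<lambda>x. f (- x)) \<in> A0pre {0..} a (\<lambda>x. q (- x))"
proof -
  obtain w w1 w2 B where *: "u \<in> L2 {..0}" "f \<in> L2 {..0}" "ac_loc_with_deriv {..0} w w1" "ac_loc_with_deriv {..0} w1 w2"
    "aeq {..0} u w" "aeq {..0} f (\<lambda>x. - a * w2 x - q x * w x)" "w 0 = 0" "w1 0 = 0" "bounded B" "\<forall>x\<in>{..0} - B. w x = 0"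
    using assms unfolding A0pre_def by blast
  show ?thesis
  proof (rule A0preI)
    show "(\<lambda>x. u (- x)) \<in> L2 {0..}" "(\<lambda>x. f (- x)) \<in> L2 {0..}" using *(1,2) unfolding L2_reflect .
    show "AC (\<lambda>x. w (- x)) (\<lambda>x. - w1 (- x))" using *(3) ac_reflect by blast
    show "AC (\<lambda>x. - w1 (- x)) (\<lambda>x. w2 (- x))"
      using AC_scale[OF *(4)[unfolded ac_reflect[of w1]], of "-1"] by simp
    show "bounded (uminus ` B)" using *(9) by simp
    show "w (- x) = 0" if "x \<in> {0..} - uminus ` B" for x
      using *(10) that by (force simp: image_iff)
    show "aeq {0..} (\<lambda>x. u (- x)) (\<lambda>x. w (- x))" using *(5) unfolding aeq_reflect .
    show "aeq {0..} (\<lambda>x. f (- x)) (\<lambda>x. - a * w2 (- x) - q (- x) * w (- x))" using *(6) unfolding aeq_reflect .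
  qed (use *(7,8) in auto)
qed

lemma A0pre_reflect2:
  assumes "(u, f) \<in> A0pre {0..} a (\<lambda>x. q (- x))"
  shows "(\<lambda>x. u (- x), \<lambda>x. f (- x)) \<in> A0pre {..0} a q"
proof -
  obtain w w1 w2 B where *: "u \<in> L2 {0..}" "f \<in> L2 {0..}" "AC w w1" "AC w1 w2"
    "aeq {0..} u w" "aeq {0..} f (\<lambda>x. - a * w2 x - q (- x) * w x)" "w 0 = 0" "w1 0 = 0" "bounded B" "\<forall>x\<in>{0..} - B. w x = 0"
    using assms unfolding A0pre_def by blast
  show ?thesis
  proof (rule A0preI)
    show "ac_loc_with_deriv {..0} (\<lambda>x. w (- x)) (\<lambda>x. - w1 (- x))" unfolding ac_reflect using *(3) by simp
    show "ac_loc_with_deriv {..0} (\<lambda>x. - w1 (- x)) (\<lambda>x. w2 (- x))"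
      unfolding ac_reflect using AC_scale[OF *(4), of "-1"] by simp
    show "aeq {..0} (\<lambda>x. u (- x)) (\<lambda>x. w (- x))" unfolding aeq_reflect using *(5) by simp
    show "aeq {..0} (\<lambda>x. f (- x)) (\<lambda>x. - a * w2 (- x) - q x * w (- x))" unfolding aeq_reflect using *(6) by simp
    show "(\<lambda>x. u (- x)) \<in> L2 {..0}" "(\<lambda>x. f (- x)) \<in> L2 {..0}" unfolding L2_reflect using *(1,2) by simp_all
    show "bounded (uminus ` B)" using *(9) by simp
    show "w (- x) = 0" if "x \<in> {..0} - uminus ` B" for x
      using *(10) that by (force simp: image_iff)
  qed (use *(7,8) in auto)
qed

lemma reflected_opclosure:
  assumes "reflected T T'" shows "reflected (opclosure {..0} T) (opclosure {0..} T')"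
proof (rule reflectedI)
  fix u f assume "(u, f) \<in> opclosure {..0} T"
  then obtain U F where *: "u \<in> L2 {..0}" "f \<in> L2 {..0}" "\<And>n. (U n, F n) \<in> T"
    "(\<lambda>n. l2norm {..0} (\<lambda>x. U n x - u x)) \<longlonglongrightarrow> 0" "(\<lambda>n. l2norm {..0} (\<lambda>x. F n x - f x)) \<longlonglongrightarrow> 0"
    unfolding opclosure_def by blast
  then show "(\<lambda>x. u (- x), \<lambda>x. f (- x)) \<in> opclosure {0..} T'"
    using reflectedD[OF assms *(3)] unfolding L2_reflect l2norm_reflect
    by (intro opclosureI[where U = "\<lambda>n x. U n (- x)" and F = "\<lambda>n x. F n (- x)"])
next
  fix u f assume "(u, f) \<in> opclosure {0..} T'"
  then obtain U F where *: "u \<in> L2 {0..}" "f \<in> L2 {0..}" "\<And>n. (U n, F n) \<in> T'"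
    "(\<lambda>n. l2norm {0..} (\<lambda>x. U n x - u x)) \<longlonglongrightarrow> 0" "(\<lambda>n. l2norm {0..} (\<lambda>x. F n x - f x)) \<longlonglongrightarrow> 0"
    unfolding opclosure_def by blast
  then show "(\<lambda>x. u (- x), \<lambda>x. f (- x)) \<in> opclosure {..0} T"
    using reflectedD'[OF assms *(3)]
    by (intro opclosureI[where U = "\<lambda>n x. U n (- x)" and F = "\<lambda>n x. F n (- x)"]) (simp_all add: L2_reflect l2norm_reflect)
qed

lemma reflected_A0: "reflected (A0 {..0} a q) (A0 {0..} a (\<lambda>x. q (- x)))"
  unfolding A0_def by (rule reflected_opclosure[OF reflectedI[OF A0pre_reflect1 A0pre_reflect2]])

lemma reflected_adjoint:
  assumes "reflected T T'" shows "reflected (adjoint {..0} T) (adjoint {0..} T')"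
proof (rule reflectedI)
  fix v g assume *: "(v, g) \<in> adjoint {..0} T"
  have "l2inner {0..} f (\<lambda>x. v (- x)) = l2inner {0..} u (\<lambda>x. g (- x))" if "(u, f) \<in> T'" for u f
    using * reflectedD'[OF assms that] unfolding adjoint_def by (force simp: l2inner_reflect)
  then show "(\<lambda>x. v (- x), \<lambda>x. g (- x)) \<in> adjoint {0..} T'"
    using * unfolding adjoint_def by (auto simp: L2_reflect)
next
  fix v g assume *: "(v, g) \<in> adjoint {0..} T'"
  have "l2inner {..0} f (\<lambda>x. v (- x)) = l2inner {..0} u (\<lambda>x. g (- x))" if "(u, f) \<in> T" for u f
    using * reflectedD[OF assms that] unfolding adjoint_def by (force simp: l2inner_reflect)
  then show "(\<lambda>x. v (- x), \<lambda>x. g (- x)) \<in> adjoint {..0} T"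
    using * unfolding adjoint_def by (auto simp: L2_reflect)
qed

lemma regtype_reflect:
  assumes "reflected T T'" shows "regtype {..0} T = regtype {0..} T'"
proof -
  have "(\<forall>(u, f)\<in>T. k * l2norm {..0} u \<le> l2norm {..0} (\<lambda>x. f x - z * u x))
     \<longleftrightarrow> (\<forall>(u, f)\<in>T'. k * l2norm {0..} u \<le> l2norm {0..} (\<lambda>x. f x - z * u x))" for k z
  proof (intro iffI ballI; clarify)
    fix u f assume "\<forall>(u, f)\<in>T. k * l2norm {..0} u \<le> l2norm {..0} (\<lambda>x. f x - z * u x)" "(u, f) \<in> T'"
    then show "k * l2norm {0..} u \<le> l2norm {0..} (\<lambda>x. f x - z * u x)"
      using reflectedD'[OF assms, of u f] by (force simp: l2norm_reflect)
  next
    fix u f assume "\<forall>(u, f)\<in>T'. k * l2norm {0..} u \<le> l2norm {0..} (\<lambda>x. f x - z * u x)" "(u, f) \<in> T"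
    then show "k * l2norm {..0} u \<le> l2norm {..0} (\<lambda>x. f x - z * u x)"
      using reflectedD[OF assms, of u f] by (force simp: l2norm_reflect)
  qed
  then show ?thesis unfolding regtype_def by simp
qed

lemma quotdim_reflect:
  assumes L: "\<And>h. (\<lambda>x. h (- x)) \<in> L \<longleftrightarrow> h \<in> L'" and V: "\<And>h. (\<lambda>x. h (- x)) \<in> V \<longleftrightarrow> h \<in> V'"
    and "quotdim L' V' n"
  shows "quotdim L V n"
proof -
  obtain g :: "nat \<Rightarrow> real \<Rightarrow> complex" where g: "\<And>i. i < n \<Longrightarrow> g i \<in> L'"
    and ind: "\<And>c :: nat \<Rightarrow> complex. (\<lambda>x. \<Sum>i<n. c i * g i x) \<in> V' \<Longrightarrow> \<forall>i<n. c i = 0"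
    and span: "\<And>h. h \<in> L' \<Longrightarrow> \<exists>c :: nat \<Rightarrow> complex. (\<lambda>x. h x - (\<Sum>i<n. c i * g i x)) \<in> V'"
    using assms(3) unfolding quotdim_def by blast
  show ?thesis unfolding quotdim_def
  proof (intro exI[of _ "\<lambda>i x. g i (- x)"] conjI allI impI ballI)
    show "(\<lambda>x. g i (- x)) \<in> L" if "i < n" for i using g[OF that] L by simp
    show "c i = 0" if "(\<lambda>x. \<Sum>i<n. c i * g i (- x)) \<in> V" "i < n" for c :: "nat \<Rightarrow> complex" and i
      using ind[of c] V[of "\<lambda>x. \<Sum>i<n. c i * g i x"] that by blast
    fix h assume "h \<in> L"
    then have "(\<lambda>x. h (- x)) \<in> L'" using L[of "\<lambda>x. h (- x)"] by simp
    from span[OF this] obtain c :: "nat \<Rightarrow> complex" where "(\<lambda>x. h (- x) - (\<Sum>i<n. c i * g i x)) \<in> V'" by blast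
    then have "(\<lambda>x. h x - (\<Sum>i<n. c i * g i (- x))) \<in> V"
      using V[of "\<lambda>x. h (- x) - (\<Sum>i<n. c i * g i x)"] by simp
    then show "\<exists>c :: nat \<Rightarrow> complex. (\<lambda>x. h x - (\<Sum>i<n. c i * g i (- x))) \<in> V" by blast
  qed
qed

lemma opdom_reflect:
  assumes "reflected T T'" shows "(\<lambda>x. h (- x)) \<in> opdom T \<longleftrightarrow> h \<in> opdom T'"
  using reflectedD[OF assms, of "\<lambda>x. h (- x)"] reflectedD'[OF assms, of h] unfolding opdom_def by force

lemma opran_opshift_reflect:
  assumes "reflected T T'" shows "(\<lambda>x. h (- x)) \<in> opran (opshift T z) \<longleftrightarrow> h \<in> opran (opshift T' z)"
proof -
  have mem: "h \<in> opran (opshift T z) \<longleftrightarrow> (\<exists>u f. (u, f) \<in> T \<and> h = (\<lambda>x. f x - z * u x))" for h T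
    unfolding opran_def opshift_def by force
  show ?thesis
  proof
    assume "(\<lambda>x. h (- x)) \<in> opran (opshift T z)"
    then obtain u f where uf: "(u, f) \<in> T" "(\<lambda>x. h (- x)) = (\<lambda>x. f x - z * u x)" unfolding mem by blast
    have "h = (\<lambda>x. f (- x) - z * u (- x))"
    proof
      show "h x = f (- x) - z * u (- x)" for x using fun_cong[OF uf(2), of "- x"] by simp
    qed
    then show "h \<in> opran (opshift T' z)" unfolding mem using reflectedD[OF assms uf(1)] by blast
  next
    assume "h \<in> opran (opshift T' z)"
    then obtain u f where uf: "(u, f) \<in> T'" "h = (\<lambda>x. f x - z * u x)" unfolding mem by blast
    then have "(\<lambda>x. h (- x)) = (\<lambda>x. f (- x) - z * u (- x))" by simp
    then show "(\<lambda>x. h (- x)) \<in> opran (opshift T z)" unfolding mem using reflectedD'[OF assms uf(1)] by blast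
  qed
qed

lemma reflected_conjop: "reflected T T' \<Longrightarrow> reflected (conjop T) (conjop T')"
  by (rule reflectedI; clarsimp simp: conjop_def; drule (1) reflectedD reflectedD'; force)

subsection \<open>Sectors\<close>

text \<open>Multiplication by the conjugate of \<open>a + b\<close> rotates the bisector of two unit
  vectors onto the positive axis, so both acquire the same real part, positive unless they are
  opposite.\<close>

lemma Re_cnj_sum_unit:
  assumes "cmod a = 1" "cmod b = 1"
  shows "Re (cnj (a + b) * a) = (cmod (a + b))\<^sup>2 / 2"
proof -
  have "(Re a)\<^sup>2 + (Im a)\<^sup>2 = 1" "(Re b)\<^sup>2 + (Im b)\<^sup>2 = 1"
    using assms cmod_power2[of a] cmod_power2[of b] by simp_all
  then show ?thesis unfolding cmod_power2 by (simp add: power2_eq_square algebra_simps)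
qed

text \<open>Intermediate form of the sector: generators match the definition of \<open>Qset\<close>
  and let linear functionals be tested on two vectors, while the polar form is derived only for the
  final statement.\<close>

definition cone2 :: "complex \<Rightarrow> complex \<Rightarrow> complex set" where
  "cone2 a b = {a * of_real r + b * of_real t | r t. 0 \<le> r \<and> 0 \<le> t}"

lemma cone2I: "0 \<le> r \<Longrightarrow> 0 \<le> t \<Longrightarrow> a * of_real r + b * of_real t \<in> cone2 a b"
  unfolding cone2_def by blast

lemma cone2_commute: "cone2 a b = cone2 b a"
  unfolding cone2_def by (auto, metis add.commute, metis add.commute)

lemma convex_cone2: "convex (cone2 a b)"
  unfolding convex_def
proof (intro ballI allI impI)
  fix x y :: complex and u v :: real
  assume "x \<in> cone2 a b" "y \<in> cone2 a b" and uv: "0 \<le> u" "0 \<le> v" "u + v = 1"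
  then obtain r t r' t' where *: "x = a * of_real r + b * of_real t" "0 \<le> r" "0 \<le> t" "y = a * of_real r' + b * of_real t'" "0 \<le> r'" "0 \<le> t'"
    unfolding cone2_def by blast
  have "u *\<^sub>R x + v *\<^sub>R y = a * of_real (u * r + v * r') + b * of_real (u * t + v * t')"
    unfolding * by (simp add: scaleR_conv_of_real algebra_simps)
  also have "\<dots> \<in> cone2 a b" using * uv by (intro cone2I) auto
  finally show "u *\<^sub>R x + v *\<^sub>R y \<in> cone2 a b" .
qed

text \<open>The cone is cut out by closed inequalities. For independent generators the coefficients
  are continuous in \<open>z\<close> by Cramer's rule; dependent unit vectors that are not opposite
  are equal, and the cone is a ray. Opposite vectors would span a line.\<close>

lemma closed_cone2:
  assumes a: "cmod a = 1" and b: "cmod b = 1" and ab: "a + b \<noteq> 0"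
  shows "closed (cone2 a b)"
proof -
  have a1: "(Re a)\<^sup>2 + (Im a)\<^sup>2 = 1" and b1: "(Re b)\<^sup>2 + (Im b)\<^sup>2 = 1"
    using a b cmod_power2[of a] cmod_power2[of b] by simp_all
  define D where "D = Im (cnj a * b)"
  show ?thesis
  proof (cases "D = 0")
    case True
    have "b = a"
    proof -
      define e where "e = cnj a * b"
      have "a * e = of_real ((cmod a)\<^sup>2) * b" unfolding e_def complex_norm_square by simp
      then have ae: "a * e = b" using a by simp
      have "cmod e = 1" unfolding e_def using a b by (simp add: norm_mult)
      moreover have "Im e = 0" using True by (simp add: D_def e_def)
      ultimately have "\<bar>Re e\<bar> = 1" by (simp add: cmod_def)
      then have "e = 1 \<or> e = -1" using \<open>Im e = 0\<close> by (auto simp: complex_eq_iff abs_if split: if_splits)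
      then show ?thesis using ae ab by auto
    qed
    have eq: "cone2 a b = {z. Im (cnj a * z) = 0 \<and> 0 \<le> Re (cnj a * z)}"
    proof (intro equalityI subsetI)
      fix z assume "z \<in> cone2 a b"
      then obtain r t where z: "z = a * of_real r + b * of_real t" "0 \<le> r" "0 \<le> t" unfolding cone2_def by blast
      have "cnj a * z = of_real ((cmod a)\<^sup>2) * of_real (r + t)"
        unfolding z(1) \<open>b = a\<close> complex_norm_square by (simp add: algebra_simps)
      then have "cnj a * z = of_real (r + t)" using a by simp
      then show "z \<in> {z. Im (cnj a * z) = 0 \<and> 0 \<le> Re (cnj a * z)}"
        using z by (simp only: mem_Collect_eq Im_complex_of_real Re_complex_of_real) simp
    next
      fix z assume "z \<in> {z. Im (cnj a * z) = 0 \<and> 0 \<le> Re (cnj a * z)}"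
      then have z: "Im (cnj a * z) = 0" "0 \<le> Re (cnj a * z)" by blast+
      have "z = of_real ((cmod a)\<^sup>2) * z" using a by simp
      also have "\<dots> = a * (cnj a * z)" unfolding complex_norm_square by simp
      also have "cnj a * z = of_real (Re (cnj a * z))" using z(1) by (simp only: complex_eq_iff Re_complex_of_real Im_complex_of_real)
      finally have "z = a * of_real (Re (cnj a * z)) + b * of_real 0" by simp
      then show "z \<in> cone2 a b" using z(2) cone2I[of "Re (cnj a * z)" 0 a b] by simp
    qed
    show ?thesis unfolding eq by (intro closed_Collect_conj closed_Collect_eq closed_Collect_le continuous_intros)
  next
    case False
    have cramer: "z * of_real D = a * of_real (- Im (cnj b * z)) + b * of_real (Im (cnj a * z))" for z
      unfolding D_def by (simp add: complex_eq_iff algebra_simps)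
    have eq: "cone2 a b = {z. 0 \<le> - Im (cnj b * z) / D \<and> 0 \<le> Im (cnj a * z) / D}"
    proof (intro equalityI subsetI)
      fix z assume "z \<in> cone2 a b"
      then obtain r t where z: "z = a * of_real r + b * of_real t" "0 \<le> r" "0 \<le> t" unfolding cone2_def by blast
      have e: "Im (cnj b * z) = - D * r" "Im (cnj a * z) = D * t"
        unfolding z(1) D_def by (simp_all add: algebra_simps)
      show "z \<in> {z. 0 \<le> - Im (cnj b * z) / D \<and> 0 \<le> Im (cnj a * z) / D}"
        unfolding mem_Collect_eq e using z False by simp
    next
      fix z assume "z \<in> {z. 0 \<le> - Im (cnj b * z) / D \<and> 0 \<le> Im (cnj a * z) / D}"
      then have z: "0 \<le> - Im (cnj b * z) / D" "0 \<le> Im (cnj a * z) / D" by blast+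
      have "z = (z * of_real D) / of_real D" using False by simp
      also have "\<dots> = a * of_real (- Im (cnj b * z) / D) + b * of_real (Im (cnj a * z) / D)"
        unfolding cramer by (simp add: add_divide_distrib)
      finally show "z \<in> cone2 a b" using cone2I[OF z, of a b] by simp
    qed
    show ?thesis unfolding eq divide_inverse
      by (intro closed_Collect_conj closed_Collect_le continuous_intros)
  qed
qed

text \<open>The coefficient \<open>r\<close> is strictly positive in the generating set; adding
  \<open>1 / (n + 1)\<close> to it approximates the points of the cone with
  \<open>r = 0\<close>.\<close>

lemma closure_hull_cone2:
  assumes "cmod a = 1" "cmod b = 1" "a + b \<noteq> 0"
  shows "closure (convex hull {a * of_real r + b * of_real t | r t. 0 < r \<and> 0 \<le> t}) = cone2 a b" (is "closure (convex hull ?G) = _")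
proof
  have "?G \<subseteq> cone2 a b" unfolding cone2_def using less_imp_le by blast
  then have "convex hull ?G \<subseteq> cone2 a b" by (intro hull_minimal convex_cone2)
  then show "closure (convex hull ?G) \<subseteq> cone2 a b" by (rule closure_minimal[OF _ closed_cone2[OF assms]])
  show "cone2 a b \<subseteq> closure (convex hull ?G)"
  proof
    fix z assume "z \<in> cone2 a b"
    then obtain r t where z: "z = a * of_real r + b * of_real t" "0 \<le> r" "0 \<le> t" unfolding cone2_def by blast
    have "a * of_real (r + inverse (real (Suc n))) + b * of_real t \<in> ?G" for n
      using z(2,3) by (intro CollectI exI[of _ "r + inverse (real (Suc n))"] exI[of _ t]) (auto intro: add_nonneg_pos)
    then have mem: "\<forall>n. a * of_real (r + inverse (real (Suc n))) + b * of_real t \<in> convex hull ?G"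
      using hull_subset[of ?G convex] by blast
    have "(\<lambda>n. a * of_real (r + inverse (real (Suc n))) + b * of_real t) \<longlonglongrightarrow> a * of_real (r + 0) + b * of_real t"
      by (intro tendsto_intros LIMSEQ_inverse_real_of_nat)
    then show "z \<in> closure (convex hull ?G)" unfolding closure_sequential using mem z(1) by auto
  qed
qed

text \<open>Both inclusions rest on the sine being nonnegative on \<open>[0, \<pi>]\<close>: one
  writes a ray as a combination of the edges, the other locates the argument of such a
  combination.\<close>

lemma sector_cone2_nonneg:
  assumes p: "0 \<le> \<psi>" "\<psi> < pi"
  shows "cone2 (exp (\<i> * of_real \<theta>)) (exp (\<i> * of_real (\<theta> + \<psi>)))
    = {of_real t * exp (\<i> * of_real \<eta>) | t \<eta>. 0 \<le> t \<and> \<theta> \<le> \<eta> \<and> \<eta> \<le> \<theta> + \<psi>}" (is "cone2 ?a ?b = ?S")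
proof (intro equalityI subsetI)
  fix z assume "z \<in> ?S"
  then obtain t \<eta> where z: "z = of_real t * exp (\<i> * of_real \<eta>)" "0 \<le> t" "\<theta> \<le> \<eta>" "\<eta> \<le> \<theta> + \<psi>" by blast
  show "z \<in> cone2 ?a ?b"
  proof (cases "\<psi> = 0")
    case True
    then show ?thesis using z cone2I[of t 0 ?a ?b] by (simp add: mult.commute)
  next
    case False
    then have sp: "sin \<psi> > 0" using p by (intro sin_gt_zero) auto
    define \<xi> where "\<xi> = \<eta> - \<theta>"
    have \<xi>: "0 \<le> \<xi>" "\<xi> \<le> \<psi>" using z by (auto simp: \<xi>_def)
    \<comment> \<open>Law of sines for the ray at angle \<xi> between the edges at 0 and \<psi>;
      both coefficients are nonnegative as
      \<open>0 \<le> \<xi> \<le> \<psi> < \<pi>\<close>.\<close>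
    have key: "of_real (sin \<psi>) * exp (\<i> * of_real \<xi>) = of_real (sin (\<psi> - \<xi>)) + of_real (sin \<xi>) * exp (\<i> * of_real \<psi>)"
      by (simp add: complex_eq_iff Re_exp Im_exp sin_diff)
    have "of_real (sin \<psi>) * exp (\<i> * of_real \<eta>) = exp (\<i> * of_real \<theta>) * (of_real (sin \<psi>) * exp (\<i> * of_real \<xi>))"
      by (simp add: \<xi>_def exp_diff algebra_simps)
    also have "\<dots> = ?a * of_real (sin (\<psi> - \<xi>)) + ?b * of_real (sin \<xi>)"
      unfolding key by (simp add: algebra_simps exp_add)
    finally have e: "of_real (sin \<psi>) * exp (\<i> * of_real \<eta>) = ?a * of_real (sin (\<psi> - \<xi>)) + ?b * of_real (sin \<xi>)" .
    have "z = of_real (t / sin \<psi>) * (of_real (sin \<psi>) * exp (\<i> * of_real \<eta>))" using sp unfolding z(1) by simp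
    also have "\<dots> = ?a * of_real (t / sin \<psi> * sin (\<psi> - \<xi>)) + ?b * of_real (t / sin \<psi> * sin \<xi>)"
      unfolding e of_real_mult by (simp only: distrib_left mult.left_commute)
    also have "\<dots> \<in> cone2 ?a ?b"
      using z(2) sp \<xi> p by (intro cone2I mult_nonneg_nonneg divide_nonneg_pos sin_ge_zero) auto
    finally show ?thesis .
  qed
next
  fix z assume "z \<in> cone2 ?a ?b"
  then obtain r t where z: "z = ?a * of_real r + ?b * of_real t" "0 \<le> r" "0 \<le> t" unfolding cone2_def by blast
  define v where "v = of_real r + of_real t * exp (\<i> * of_real \<psi>)"
  have zv: "z = ?a * v" unfolding z(1) v_def by (simp add: algebra_simps exp_add)
  have "\<exists>\<rho> \<xi>. v = of_real \<rho> * exp (\<i> * of_real \<xi>) \<and> 0 \<le> \<rho> \<and> 0 \<le> \<xi> \<and> \<xi> \<le> \<psi>"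
  proof (cases "\<psi> = 0 \<or> v = 0")
    case True
    then show ?thesis
    proof
      assume "\<psi> = 0"
      then have "v = of_real (r + t) * exp (\<i> * of_real 0)" by (simp add: v_def)
      then show ?thesis using z(2,3) p(1) by (intro exI[of _ "r + t"] exI[of _ 0]) simp
    next
      assume "v = 0"
      then show ?thesis using p(1) by (intro exI[of _ 0]) auto
    qed
  next
    case False
    then have sp: "sin \<psi> > 0" using p by (intro sin_gt_zero) auto
    have v: "v = of_real (cmod v) * exp (\<i> * of_real (Arg v))" using False Arg_eq[of v] by simp
    have Im: "cmod v * sin (Arg v) = t * sin \<psi>"
    proof -
      have "Im v = t * sin \<psi>" by (simp add: v_def Im_exp)
      moreover have "Im v = cmod v * sin (Arg v)" by (subst v) (simp add: Im_exp)
      ultimately show ?thesis by simp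
    qed
    have Re: "cmod v * cos (Arg v) = r + t * cos \<psi>"
    proof -
      have "Re v = r + t * cos \<psi>" by (simp add: v_def Re_exp)
      moreover have "Re v = cmod v * cos (Arg v)" by (subst v) (simp add: Re_exp)
      ultimately show ?thesis by simp
    qed
    have vp: "cmod v > 0" using False by simp
    note bd = mpi_less_Arg[of v] Arg_le_pi[of v]
    have A0: "0 \<le> Arg v"
    proof (rule ccontr)
      assume "\<not> 0 \<le> Arg v"
      then have "sin (Arg v) < 0" using bd sin_gt_zero[of "- Arg v"] by simp
      then have "cmod v * sin (Arg v) < 0" using vp by (simp add: mult_pos_neg)
      moreover have "0 \<le> t * sin \<psi>" using z(3) sp by simp
      ultimately show False using Im by linarith
    qed
    \<comment> \<open>Beyond the second edge the sine of \<open>Arg v - \<psi>\<close> would be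
      positive, but measured from that edge the component of \<open>v\<close> is
      \<open>- r * sin \<psi>\<close>, which is not positive.\<close>
    have "Arg v \<le> \<psi>"
    proof (rule ccontr)
      assume n: "\<not> Arg v \<le> \<psi>"
      have "\<psi> \<noteq> 0" using False by simp
      then have "sin (Arg v - \<psi>) > 0" using n bd p by (intro sin_gt_zero) auto
      then have "0 < cmod v * sin (Arg v - \<psi>)" using vp by simp
      also have "cmod v * sin (Arg v - \<psi>) = (cmod v * sin (Arg v)) * cos \<psi> - (cmod v * cos (Arg v)) * sin \<psi>"
        by (simp add: sin_diff algebra_simps)
      also have "\<dots> = - r * sin \<psi>" unfolding Im Re by (simp add: algebra_simps)
      finally show False using z(2) sp by (simp add: mult_less_0_iff)
    qed
    then show ?thesis using v A0 by (intro exI[of _ "cmod v"] exI[of _ "Arg v"]) auto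
  qed
  then obtain \<rho> \<xi> where v: "v = of_real \<rho> * exp (\<i> * of_real \<xi>)" "0 \<le> \<rho>" "0 \<le> \<xi>" "\<xi> \<le> \<psi>" by blast
  have "z = of_real \<rho> * exp (\<i> * of_real (\<theta> + \<xi>))" unfolding zv v(1) by (simp add: algebra_simps exp_add)
  then show "z \<in> ?S" using v by (intro CollectI exI[of _ \<rho>] exI[of _ "\<theta> + \<xi>"]) auto
qed

text \<open>The sign of the relative argument \<psi> decides which generator comes first
  counterclockwise, and \<open>a + b \<noteq> 0\<close> excludes
  \<open>\<psi> = \<pi>\<close>.\<close>

lemma closed_sector_cone2:
  assumes a: "cmod a = 1" and b: "cmod b = 1" and ab: "a + b \<noteq> 0"
  shows "closed_sector_lt_pi (cone2 a b)"
proof -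
  define \<theta> where "\<theta> = Arg a"
  define \<psi> where "\<psi> = Arg (b / a)"
  have a0: "a \<noteq> 0" "b \<noteq> 0" using a b by auto
  have ae: "a = exp (\<i> * of_real \<theta>)" using Arg_eq[of a] a a0 by (simp add: \<theta>_def)
  have "b / a = exp (\<i> * of_real \<psi>)" using Arg_eq[of "b / a"] a b a0 by (simp add: \<psi>_def norm_divide)
  then have be0: "b = a * exp (\<i> * of_real \<psi>)" using a0 by (simp add: field_simps)
  then have be: "b = exp (\<i> * of_real (\<theta> + \<psi>))" unfolding ae by (simp add: exp_add algebra_simps)
  have "\<psi> \<noteq> pi"
  proof
    assume "\<psi> = pi"
    then have "b = - a" using be0 by (simp add: exp_pi_i')
    then show False using ab by simp
  qed
  then have bd: "- pi < \<psi>" "\<psi> < pi" using mpi_less_Arg[of "b / a"] Arg_le_pi[of "b / a"] by (auto simp: \<psi>_def)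
  show ?thesis
  proof (cases "0 \<le> \<psi>")
    case True
    show ?thesis unfolding closed_sector_lt_pi_def
      by (intro exI[of _ \<theta>] exI[of _ "\<theta> + \<psi>"] conjI)
         (use True bd sector_cone2_nonneg[OF True bd(2), of \<theta>, folded ae be] in auto)
  next
    case False
    have p: "0 \<le> - \<psi>" "- \<psi> < pi" using False bd by auto
    have ae': "a = exp (\<i> * of_real ((\<theta> + \<psi>) + - \<psi>))" using ae by simp
    have "cone2 b a = {of_real t * exp (\<i> * of_real \<eta>) | t \<eta>. 0 \<le> t \<and> \<theta> + \<psi> \<le> \<eta> \<and> \<eta> \<le> (\<theta> + \<psi>) + - \<psi>}"
      using sector_cone2_nonneg[OF p, of "\<theta> + \<psi>", folded ae' be] .
    then show ?thesis unfolding closed_sector_lt_pi_def cone2_commute[of a b]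
      by (intro exI[of _ "\<theta> + \<psi>"] exI[of _ "(\<theta> + \<psi>) + - \<psi>"] conjI) (use p in auto)
  qed
qed

text \<open>A hyperplane that separates a point from a cone can be moved to the vertex: invariance
  under scaling turns a lower bound on the cone into nonnegativity.\<close>

lemma cone2_separation:
  assumes "cmod a = 1" "cmod b = 1" "a + b \<noteq> 0" "z \<notin> cone2 a b"
  shows "\<exists>c. 0 \<le> Re (c * a) \<and> 0 \<le> Re (c * b) \<and> Re (c * z) < 0"
proof -
  obtain d B where dB: "inner d z < B" "\<And>x. x \<in> cone2 a b \<Longrightarrow> inner d x > B"
    using separating_hyperplane_closed_point[OF convex_cone2 closed_cone2[OF assms(1-3)] assms(4)] by blast
  have in_eq: "inner d x = Re (cnj d * x)" for x by (simp add: inner_complex_def)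
  have scale: "inner d (x * of_real t) = t * inner d x" for x t
    by (simp add: inner_complex_def algebra_simps)
  have B0: "B < 0" using dB(2)[of 0] cone2I[of 0 0 a b] by simp
  have nn: "0 \<le> inner d x" if x: "\<And>t. 0 \<le> t \<Longrightarrow> x * of_real t \<in> cone2 a b" for x
  proof (rule ccontr)
    assume n: "\<not> 0 \<le> inner d x"
    \<comment> \<open>Both \<open>B\<close> and \<open>inner d x\<close> are negative, so the
      scaling factor is positive, and the scaled point attains the value \<open>B\<close> that the
      cone must strictly exceed.\<close>
    have "B < inner d (x * of_real (B / inner d x))" using n B0 by (intro dB(2) x) (auto intro: divide_nonpos_neg)
    also have "\<dots> = B / inner d x * inner d x" by (rule scale)
    also have "\<dots> = B" using n by simp
    finally show False by simp
  qed
  have "0 \<le> inner d a" using cone2I[of _ 0 a b] by (intro nn) simp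
  moreover have "0 \<le> inner d b" using cone2I[of 0 _ a b] by (intro nn) simp
  moreover have "inner d z < 0" using dB(1) B0 by simp
  ultimately show ?thesis unfolding in_eq by (intro exI[of _ "cnj d"]) blast
qed

subsection \<open>The operators of the theorem\<close>

lemma halfline_m1: "halfline (- 1) = {..0}"
  by (auto simp: halfline_def)

lemma halfline_cases:
  assumes "s = 1 \<or> s = -1"
  obtains "s = 1" "halfline s = {0..}" | "s = -1" "halfline s = {..0}"
  using assms halfline_1 halfline_m1 by blast

lemma regtype_halfline:
  assumes "s = 1 \<or> s = -1"
  shows "regtype (halfline s) (A0 (halfline s) a q) = regtype {0..} (A0 {0..} a (\<lambda>x. q (s * x)))"
  using assms
proof (cases rule: halfline_cases)
  case 1
  then show ?thesis by simp
next
  case 2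
  then show ?thesis using regtype_reflect[OF reflected_A0[of a q]] by simp
qed

text \<open>Both half-lines are served by the coefficient \<open>q (s * x)\<close> on
  \<open>{0..}\<close>; for \<open>s = -1\<close> the equalities are pulled back because a relation
  is determined by its reflection.\<close>

lemma halfline_adjoints:
  assumes s: "s = 1 \<or> s = -1" and op: "halfline_operator a (\<lambda>x. q (s * x)) c"
  shows "adjoint (halfline s) (Amax (halfline s) a q) = A0 (halfline s) (cnj a) (\<lambda>x. cnj (q x))
    \<and> adjoint (halfline s) (A0 (halfline s) a q) = Amax (halfline s) (cnj a) (\<lambda>x. cnj (q x))
    \<and> conjop (A0 (halfline s) a q) \<subseteq> adjoint (halfline s) (A0 (halfline s) a q)"
proof -
  interpret halfline_operator a "\<lambda>x. q (s * x)" c by (rule op)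
  interpret cj: halfline_operator "cnj a" "\<lambda>x. cnj (q (s * x))" "cnj c" by (rule conj)
  have pos1: "adjoint {0..} (Amax {0..} a (\<lambda>x. q (s * x))) = A0 {0..} (cnj a) (\<lambda>x. cnj (q (s * x)))"
    using cj.adjoint_Amax by simp
  have pos2: "adjoint {0..} (A0 {0..} a (\<lambda>x. q (s * x))) = Amax {0..} (cnj a) (\<lambda>x. cnj (q (s * x)))"
    by (rule adjoint_A0[OF q a0])
  note pos3 = conjop_A0_subset_adjoint
  show ?thesis using s
  proof (cases rule: halfline_cases)
    case 1
    then show ?thesis using pos1 pos2 pos3 by simp
  next
    case 2
    let ?q = "\<lambda>x. q (- x)"
    have q': "(\<lambda>x. q (s * x)) = ?q" "(\<lambda>x. cnj (q (s * x))) = (\<lambda>x. cnj (q (- x)))" using 2 by simp_all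
    have neg1: "adjoint {..0} (Amax {..0} a q) = A0 {..0} (cnj a) (\<lambda>x. cnj (q x))"
      by (rule reflected_unique[OF reflected_adjoint[OF reflected_Amax]])
         (unfold pos1[unfolded q'], rule reflected_A0)
    have neg2: "adjoint {..0} (A0 {..0} a q) = Amax {..0} (cnj a) (\<lambda>x. cnj (q x))"
      by (rule reflected_unique[OF reflected_adjoint[OF reflected_A0]])
         (unfold pos2[unfolded q'], rule reflected_Amax)
    have "conjop (A0 {..0} a q) \<subseteq> adjoint {..0} (A0 {..0} a q)"
    proof clarify
      fix u f assume "(u, f) \<in> conjop (A0 {..0} a q)"
      then have "(\<lambda>x. u (- x), \<lambda>x. f (- x)) \<in> conjop (A0 {0..} a ?q)"
        by (rule reflectedD[OF reflected_conjop[OF reflected_A0]])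
      then have "(\<lambda>x. u (- x), \<lambda>x. f (- x)) \<in> adjoint {0..} (A0 {0..} a ?q)" using pos3 unfolding q' by blast
      from reflectedD'[OF reflected_adjoint[OF reflected_A0] this]
      show "(u, f) \<in> adjoint {..0} (A0 {..0} a q)" by simp
    qed
    then show ?thesis using neg1 neg2 2 by simp
  qed
qed

text \<open>The assertion at \<open>cnj z\<close> is the deficiency result for the conjugate
  coefficients: conjugation carries \<open>A0\<close> to their minimal operator and a point
  \<open>z\<close> of the regularity domain to \<open>cnj z\<close>.\<close>

lemma halfline_dimensions:
  assumes s: "s = 1 \<or> s = -1" and op: "halfline_operator a (\<lambda>x. q (s * x)) c"
  shows "(\<forall>z \<in> regtype (halfline s) (A0 (halfline s) a q).
        quotdim (L2 (halfline s)) (opran (opshift (A0 (halfline s) a q) z)) 1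
      \<and> quotdim (L2 (halfline s)) (opran (opshift (A0 (halfline s) (cnj a) (\<lambda>x. cnj (q x))) (cnj z))) 1)
    \<and> quotdim (opdom (Amax (halfline s) a q)) (opdom (A0 (halfline s) a q)) 2"
proof -
  interpret halfline_operator a "\<lambda>x. q (s * x)" c by (rule op)
  interpret cj: halfline_operator "cnj a" "\<lambda>x. cnj (q (s * x))" "cnj c" by (rule conj)
  have pos: "quotdim (L2 {0..}) (opran (opshift (A0 {0..} a (\<lambda>x. q (s * x))) z)) 1"
    "quotdim (L2 {0..}) (opran (opshift (A0 {0..} (cnj a) (\<lambda>x. cnj (q (s * x)))) (cnj z))) 1"
    if z: "z \<in> regtype (halfline s) (A0 (halfline s) a q)" for z
  proof -
    have z': "z \<in> regtype {0..} (A0 {0..} a (\<lambda>x. q (s * x)))" using z unfolding regtype_halfline[OF s] .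
    show "quotdim (L2 {0..}) (opran (opshift (A0 {0..} a (\<lambda>x. q (s * x))) z)) 1" by (rule quotdim_range[OF z'])
    show "quotdim (L2 {0..}) (opran (opshift (A0 {0..} (cnj a) (\<lambda>x. cnj (q (s * x)))) (cnj z))) 1"
      by (rule cj.quotdim_range) (use regtype_conjop[OF z'] conjop_A0_eq in simp)
  qed
  show ?thesis using s
  proof (cases rule: halfline_cases)
    case 1
    then show ?thesis using pos quotdim_Amax_A0 by simp
  next
    case 2
    have L: "(\<lambda>x. h (- x)) \<in> L2 {..0} \<longleftrightarrow> h \<in> L2 {0..}" for h by (simp add: L2_reflect)
    have "quotdim (L2 {..0}) (opran (opshift (A0 {..0} a q) z)) 1"
      "quotdim (L2 {..0}) (opran (opshift (A0 {..0} (cnj a) (\<lambda>x. cnj (q x))) (cnj z))) 1"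
      if "z \<in> regtype (halfline s) (A0 (halfline s) a q)" for z
      using pos[OF that] 2
      by (auto intro!: quotdim_reflect[OF L opran_opshift_reflect[OF reflected_A0]])
    moreover have "quotdim (opdom (Amax {..0} a q)) (opdom (A0 {..0} a q)) 2"
      using quotdim_Amax_A0 2
      by (intro quotdim_reflect[OF opdom_reflect[OF reflected_Amax] opdom_reflect[OF reflected_A0]]) simp
    ultimately show ?thesis using 2 by simp
  qed
qed

text \<open>The unit vector \<open>b\<close> for which minus the potential at \<open>s * x\<close>
  equals \<open>b * x ^ (N + 2)\<close>; it spans the second edge of \<open>Qset\<close>.\<close>

definition tau_dir :: "nat \<Rightarrow> real \<Rightarrow> real \<Rightarrow> complex" where
  "tau_dir N s \<phi> = - ((\<i> * of_real s) ^ (N + 2) * exp (of_nat (N + 2) * \<i> * of_real (s * \<phi>)))"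

lemma tau_q_scaled: "tau_q N s \<phi> (s * x) = - tau_dir N s \<phi> * of_real (x ^ (N + 2))"
  unfolding tau_q_def tau_dir_def by (simp add: power_mult_distrib algebra_simps)

lemma cmod_tau:
  assumes "s = 1 \<or> s = -1"
  shows "cmod (tau_a s \<phi>) = 1" "cmod (tau_dir N s \<phi>) = 1"
proof -
  have "cmod (exp (\<i> * of_real t)) = 1" for t :: real by simp
  from this[of "- 2 * (s * \<phi>)"] this[of "of_nat (N + 2) * (s * \<phi>)"]
  have "cmod (exp (- 2 * \<i> * of_real (s * \<phi>))) = 1" "cmod (exp (of_nat (N + 2) * \<i> * of_real (s * \<phi>))) = 1"
    by (simp_all add: algebra_simps)
  then show "cmod (tau_a s \<phi>) = 1" "cmod (tau_dir N s \<phi>) = 1"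
    unfolding tau_a_def tau_dir_def using assms by (auto simp: norm_mult norm_power simp del: power_Suc)
qed

text \<open>Conjugation plays two roles: on one half-line it produces the formal adjoint, and on the
  two edge directions it exchanges the half-lines.\<close>

lemma tau_cnj:
  "cnj (tau_a s \<phi>) = tauplus_a s \<phi>" "(\<lambda>x. cnj (tau_q N s \<phi> x)) = tauplus_q N s \<phi>"
  "tau_a (- s) \<phi> = cnj (tau_a s \<phi>)" "tau_dir N (- s) \<phi> = cnj (tau_dir N s \<phi>)"
proof -
  show "cnj (tau_a s \<phi>) = tauplus_a s \<phi>" "tau_a (- s) \<phi> = cnj (tau_a s \<phi>)"
    "tau_dir N (- s) \<phi> = cnj (tau_dir N s \<phi>)"
    unfolding tau_a_def tauplus_a_def tau_dir_def by (simp_all add: exp_cnj del: power_Suc)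
  show "(\<lambda>x. cnj (tau_q N s \<phi> x)) = tauplus_q N s \<phi>"
  proof
    fix x
    have A: "cnj ((\<i> * of_real x) ^ (N + 2)) = (- \<i> * of_real x) ^ (N + 2)"
      by (simp del: power_Suc)
    have B: "cnj (exp (of_nat (N + 2) * \<i> * of_real (s * \<phi>))) = exp (- of_nat (N + 2) * \<i> * of_real (s * \<phi>))"
      unfolding exp_cnj
      by (simp only: complex_cnj_mult complex_cnj_of_nat complex_cnj_i complex_cnj_complex_of_real mult_minus_left mult_minus_right)
    show "cnj (tau_q N s \<phi> x) = tauplus_q N s \<phi> x"
      unfolding tau_q_def tauplus_q_def complex_cnj_mult[of "(\<i> * of_real x) ^ (N + 2)"] A B ..
  qed
qed

text \<open>If the edges were opposite, two points of the unit circle would coincide. Comparing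
  their arguments modulo \<open>2 * pi\<close> gives a linear equation in \<phi> with solutions
  exactly of the excluded form.\<close>

lemma tau_nondegenerate:
  assumes s: "s = 1 \<or> s = -1"
    and lp: "\<forall>k::int. \<phi> \<noteq> - (real (N + 2) / real (2 * N + 8)) * pi + (2 * real_of_int k / real (N + 4)) * pi"
  shows "tau_a s \<phi> + tau_dir N s \<phi> \<noteq> 0"
proof
  assume "tau_a s \<phi> + tau_dir N s \<phi> = 0"
  have i_exp: "\<i> * of_real s = exp (\<i> * of_real (s * pi / 2))"
    using s by (auto simp: exp_eq_polar cis_conv_exp[symmetric] complex_eq_iff)
  have "tau_a s \<phi> = (\<i> * of_real s) ^ (N + 2) * exp (of_nat (N + 2) * \<i> * of_real (s * \<phi>))"
    using \<open>_ = 0\<close> unfolding tau_dir_def by simp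
  also have "\<dots> = exp (of_nat (N + 2) * (\<i> * of_real (s * pi / 2))) * exp (of_nat (N + 2) * \<i> * of_real (s * \<phi>))"
    unfolding i_exp exp_of_nat_mult ..
  also have "\<dots> = exp (\<i> * of_real (real (N + 2) * (s * pi / 2 + s * \<phi>)))"
    unfolding exp_add[symmetric] by (rule arg_cong[of _ _ exp]) (simp add: algebra_simps)
  finally have "exp (\<i> * of_real (- 2 * s * \<phi>)) = exp (\<i> * of_real (real (N + 2) * (s * pi / 2 + s * \<phi>)))"
    unfolding tau_a_def by (simp add: algebra_simps)
  then obtain n :: int where "\<i> * of_real (- 2 * s * \<phi>) = \<i> * of_real (real (N + 2) * (s * pi / 2 + s * \<phi>)) + (of_int (2 * n) * pi) * \<i>"
    unfolding exp_eq by blast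
  from arg_cong[OF this, of Im] have n: "- 2 * s * \<phi> = real (N + 2) * (s * pi / 2 + s * \<phi>) + of_int (2 * n) * pi"
    by simp
  \<comment> \<open>Multiplying the equation by \<open>s\<close> moves its sign to the
    integer.\<close>
  define k where "k = (if s = 1 then - n else n)"
  have "real (N + 4) * \<phi> = - (real (N + 2) * pi / 2) + 2 * real_of_int k * pi"
    using s n by (auto simp: k_def algebra_simps add_divide_distrib diff_divide_distrib)
  then have "\<phi> = (- (real (N + 2) * pi / 2) + 2 * real_of_int k * pi) / real (N + 4)"
    by (simp add: field_simps)
  also have "\<dots> = - (real (N + 2) / real (2 * N + 8)) * pi + (2 * real_of_int k / real (N + 4)) * pi"
  proof -
    have "(- (A * pi / 2) + 2 * K * pi) / D = - (A / (2 * D)) * pi + (2 * K / D) * pi" if "D \<noteq> 0" for A K D :: real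
      using that by (simp add: field_simps)
    moreover have "real (2 * N + 8) = 2 * real (N + 4)" by simp
    ultimately show ?thesis by (metis of_nat_eq_0_iff add_is_0 zero_neq_numeral)
  qed
  finally show False using lp by blast
qed

lemma Qset_eq_cone2:
  assumes s: "s = 1 \<or> s = -1" and ne: "tau_a s \<phi> + tau_dir N s \<phi> \<noteq> 0"
  shows "Qset N s \<phi> = cone2 (tau_a s \<phi>) (tau_dir N s \<phi>)"
proof -
  have "{tau_a s \<phi> * of_real r - tau_q N s \<phi> x | r x. 0 < r \<and> x \<in> halfline s}
      = {tau_a s \<phi> * of_real r + tau_dir N s \<phi> * of_real t | r t. 0 < r \<and> 0 \<le> t}" (is "?L = ?R")
  proof (intro equalityI subsetI)
    fix z assume "z \<in> ?L"
    then obtain r x where z: "z = tau_a s \<phi> * of_real r - tau_q N s \<phi> x" "0 < r" "0 \<le> s * x"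
      unfolding halfline_def by blast
    have "s * (s * x) = x" using s by auto
    then have "tau_q N s \<phi> x = - tau_dir N s \<phi> * of_real ((s * x) ^ (N + 2))"
      using tau_q_scaled[of N s \<phi> "s * x"] by (simp only:)
    then show "z \<in> ?R" unfolding z(1) using z(2,3)
      by (intro CollectI exI[of _ r] exI[of _ "(s * x) ^ (N + 2)"]) (simp add: zero_le_power del: power_Suc)
  next
    fix z assume "z \<in> ?R"
    then obtain r t where z: "z = tau_a s \<phi> * of_real r + tau_dir N s \<phi> * of_real t" "0 < r" "0 \<le> t" by blast
    \<comment> \<open>Every \<open>t \<ge> 0\<close> is an \<open>(N + 2)\<close>-th power, so the
      potential sweeps out its entire ray.\<close>
    define y where "y = root (N + 2) t"
    have y: "y ^ (N + 2) = t" "0 \<le> y" unfolding y_def using z(3) real_root_pow_pos2[of "N + 2" t] by simp_all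
    have "s * y \<in> halfline s" using s y by (auto simp: halfline_def)
    moreover have "z = tau_a s \<phi> * of_real r - tau_q N s \<phi> (s * y)"
      unfolding tau_q_scaled z(1) y(1) by simp
    ultimately show "z \<in> ?L" using z(2) by blast
  qed
  then show ?thesis unfolding Qset_def
    using closure_hull_cone2[OF cmod_tau(1)[OF s] cmod_tau(2)[OF s] ne] by simp
qed

lemma tau_q_continuous: "continuous_on {0..} (\<lambda>x. tau_q N s \<phi> (s * x))"
  unfolding tau_q_scaled by (intro continuous_intros)

lemma Re_tau_q:
  assumes "0 \<le> Re (c * tau_dir N s \<phi>)" "0 \<le> x"
  shows "Re (c * tau_q N s \<phi> (s * x)) \<le> 0"
proof -
  have "c * tau_q N s \<phi> (s * x) = of_real (x ^ (N + 2)) * (- (c * tau_dir N s \<phi>))"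
    unfolding tau_q_scaled by simp
  then have "Re (c * tau_q N s \<phi> (s * x)) = x ^ (N + 2) * (- Re (c * tau_dir N s \<phi>))"
    by (simp only: Re_complex_of_real Im_complex_of_real times_complex.simps(1) uminus_complex.simps mult_zero_left diff_0_right)
  also have "\<dots> \<le> 0"
    by (rule mult_nonneg_nonpos) (use assms in \<open>simp_all only: zero_le_power neg_le_0_iff_le\<close>)
  finally show ?thesis .
qed

lemma regtype_tau:
  assumes s: "s = 1 \<or> s = -1" and c: "0 \<le> Re (c * tau_a s \<phi>)" "0 \<le> Re (c * tau_dir N s \<phi>)" "Re (c * z) < 0"
  shows "z \<in> regtype (halfline s) (A0 (halfline s) (tau_a s \<phi>) (tau_q N s \<phi>))"
  unfolding regtype_halfline[OF s]
  by (rule regtype_A0[OF tau_q_continuous c(1) Re_tau_q[OF c(2)] c(3)])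

text \<open>A real point lies in both regularity domains: the half-plane directions for the two
  half-lines are conjugate, and a direction with nonzero real part is found by perturbation.\<close>
lemma regtype_tau_common:
  assumes ne: "tau_a 1 \<phi> + tau_dir N 1 \<phi> \<noteq> 0"
  shows "\<exists>z. z \<in> regtype (halfline (-1)) (A0 (halfline (-1)) (tau_a (-1) \<phi>) (tau_q N (-1) \<phi>))
    \<and> z \<in> regtype (halfline 1) (A0 (halfline 1) (tau_a 1 \<phi>) (tau_q N 1 \<phi>))"
proof -
  define a b where "a = tau_a 1 \<phi>" and "b = tau_dir N 1 \<phi>"
  have ab: "cmod a = 1" "cmod b = 1" unfolding a_def b_def using cmod_tau[of 1] by auto
  define c where "c = cnj (a + b)"
  define e where "e = (cmod (a + b))\<^sup>2 / 2"
  have e: "e > 0" using ne by (simp add: e_def a_def b_def)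
  have ca: "Re (c * a) = e" "Re (c * b) = e"
    using Re_cnj_sum_unit[OF ab] Re_cnj_sum_unit[OF ab(2,1)] unfolding c_def e_def by (simp_all add: add.commute)
  \<comment> \<open>A purely imaginary \<open>c\<close> would leave no real point in the open
    half-plane. Adding the real number \<open>e\<close> repairs this, and the products stay
    nonnegative because \<open>Re (c * a)\<close> and \<open>Re (c * b)\<close> equal
    \<open>e\<close> while \<open>Re a\<close> and \<open>Re b\<close> are at least
    \<open>-1\<close>.\<close>
  define d where "d = (if Re c = 0 then c + of_real e else c)"
  have "\<bar>Re a\<bar> \<le> 1" "\<bar>Re b\<bar> \<le> 1" using abs_Re_le_cmod[of a] abs_Re_le_cmod[of b] ab by auto
  then have "e * (- 1) \<le> e * Re a" "e * (- 1) \<le> e * Re b" using e by (intro mult_left_mono; linarith)+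
  moreover have "Re ((c + of_real e) * x) = Re (c * x) + e * Re x" for x by (simp add: algebra_simps)
  ultimately have d: "0 \<le> Re (d * a)" "0 \<le> Re (d * b)" unfolding d_def using ca e by (auto simp del: times_complex.simps)
  have d0: "Re d \<noteq> 0" unfolding d_def using e by auto
  \<comment> \<open>Being real, this point gives the same value \<open>- (Re d * Re d)\<close>
    against \<open>d\<close> and against \<open>cnj d\<close>, and so works on both
    half-lines.\<close>
  define z where "z = complex_of_real (- Re d)"
  have "- (Re d * Re d) < 0" using d0 by (auto simp: mult_pos_pos mult_neg_neg linorder_neq_iff)
  then have z: "Re (d * z) < 0" "Re (cnj d * z) < 0" by (simp_all add: z_def)
  have "z \<in> regtype (halfline 1) (A0 (halfline 1) (tau_a 1 \<phi>) (tau_q N 1 \<phi>))"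
    by (rule regtype_tau[of 1 d]) (use d z a_def b_def in auto)
  moreover have "0 \<le> Re (cnj d * tau_a (-1) \<phi>)" "0 \<le> Re (cnj d * tau_dir N (-1) \<phi>)"
    using d unfolding tau_cnj(3)[of 1] tau_cnj(4)[of N 1] a_def[symmetric] b_def[symmetric] by simp_all
  then have "z \<in> regtype (halfline (-1)) (A0 (halfline (-1)) (tau_a (-1) \<phi>) (tau_q N (-1) \<phi>))"
    using z by (intro regtype_tau[of "-1" "cnj d"]) auto
  ultimately show ?thesis by blast
qed

theorem theorem3:
  fixes N :: nat and \<phi> s :: real
  assumes "N \<ge> 1"
    and "- (pi / 2) < \<phi>" and "\<phi> < pi / 2"
    and "\<forall>k::int. \<phi> \<noteq> - (real (N + 2) / real (2 * N + 8)) * pi + (2 * real_of_int k / real (N + 4)) * pi"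
    and "s = 1 \<or> s = -1"
  defines "S \<equiv> halfline s"
  shows
    "adjoint S (Amax S (tau_a s \<phi>) (tau_q N s \<phi>)) = A0 S (tauplus_a s \<phi>) (tauplus_q N s \<phi>)
     \<and> adjoint S (A0 S (tau_a s \<phi>) (tau_q N s \<phi>)) = Amax S (tauplus_a s \<phi>) (tauplus_q N s \<phi>)
     \<and> conjop (A0 S (tau_a s \<phi>) (tau_q N s \<phi>)) \<subseteq> adjoint S (A0 S (tau_a s \<phi>) (tau_q N s \<phi>))
     \<and> closed_sector_lt_pi (Qset N s \<phi>)
     \<and> - Qset N s \<phi> \<subseteq> regtype S (A0 S (tau_a s \<phi>) (tau_q N s \<phi>))
     \<and> regtype S (A0 S (tau_a s \<phi>) (tau_q N s \<phi>)) \<noteq> {}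
     \<and> regtype (halfline (-1)) (A0 (halfline (-1)) (tau_a (-1) \<phi>) (tau_q N (-1) \<phi>))
         \<inter> regtype (halfline 1) (A0 (halfline 1) (tau_a 1 \<phi>) (tau_q N 1 \<phi>)) \<noteq> {}
     \<and> (\<forall>z \<in> regtype S (A0 S (tau_a s \<phi>) (tau_q N s \<phi>)).
           quotdim (L2 S) (opran (opshift (A0 S (tau_a s \<phi>) (tau_q N s \<phi>)) z)) 1
         \<and> quotdim (L2 S) (opran (opshift (A0 S (tauplus_a s \<phi>) (tauplus_q N s \<phi>)) (cnj z))) 1)
     \<and> quotdim (opdom (Amax S (tau_a s \<phi>) (tau_q N s \<phi>))) (opdom (A0 S (tau_a s \<phi>) (tau_q N s \<phi>))) 2"
proof -
  note s = assms(5)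
  note ne = tau_nondegenerate[OF _ assms(4)]
  note u = cmod_tau[OF s]
  define c where "c = cnj (tau_a s \<phi> + tau_dir N s \<phi>)"
  have pos: "0 < (cmod (tau_a s \<phi> + tau_dir N s \<phi>))\<^sup>2 / 2" using ne[OF s] by simp
  have c: "0 < Re (c * tau_a s \<phi>)" "0 < Re (c * tau_dir N s \<phi>)"
    unfolding c_def using pos Re_cnj_sum_unit[OF u(1) u(2)] Re_cnj_sum_unit[OF u(2) u(1)] by (simp_all only: add.commute)
  have op: "halfline_operator (tau_a s \<phi>) (\<lambda>x. tau_q N s \<phi> (s * x)) c"
    by (rule halfline_operator.intro[OF tau_q_continuous c(1) Re_tau_q[OF less_imp_le[OF c(2)]]])
  note Q = Qset_eq_cone2[OF s ne[OF s]]
  have reg: "- Qset N s \<phi> \<subseteq> regtype S (A0 S (tau_a s \<phi>) (tau_q N s \<phi>))"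
  proof
    fix z assume "z \<in> - Qset N s \<phi>"
    then have "z \<notin> cone2 (tau_a s \<phi>) (tau_dir N s \<phi>)" unfolding Q by simp
    from cone2_separation[OF u(1) u(2) ne[OF s] this]
    show "z \<in> regtype S (A0 S (tau_a s \<phi>) (tau_q N s \<phi>))"
      unfolding S_def using regtype_tau[OF s] by blast
  qed
  have common: "regtype (halfline (-1)) (A0 (halfline (-1)) (tau_a (-1) \<phi>) (tau_q N (-1) \<phi>))
         \<inter> regtype (halfline 1) (A0 (halfline 1) (tau_a 1 \<phi>) (tau_q N 1 \<phi>)) \<noteq> {}"
    using regtype_tau_common[OF ne] by blast
  then have nonempty: "regtype S (A0 S (tau_a s \<phi>) (tau_q N s \<phi>)) \<noteq> {}"
    unfolding S_def using s by blast
  show ?thesis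
    using halfline_adjoints[OF s op, folded S_def] halfline_dimensions[OF s op, folded S_def]
      closed_sector_cone2[OF u(1) u(2) ne[OF s]] reg common nonempty
    unfolding tau_cnj Q by blast
qed

end
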